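(* Let $\mathbf{T}=(T_1,\dots,T_m)\in\mathcal{B}_n^m(\mathbb{B}_m)$ and consider the operator tuple $\mathbf{M}_z^*=(M_{z_1}^*,\dots,M_{z_m}^* )\in\mathcal{B}_{n_1}^m(\mathbb{B}_m)$ on a Hilbert space $\mathcal{H}_K$ defined on $\mathbb{B}_m$ with reproducing kernel $K$. Suppose that $n_2:=n/n_1\in\mathbb{N}$ and that there exist an isometry $V$ and a Hermitian holomorphic vector bundle $\mathcal{E}$ over $\mathbb{B}_m$ such that $$VK_{\mathbf{T},w^I\overline{w}^J}V^*-K_{\mathbf{M}_z^*,w^I\overline{w}^J}\otimes I_{n_2}=I_{n_1}\otimes K_{\mathcal{E},w^I\overline{w}^J},\qquad I,J\in\mathbb{N}_0^m.$$ If the bundle $\mathcal{E}$ satisfies condition $(\mathbf{C})$ via $\mathcal{H}_K$, then $\mathbf{T}\sim_s\bigoplus_1^{n_2}\mathbf{M}_z^*$.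
   Context: $\mathbb{B}_m$ is the open unit ball of $\mathbb{C}^m$. For a commuting tuple $\mathbf{T}=(T_1,\dots,T_m)\in\mathcal{L}(\mathcal{H})^m$ on a complex separable Hilbert space let $\mathscr{D}_{\mathbf{T}}h=(T_1h,\dots,T_mh)$ and $\mathbf{T}-w=(T_1-w_1,\dots,T_m-w_m)$, so $\ker\mathscr{D}_{\mathbf{T}-w}=\bigcap_i\ker(T_i-w_i)$. For a bounded domain $\Omega\subset\mathbb{C}^m$, $\mathcal{B}_n^m(\Omega)$ consists of commuting $m$-tuples with (1) $\operatorname{ran}\mathscr{D}_{\mathbf{T}-w}$ closed, (2) $\dim\ker\mathscr{D}_{\mathbf{T}-w}=n$ for all $w\in\Omega$, and (3) the span of $\bigcup_{w\in\Omega}\ker\mathscr{D}_{\mathbf{T}-w}$ dense in $\mathcal{H}$. $\mathcal{E}_{\mathbf{T}}$ is the rank $n$ Hermitian holomorphic vector bundle over $\Omega$ with fibre $\ker\mathscr{D}_{\mathbf{T}-w}$ and metric inherited from $\mathcal{H}$. $\mathcal{H}_K$ is a reproducing kernel Hilbert space of $\mathbb{C}^{n_1}$-valued holomorphic functions on $\mathbb{B}_m$, $M_{z_i}$ is multiplication by $z_i$, and $\ker(\mathbf{M}_z^*-w)=\{K(\cdot,\overline{w})\xi:\xi\in\mathbb{C}^{n_1}\}$. Curvature: for a Hermitian holomorphic vector bundle $\mathcal{E}$ with holomorphic frame $\{\sigma_i\}$ and Gram matrix $h=(\langle\sigma_j,\sigma_i\rangle)_{i,j}$, the curvature matrix $K_{\mathcal{E}}$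 has (matrix-valued) entries $K_{\mathcal{E}}^{i,j}=-\frac{\partial}{\partial\overline{w}_j}\left(h^{-1}\frac{\partial h}{\partial w_i}\right)$, $1\le i,j\le m$. Its covariant derivatives, computed entrywise, are defined recursively by $K_{\mathcal{E},w^{I+e_j}}=\frac{\partial}{\partial w_j}K_{\mathcal{E},w^I}+\left[h^{-1}\frac{\partial h}{\partial w_j},K_{\mathcal{E},w^I}\right]$ and $K_{\mathcal{E},w^I\overline{w}^{J+e_j}}=\frac{\partial}{\partial\overline{w}_j}K_{\mathcal{E},w^I\overline{w}^J}$, starting from $K_{\mathcal{E}}$, where $e_j$ is the $j$-th unit multi-index. For an operator tuple, $K_{\mathbf{T},w^I\overline{w}^J}:=K_{\mathcal{E}_{\mathbf{T}},w^I\overline{w}^J}$. These matrices represent endomorphisms of the fibres, and $\otimes I$, $I\otimes$ are applied to each $(i,j)$ entry. Here $\mathcal{E}$ has rank $n_2$, and the isometry $V$ is understood, as in Cowen-Douglas theory, as a smooth fibrewise isometric bundle map $V(w):\mathcal{E}_{\mathbf{T}}(w)\to(\mathcal{E}_{\mathbf{M}_z^*}\otimes\mathcal{E})(w)$ (acting on each $(i,j)$ entry). Multipliers: for Hilbert spaces $E_1,E_2$, $\mathrm{Mult}(\mathcal{H}_K\otimes E_1,\mathcal{H}_K\otimes E_2)$ is the set of functions $\Phi:\mathbb{B}_m\to\mathcal{L}(E_1,E_2)$ for which pointwise multiplication $(M_\Phi h)(z)=\Phi(z)h(z)$ (with $\Phi(z)$ acting on the $E_1$ tensor factor) maps $\mathcal{H}_K\otimes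 E_1$ into $\mathcal{H}_K\otimes E_2$. $H^\infty_{E_1\to E_2}(\Omega)$ denotes bounded analytic $\mathcal{L}(E_1,E_2)$-valued functions. Condition $(\mathbf{C})$: let $\mathcal{E}$ be a Hermitian holomorphic bundle of rank $r$ over $\Omega$ whose fibres are $\mathcal{E}(w)=\operatorname{span}\{f_1(w),\dots,f_r(w)\}$ for a holomorphic frame of Hilbert-space-valued analytic functions $f_1,\dots,f_r$; let $E$ be the closed span of all $f_i(w)$, $w\in\Omega$, and $\{\sigma_i\}_{i=1}^r$ an orthonormal basis of $\mathbb{C}^r$. Then $\mathcal{E}$ satisfies condition $(\mathbf{C})$ via a Hilbert function space $\mathcal{H}$ if there exist (for such a frame) $F\in H^\infty_{\mathbb{C}^r\to E}(\Omega)$ and $G\in H^\infty_{E\to\mathbb{C}^r}(\Omega)$ such that, with $F^\#(\overline{w}):=F(w)$ and $G^\#(\overline{w}):=G(w)$, one has $F(w)\sigma_i=f_i(w)$, $(F^\#)^*\in\mathrm{Mult}(\mathcal{H}\otimes E,\mathcal{H}\otimes\mathbb{C}^r)$, $(G^\#)^*\in\mathrm{Mult}(\mathcal{H}\otimes\mathbb{C}^r,\mathcal{H}\otimes E)$, and $G^\#(\overline{w})F^\#(\overline{w})\equiv I$ for all $w\in\Omega$. Here $(F^\#)^*(z)=F^\#(z)^*$. $\mathbf{T}\sim_s\mathbf{S}$ means there is a bounded invertible operator $X$ between the underlying spaces with $XT_i=S_iX$ for all $i$. *)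

theory Defs
  imports "HOL-Analysis.Analysis"
begin

section \<open>Complex Hilbert spaces\<close>

text \<open>The inner product is linear in the first argument. The topology and the norm are those of the
  underlying real inner product space, whose inner product is the real part of \<open>cinner\<close>.\<close>

class complex_inner = real_inner +
  fixes scaleC :: "complex \<Rightarrow> 'a \<Rightarrow> 'a" (infixr "*\<^sub>C" 75)
    and cinner :: "'a \<Rightarrow> 'a \<Rightarrow> complex"
  assumes scaleC_add_right: "a *\<^sub>C (x + y) = a *\<^sub>C x + a *\<^sub>C y"
    and scaleC_add_left: "(a + b) *\<^sub>C x = a *\<^sub>C x + b *\<^sub>C x"
    and scaleC_scaleC: "a *\<^sub>C b *\<^sub>C x = (a * b) *\<^sub>C x"
    and scaleR_scaleC: "r *\<^sub>R x = complex_of_real r *\<^sub>C x"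
    and cinner_commute: "cinner x y = cnj (cinner y x)"
    and cinner_add_left: "cinner (x + y) z = cinner x z + cinner y z"
    and cinner_scaleC_left: "cinner (a *\<^sub>C x) y = a * cinner x y"
    and inner_Re_cinner: "inner x y = Re (cinner x y)"

class complex_hilbert = complex_inner + complete_space

global_interpretation complex_vector:
  vector_space "scaleC :: complex \<Rightarrow> 'a \<Rightarrow> 'a::complex_inner"
  defines cspan = complex_vector.span
    and cindependent = "\<lambda>S. \<not> complex_vector.dependent S"
    and cdim = complex_vector.dim
proof
  show "1 *\<^sub>C x = x" for x :: 'a
    using scaleR_scaleC[of 1 x] by simp
qed (simp_all add: scaleC_add_right scaleC_add_left scaleC_scaleC)

instantiation complex :: complex_hilbert
begin
definition "scaleC_complex (a::complex) (x::complex) = a * x"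
definition "cinner_complex (x::complex) (y::complex) = x * cnj y"
instance
  by standard
    (simp_all add: scaleC_complex_def cinner_complex_def algebra_simps scaleR_conv_of_real
      inner_complex_def)
end

instantiation vec :: (complex_inner, finite) complex_inner
begin
definition "scaleC_vec (a::complex) (x::'a^'b) = (\<chi> i. a *\<^sub>C x $ i)"
definition "cinner_vec (x::'a^'b) (y::'a^'b) = (\<Sum>i\<in>UNIV. cinner (x $ i) (y $ i))"
instance
proof
  fix x y :: "'a^'b"
  have "(\<Sum>i\<in>UNIV. cinner (x $ i) (y $ i)) = (\<Sum>i\<in>UNIV. cnj (cinner (y $ i) (x $ i)))"
    by (intro sum.cong refl cinner_commute)
  then show "cinner x y = cnj (cinner y x)"
    by (simp add: cinner_vec_def)
qed (simp_all add: scaleC_vec_def cinner_vec_def vec_eq_iff scaleC_add_right scaleC_add_left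
      scaleC_scaleC scaleR_scaleC cinner_add_left cinner_scaleC_left inner_Re_cinner sum.distrib
      sum_distrib_left inner_vec_def)
end

instance vec :: (complex_hilbert, finite) complex_hilbert ..

definition orthonormal_on :: "'i set \<Rightarrow> ('i \<Rightarrow> 'a::complex_inner) \<Rightarrow> bool" where
  "orthonormal_on N e \<longleftrightarrow>
     (\<forall>i\<in>N. \<forall>j\<in>N. cinner (e i) (e j) = (if i = j then 1 else 0))"

text \<open>Bounded operators between subspaces \<open>S\<^sub>1\<close> and \<open>S\<^sub>2\<close>; the values outside \<open>S\<^sub>1\<close> are
  irrelevant.\<close>

definition bounded_op_on ::
    "'a::complex_inner set \<Rightarrow> 'b::complex_inner set \<Rightarrow> ('a \<Rightarrow> 'b) \<Rightarrow> bool" where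
  "bounded_op_on S\<^sub>1 S\<^sub>2 A \<longleftrightarrow>
     (\<forall>x\<in>S\<^sub>1. A x \<in> S\<^sub>2) \<and>
     (\<forall>x\<in>S\<^sub>1. \<forall>y\<in>S\<^sub>1. A (x + y) = A x + A y) \<and>
     (\<forall>c. \<forall>x\<in>S\<^sub>1. A (c *\<^sub>C x) = c *\<^sub>C A x) \<and>
     (\<exists>B. \<forall>x\<in>S\<^sub>1. norm (A x) \<le> B * norm x)"

abbreviation bounded_op :: "('a::complex_inner \<Rightarrow> 'b::complex_inner) \<Rightarrow> bool" where
  "bounded_op \<equiv> bounded_op_on UNIV UNIV"

text \<open>The adjoint of an operator with domain \<open>S\<close>; it takes its values in \<open>S\<close>.\<close>

definition adjoint_on ::
    "'a::complex_inner set \<Rightarrow> ('a \<Rightarrow> 'b::complex_inner) \<Rightarrow> 'b \<Rightarrow> 'a" where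
  "adjoint_on S A y = (THE u. u \<in> S \<and> (\<forall>x\<in>S. cinner (A x) y = cinner x u))"

text \<open>\<open>tens\<close> exhibits \<open>'t\<close> as the Hilbert space tensor product of \<open>'k\<close> and \<open>'e\<close>. These
  properties determine \<open>'t\<close> and \<open>tens\<close> up to a unique unitary.\<close>

definition hilbert_tensor ::
    "('k::complex_hilbert \<Rightarrow> 'e::complex_hilbert \<Rightarrow> 't::complex_hilbert) \<Rightarrow> bool" where
  "hilbert_tensor tens \<longleftrightarrow>
     (\<forall>k k' e. tens (k + k') e = tens k e + tens k' e) \<and>
     (\<forall>k e e'. tens k (e + e') = tens k e + tens k e') \<and>
     (\<forall>c k e. tens (c *\<^sub>C k) e = c *\<^sub>C tens k e) \<and>
     (\<forall>c k e. tens k (c *\<^sub>C e) = c *\<^sub>C tens k e) \<and>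
     (\<forall>k k' e e'. cinner (tens k e) (tens k' e') = cinner k k' * cinner e e') \<and>
     closure (cspan {tens k e |k e. True}) = UNIV"


section \<open>Holomorphic and smooth maps on open subsets of complex Euclidean space\<close>

definition holo_on :: "(complex^'m) set \<Rightarrow> (complex^'m \<Rightarrow> 'a::complex_inner) \<Rightarrow> bool" where
  "holo_on U f \<longleftrightarrow>
     (\<forall>w\<in>U. \<exists>D. (f has_derivative D) (at w) \<and> (\<forall>c v. D (c *\<^sub>C v) = c *\<^sub>C D v))"

primrec Ck_on ::
    "nat \<Rightarrow> 'a::real_normed_vector set \<Rightarrow> ('a \<Rightarrow> 'b::real_normed_vector) \<Rightarrow> bool" where
  "Ck_on 0 U f \<longleftrightarrow> continuous_on U f"
| "Ck_on (Suc k) U f \<longleftrightarrow>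
     (\<forall>x\<in>U. f differentiable (at x)) \<and> (\<forall>v. Ck_on k U (\<lambda>x. frechet_derivative f (at x) v))"

definition smooth_on ::
    "'a::euclidean_space set \<Rightarrow> ('a \<Rightarrow> 'b::real_normed_vector) \<Rightarrow> bool" where
  "smooth_on U f \<longleftrightarrow> (\<forall>k. Ck_on k U f)"

definition dz :: "'m \<Rightarrow> (complex^'m \<Rightarrow> 'a::complex_inner) \<Rightarrow> complex^'m \<Rightarrow> 'a" where
  "dz i f w = (1/2) *\<^sub>C (frechet_derivative f (at w) (axis i 1)
                     - \<i> *\<^sub>C frechet_derivative f (at w) (axis i \<i>))"

definition dzbar :: "'m \<Rightarrow> (complex^'m \<Rightarrow> 'a::complex_inner) \<Rightarrow> complex^'m \<Rightarrow> 'a" where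
  "dzbar i f w = (1/2) *\<^sub>C (frechet_derivative f (at w) (axis i 1)
                     + \<i> *\<^sub>C frechet_derivative f (at w) (axis i \<i>))"

text \<open>Bounded functions with values in the operators from \<open>S\<^sub>1\<close> to \<open>S\<^sub>2\<close> that are complex Frechet
  differentiable in the operator norm.\<close>

definition Hinf ::
    "(complex^'m) set \<Rightarrow> 'a::complex_inner set \<Rightarrow> 'b::complex_inner set \<Rightarrow>
     (complex^'m \<Rightarrow> 'a \<Rightarrow> 'b) \<Rightarrow> bool" where
  "Hinf \<Omega> S\<^sub>1 S\<^sub>2 \<Phi> \<longleftrightarrow>
     (\<forall>w\<in>\<Omega>. bounded_op_on S\<^sub>1 S\<^sub>2 (\<Phi> w)) \<and>
     (\<exists>B. \<forall>w\<in>\<Omega>. \<forall>x\<in>S\<^sub>1. norm (\<Phi> w x) \<le> B * norm x) \<and>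
     (\<forall>w\<in>\<Omega>. \<exists>D.
        (\<forall>v. bounded_op_on S\<^sub>1 S\<^sub>2 (D v)) \<and>
        (\<forall>v v'. \<forall>x\<in>S\<^sub>1. D (v + v') x = D v x + D v' x) \<and>
        (\<forall>c v. \<forall>x\<in>S\<^sub>1. D (c *\<^sub>C v) x = c *\<^sub>C D v x) \<and>
        (\<forall>\<epsilon>>0. \<exists>\<delta>>0. \<forall>v. norm v < \<delta> \<longrightarrow>
           (\<forall>x\<in>S\<^sub>1. norm (\<Phi> (w + v) x - \<Phi> w x - D v x) \<le> \<epsilon> * norm v * norm x)))"


section \<open>Hermitian holomorphic vector bundles\<close>

text \<open>A bundle is given by its fibres, which are subspaces of a Hilbert space and carry the inherited
  metric; its rank is the cardinality of the index type \<open>'n\<close> of its frames.\<close>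

definition holo_frame ::
    "(complex^'m) set \<Rightarrow> (complex^'m \<Rightarrow> 'a::complex_inner set) \<Rightarrow>
     ('n::finite \<Rightarrow> complex^'m \<Rightarrow> 'a) \<Rightarrow> bool" where
  "holo_frame U E \<sigma> \<longleftrightarrow> open U \<and> (\<forall>i. holo_on U (\<sigma> i)) \<and>
     (\<forall>w\<in>U. inj (\<lambda>i. \<sigma> i w) \<and> cindependent (range (\<lambda>i. \<sigma> i w)) \<and>
            cspan (range (\<lambda>i. \<sigma> i w)) = E w)"

definition hermitian_holo_bundle ::
    "'n::finite itself \<Rightarrow> (complex^'m) set \<Rightarrow> (complex^'m \<Rightarrow> 'a::complex_inner set) \<Rightarrow> bool" where
  "hermitian_holo_bundle n \<Omega> E \<longleftrightarrow>
     (\<forall>w\<in>\<Omega>. \<exists>U. w \<in> U \<and> U \<subseteq> \<Omega> \<and> (\<exists>\<sigma> :: 'n \<Rightarrow> complex^'m \<Rightarrow> 'a. holo_frame U E \<sigma>))"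

definition gram ::
    "('n::finite \<Rightarrow> complex^'m \<Rightarrow> 'a::complex_inner) \<Rightarrow> complex^'m \<Rightarrow> complex^'n^'n" where
  "gram \<sigma> w = (\<chi> i j. cinner (\<sigma> j w) (\<sigma> i w))"

definition connection ::
    "(complex^'m \<Rightarrow> complex^'n^'n) \<Rightarrow> 'm \<Rightarrow> complex^'m \<Rightarrow> complex^'n^'n" where
  "connection h i w = matrix_inv (h w) ** dz i h w"

definition curvature_matrix ::
    "(complex^'m \<Rightarrow> complex^'n^'n) \<Rightarrow> 'm \<Rightarrow> 'm \<Rightarrow> complex^'m \<Rightarrow> complex^'n^'n" where
  "curvature_matrix h i j w = - dzbar j (connection h i) w"

text \<open>A multi-index is represented by a list \<open>I\<close> of coordinate indices, in which \<open>j\<close> occurs as often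
  as the \<open>j\<close>-th entry says, and adding the \<open>j\<close>-th unit multi-index is \<open>j # I\<close>. The order of the list
  does not matter: the \<open>dzbar j\<close> commute, and so do the holomorphic covariant derivatives, since the
  curvature of the metric connection has type (1,1).\<close>

primrec covariant_dz ::
    "(complex^'m \<Rightarrow> complex^'n^'n) \<Rightarrow> (complex^'m \<Rightarrow> complex^'n^'n) \<Rightarrow> 'm list \<Rightarrow>
     complex^'m \<Rightarrow> complex^'n^'n" where
  "covariant_dz h M [] = M"
| "covariant_dz h M (j # I) =
     (\<lambda>w. dz j (covariant_dz h M I) w +
          (connection h j w ** covariant_dz h M I w - covariant_dz h M I w ** connection h j w))"

primrec covariant_dzbar ::
    "(complex^'m \<Rightarrow> complex^'n^'n) \<Rightarrow> 'm list \<Rightarrow> complex^'m \<Rightarrow> complex^'n^'n" where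
  "covariant_dzbar M [] = M"
| "covariant_dzbar M (j # J) = dzbar j (covariant_dzbar M J)"

definition curvature_derivative_matrix ::
    "(complex^'m \<Rightarrow> complex^'n^'n) \<Rightarrow> 'm list \<Rightarrow> 'm list \<Rightarrow> 'm \<Rightarrow> 'm \<Rightarrow>
     complex^'m \<Rightarrow> complex^'n^'n" where
  "curvature_derivative_matrix h I J i j =
     covariant_dzbar (covariant_dz h (curvature_matrix h i j) I) J"

text \<open>The endomorphism of the fibre at \<open>w\<close> with matrix \<open>M\<close> in the frame \<open>\<sigma>\<close>.\<close>

definition frame_endo ::
    "('n::finite \<Rightarrow> complex^'m \<Rightarrow> 'a::complex_inner) \<Rightarrow> complex^'m \<Rightarrow> complex^'n^'n \<Rightarrow> 'a \<Rightarrow> 'a" where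
  "frame_endo \<sigma> w M x =
     (let c = (THE c :: complex^'n. x = (\<Sum>j\<in>UNIV. (c $ j) *\<^sub>C \<sigma> j w))
      in \<Sum>i\<in>UNIV. ((M *v c) $ i) *\<^sub>C \<sigma> i w)"

text \<open>The \<open>(i,j)\<close> entry of the covariant derivative of the curvature, as an endomorphism of the fibre
  at \<open>w\<close>. It does not depend on the holomorphic frame chosen near \<open>w\<close>, because the matrices of two
  frames are conjugate by the change of frame.\<close>

definition curvature_endo ::
    "'n::finite itself \<Rightarrow> (complex^'m \<Rightarrow> 'a::complex_inner set) \<Rightarrow> 'm list \<Rightarrow> 'm list \<Rightarrow>
     'm \<Rightarrow> 'm \<Rightarrow> complex^'m \<Rightarrow> 'a \<Rightarrow> 'a" where
  "curvature_endo n E I J i j w =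
     (let \<sigma> = (SOME \<sigma> :: 'n \<Rightarrow> complex^'m \<Rightarrow> 'a. \<exists>U. w \<in> U \<and> holo_frame U E \<sigma>)
      in frame_endo \<sigma> w (curvature_derivative_matrix (gram \<sigma>) I J i j w))"

definition tensor_bundle ::
    "('k::complex_inner \<Rightarrow> 'e::complex_inner \<Rightarrow> 't::complex_inner) \<Rightarrow>
     (complex^'m \<Rightarrow> 'k set) \<Rightarrow> (complex^'m \<Rightarrow> 'e set) \<Rightarrow> complex^'m \<Rightarrow> 't set" where
  "tensor_bundle tens E\<^sub>1 E\<^sub>2 w = cspan {tens k e |k e. k \<in> E\<^sub>1 w \<and> e \<in> E\<^sub>2 w}"

definition isometric_bundle_map ::
    "(complex^'m) set \<Rightarrow> (complex^'m \<Rightarrow> 'a::complex_inner set) \<Rightarrow>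
     (complex^'m \<Rightarrow> 'b::complex_inner set) \<Rightarrow> (complex^'m \<Rightarrow> 'a \<Rightarrow> 'b) \<Rightarrow> bool" where
  "isometric_bundle_map \<Omega> E\<^sub>1 E\<^sub>2 V \<longleftrightarrow>
     (\<forall>w\<in>\<Omega>. bounded_op_on (E\<^sub>1 w) (E\<^sub>2 w) (V w) \<and> (\<forall>x\<in>E\<^sub>1 w. norm (V w x) = norm x)) \<and>
     (\<forall>U s. open U \<and> U \<subseteq> \<Omega> \<and> holo_on U s \<and> (\<forall>w\<in>U. s w \<in> E\<^sub>1 w) \<longrightarrow>
        smooth_on U (\<lambda>w. V w (s w)))"


section \<open>Operator tuples\<close>

definition joint_ker :: "('m \<Rightarrow> 'a::complex_inner \<Rightarrow> 'a) \<Rightarrow> complex^'m \<Rightarrow> 'a set" where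
  "joint_ker T w = {x. \<forall>i. T i x - (w $ i) *\<^sub>C x = 0}"

definition cowen_douglas ::
    "(complex^'m) set \<Rightarrow> nat \<Rightarrow> ('m::finite \<Rightarrow> 'a::complex_hilbert \<Rightarrow> 'a) \<Rightarrow> bool" where
  "cowen_douglas \<Omega> n T \<longleftrightarrow>
     0 < n \<and>
     (\<forall>i. bounded_op (T i)) \<and>
     (\<forall>i j x. T i (T j x) = T j (T i x)) \<and>
     (\<forall>w\<in>\<Omega>. closed (range (\<lambda>x. \<chi> i. T i x - (w $ i) *\<^sub>C x))) \<and>
     (\<forall>w\<in>\<Omega>. cdim (joint_ker T w) = n) \<and>
     closure (cspan (\<Union>w\<in>\<Omega>. joint_ker T w)) = UNIV"

definition similar ::
    "('m \<Rightarrow> 'a::complex_inner \<Rightarrow> 'a) \<Rightarrow> ('m \<Rightarrow> 'b::complex_inner \<Rightarrow> 'b) \<Rightarrow> bool" where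
  "similar T S \<longleftrightarrow>
     (\<exists>X Y. bounded_op X \<and> bounded_op Y \<and> (\<forall>x. Y (X x) = x) \<and> (\<forall>y. X (Y y) = y) \<and>
            (\<forall>i x. X (T i x) = S i (X x)))"

definition direct_sum_copies ::
    "('m \<Rightarrow> 'a \<Rightarrow> 'a) \<Rightarrow> 'm \<Rightarrow> 'a^'r \<Rightarrow> 'a^'r" where
  "direct_sum_copies S i x = (\<chi> l. S i (x $ l))"


section \<open>Reproducing kernel Hilbert spaces on the unit ball and their multipliers\<close>

abbreviation unit_ball :: "(complex^'m) set" where
  "unit_ball \<equiv> ball 0 1"

text \<open>The Hilbert space \<open>'k\<close> is a space of functions on the unit ball through \<open>ev\<close>: the vector \<open>f\<close> is
  the function \<open>ev f\<close>, of which only the values on the unit ball count.\<close>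

definition rkhs ::
    "('k::complex_hilbert \<Rightarrow> complex^'m \<Rightarrow> complex^'d) \<Rightarrow>
     (complex^'m \<Rightarrow> complex^'m \<Rightarrow> complex^'d^'d) \<Rightarrow> bool" where
  "rkhs ev K \<longleftrightarrow>
     (\<forall>f g. \<forall>z\<in>unit_ball. ev (f + g) z = ev f z + ev g z) \<and>
     (\<forall>c f. \<forall>z\<in>unit_ball. ev (c *\<^sub>C f) z = c *\<^sub>C ev f z) \<and>
     (\<forall>f. (\<forall>z\<in>unit_ball. ev f z = 0) \<longrightarrow> f = 0) \<and>
     (\<forall>f. holo_on unit_ball (ev f)) \<and>
     (\<forall>w\<in>unit_ball. \<forall>\<xi>. \<exists>k. (\<forall>z\<in>unit_ball. ev k z = K z w *v \<xi>) \<and>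
                            (\<forall>f. cinner f k = cinner (ev f w) \<xi>))"

definition mult_coord ::
    "('k \<Rightarrow> complex^'m \<Rightarrow> complex^'d) \<Rightarrow> 'm::finite \<Rightarrow> 'k \<Rightarrow> 'k" where
  "mult_coord ev i f = (THE g. \<forall>z\<in>unit_ball. ev g z = (z $ i) *\<^sub>C ev f z)"

definition mult_coord_adjoint ::
    "('k::complex_hilbert \<Rightarrow> complex^'m \<Rightarrow> complex^'d) \<Rightarrow> 'm::finite \<Rightarrow> 'k \<Rightarrow> 'k" where
  "mult_coord_adjoint ev i = adjoint_on UNIV (mult_coord ev i)"

text \<open>The Hilbert space tensor product of the function space given by \<open>ev\<close> with a separable closed
  subspace \<open>S\<close>, as a space of functions with values in the tensor product of \<open>complex^'d\<close> and \<open>S\<close>,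
  which is \<open>S\<^sup>d\<close>: its elements are the orthogonal sums of \<open>h k \<otimes> e k\<close> with \<open>e\<close> orthonormal in \<open>S\<close> and
  the squared norms of the \<open>h k\<close> summable.\<close>

definition tensor_functions ::
    "('k::complex_hilbert \<Rightarrow> complex^'m \<Rightarrow> complex^'d) \<Rightarrow> 'e::complex_inner set \<Rightarrow>
     (complex^'m \<Rightarrow> 'e^'d) set" where
  "tensor_functions ev S =
     {F. \<exists>(N :: nat set) h e. e ` N \<subseteq> S \<and> orthonormal_on N e \<and>
           (\<lambda>k. (norm (h k))\<^sup>2) summable_on N \<and>
           (\<forall>z\<in>unit_ball. ((\<lambda>k. \<chi> a. (ev (h k) z $ a) *\<^sub>C e k) has_sum F z) N)}"

definition Mult ::
    "('k::complex_hilbert \<Rightarrow> complex^'m \<Rightarrow> complex^'d) \<Rightarrow> 'a::complex_inner set \<Rightarrow>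
     'b::complex_inner set \<Rightarrow> (complex^'m \<Rightarrow> 'a \<Rightarrow> 'b) set" where
  "Mult ev S\<^sub>1 S\<^sub>2 =
     {\<Phi>. (\<forall>z\<in>unit_ball. bounded_op_on S\<^sub>1 S\<^sub>2 (\<Phi> z)) \<and>
         (\<forall>F\<in>tensor_functions ev S\<^sub>1. (\<lambda>z. \<chi> a. \<Phi> z (F z $ a)) \<in> tensor_functions ev S\<^sub>2)}"

definition cnj_vec :: "complex^'m \<Rightarrow> complex^'m" where
  "cnj_vec z = (\<chi> i. cnj (z $ i))"

definition condition_C ::
    "'r::finite itself \<Rightarrow> ('k::complex_hilbert \<Rightarrow> complex^'m \<Rightarrow> complex^'d) \<Rightarrow>
     (complex^'m \<Rightarrow> 'e::complex_hilbert set) \<Rightarrow> bool" where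
  "condition_C r ev E \<longleftrightarrow>
     (\<exists>(f :: 'r \<Rightarrow> complex^'m \<Rightarrow> 'e) (\<sigma> :: 'r \<Rightarrow> complex^'r).
        holo_frame unit_ball E f \<and> orthonormal_on UNIV \<sigma> \<and>
        (let S = closure (cspan (\<Union>w\<in>unit_ball. range (\<lambda>i. f i w)))
         in \<exists>F G. Hinf unit_ball UNIV S F \<and> Hinf unit_ball S UNIV G \<and>
              (\<forall>w\<in>unit_ball. \<forall>i. F w (\<sigma> i) = f i w) \<and>
              (\<lambda>z. adjoint_on UNIV (F (cnj_vec z))) \<in> Mult ev S UNIV \<and>
              (\<lambda>z. adjoint_on S (G (cnj_vec z))) \<in> Mult ev UNIV S \<and>
              (\<forall>w\<in>unit_ball. \<forall>x. G w (F w x) = x)))"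

end

theory Submission
  imports Defs "HOL-Complex_Analysis.Conformal_Mappings"
begin

text \<open>
  The two bundles are compared through Taylor expansions at \<open>0\<close>. A holomorphic frame \<open>\<sigma>\<close> with values in a
  Hilbert space has a polarized Gram matrix \<open>H (z, u)\<close> with entries \<open>cinner (\<sigma> j z) (\<sigma> i (cnj u))\<close>; it is
  holomorphic in \<open>z\<close> and \<open>u\<close> and is the metric for \<open>u = cnj z\<close>. Multiplying \<open>H\<close> from the left by a
  function of \<open>u\<close> does not change the connection \<open>H\<^sup>-\<^sup>1 \<partial>H/\<partial>z\<close>, so \<open>H\<close> may be replaced by a matrix \<open>B\<close> that
  is the identity for \<open>z = 0\<close>. Conjugation by \<open>B\<close> turns covariant into ordinary differentiation, and the
  covariant derivatives of the curvature at \<open>0\<close> are, up to sign, Taylor coefficients of the logarithmic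
  derivatives \<open>\<partial>B/\<partial>u B\<^sup>-\<^sup>1\<close> (\<open>curvature_derivative_polarized\<close>). These are additive for tensor products.
  If \<open>A\<close> is the matrix of the isometry at \<open>0\<close>, the hypothesis therefore says that \<open>A\<close> conjugates all Taylor
  coefficients of one family of logarithmic derivatives to those of the other. So \<open>A\<close> conjugates the
  logarithmic derivatives, the metrics differ by a factor depending on \<open>z\<close> only
  (\<open>normalized_metrics_rigid\<close>), and this factor is a change of frame after which the two polarized Gram
  matrices coincide near \<open>0\<close> (\<open>local_equivalence\<close>).

  Equality of polarized Gram matrices means that the eigenvectors \<open>\<sigma> j z\<close> of \<open>T\<close> and certain combinations of
  vectors \<open>k \<otimes> x\<close>, with \<open>k\<close> an eigenvector of \<open>Mz\<close> and \<open>x \<in> E z\<close>, have the same inner products. For this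
  argument the joint eigenspaces must have holomorphic frames, which follows from closed range and
  constant dimension by the open mapping theorem (\<open>joint_ker_frame\<close>), and the eigenvectors near \<open>0\<close> must
  be total, which is the identity theorem (\<open>dense_eigenspaces_small_ball\<close>).

  Condition (C) maps \<open>k \<otimes> x\<close> to \<open>k \<otimes> G z x\<close>, an eigenvector of the direct sum of copies of \<open>Mz\<close>. The
  adjoint of multiplication by the conjugate of \<open>G\<close> bounds this map above, that of \<open>F\<close> bounds it
  below (\<open>multiplier_adjoint_bound\<close>, \<open>condition_C_bounds\<close>). Hence eigenvectors of \<open>T\<close> and of the direct sum
  form total families with comparable combinations and equal eigenvalues, and the correspondence between
  them extends to a similarity (\<open>similar_of_eigenvectors\<close>).\<close>

section \<open>Complex inner product spaces\<close>

instance complex_hilbert \<subseteq> banach ..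

lemma cinner_add_right: "cinner x (y + z) = cinner x y + cinner x z"
  by (metis cinner_add_left cinner_commute complex_cnj_add)

lemma cinner_scaleC_right [simp]: "cinner x (a *\<^sub>C y) = cnj a * cinner x y"
  by (metis cinner_commute cinner_scaleC_left complex_cnj_mult)

declare cinner_scaleC_left [simp]

lemma scaleC_one [simp]: "1 *\<^sub>C x = (x :: 'a::complex_inner)"
  by (metis of_real_1 scaleR_one scaleR_scaleC)

lemma scaleC_zero_left [simp]: "0 *\<^sub>C x = (0 :: 'a::complex_inner)"
  by (metis of_real_0 scaleR_zero_left scaleR_scaleC)

lemma scaleC_zero_right [simp]: "a *\<^sub>C (0 :: 'a::complex_inner) = 0"
  by (metis add_cancel_right_right scaleC_add_right)

lemma scaleC_minus_left [simp]: "(- a) *\<^sub>C x = - (a *\<^sub>C (x :: 'a::complex_inner))"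
  by (metis add_eq_0_iff scaleC_add_left scaleC_zero_left)

lemma scaleC_minus_right [simp]: "a *\<^sub>C (- x) = - (a *\<^sub>C (x :: 'a::complex_inner))"
  by (metis add_eq_0_iff scaleC_add_right scaleC_zero_right)

lemma scaleC_diff_right: "a *\<^sub>C (x - y) = a *\<^sub>C x - a *\<^sub>C (y :: 'a::complex_inner)"
  by (metis diff_conv_add_uminus scaleC_add_right scaleC_minus_right)

lemma scaleC_diff_left: "(a - b) *\<^sub>C x = a *\<^sub>C x - b *\<^sub>C (x :: 'a::complex_inner)"
  by (metis diff_conv_add_uminus scaleC_add_left scaleC_minus_left)

lemma scaleC_sum_right: "a *\<^sub>C (\<Sum>i\<in>A. f i) = (\<Sum>i\<in>A. a *\<^sub>C (f i :: 'a::complex_inner))"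
  by (induction A rule: infinite_finite_induct) (auto simp: scaleC_add_right)

lemma scaleC_sum_left: "(\<Sum>i\<in>A. f i) *\<^sub>C x = (\<Sum>i\<in>A. f i *\<^sub>C (x :: 'a::complex_inner))"
  by (induction A rule: infinite_finite_induct) (auto simp: scaleC_add_left)

lemma cinner_zero_left [simp]: "cinner 0 y = 0"
  by (metis cinner_scaleC_left mult_zero_left scaleC_zero_left)

lemma cinner_zero_right [simp]: "cinner x 0 = 0"
  by (metis cinner_commute cinner_zero_left complex_cnj_zero)

lemma cinner_minus_left [simp]: "cinner (- x) y = - cinner x y"
  by (metis add.inverse_unique add.right_inverse cinner_add_left cinner_zero_left)

lemma cinner_minus_right [simp]: "cinner x (- y) = - cinner x y"
  by (metis add.inverse_unique add.right_inverse cinner_add_right cinner_zero_right)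

lemma cinner_diff_left: "cinner (x - z) y = cinner x y - cinner z y"
  by (metis cinner_add_left cinner_minus_left diff_conv_add_uminus)

lemma cinner_diff_right: "cinner x (y - z) = cinner x y - cinner x z"
  by (metis cinner_add_right cinner_minus_right diff_conv_add_uminus)

lemma cinner_sum_left: "cinner (\<Sum>i\<in>A. f i) y = (\<Sum>i\<in>A. cinner (f i) y)"
  by (induction A rule: infinite_finite_induct) (auto simp: cinner_add_left)

lemma cinner_sum_right: "cinner x (\<Sum>i\<in>A. f i) = (\<Sum>i\<in>A. cinner x (f i))"
  by (induction A rule: infinite_finite_induct) (auto simp: cinner_add_right)

lemma cinner_self: "cinner x x = of_real ((norm x)\<^sup>2)"
proof -
  have "Im (cinner x x) = 0"
    using arg_cong[OF cinner_commute[of x x], of Im] by simp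
  then show ?thesis
    by (simp add: complex_eq_iff flip: inner_Re_cinner dot_square_norm)
qed

lemma cinner_self_eq_0 [simp]: "cinner x x = 0 \<longleftrightarrow> x = 0"
  by (simp add: cinner_self)

lemma norm_scaleC [simp]: "norm (a *\<^sub>C x) = norm a * norm (x :: 'a::complex_inner)"
proof -
  have "complex_of_real ((norm (a *\<^sub>C x))\<^sup>2) = cinner (a *\<^sub>C x) (a *\<^sub>C x)"
    by (rule cinner_self[symmetric])
  also have "\<dots> = (a * cnj a) * cinner x x"
    by simp
  also have "\<dots> = complex_of_real ((norm a * norm x)\<^sup>2)"
    by (simp only: cinner_self power_mult_distrib complex_norm_square of_real_mult)
  finally have "complex_of_real ((norm (a *\<^sub>C x))\<^sup>2) = complex_of_real ((norm a * norm x)\<^sup>2)" .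
  then have "(norm (a *\<^sub>C x))\<^sup>2 = (norm a * norm x)\<^sup>2"
    using of_real_eq_iff by blast
  then show ?thesis
    by (simp add: power2_eq_iff_nonneg)
qed

lemma norm_cinner_le: "norm (cinner x y) \<le> norm x * norm y"
proof (cases "cinner x y = 0")
  case False
  define a where "a = cnj (cinner x y) / norm (cinner x y)"
  have na: "norm a = 1"
    using False by (simp add: a_def norm_divide)
  have "a * cinner x y = (norm (cinner x y))"
    using False complex_norm_square[of "cinner x y"]
    by (simp add: a_def power2_eq_square field_simps)
  then have "norm (cinner x y) = inner (a *\<^sub>C x) y"
    by (simp add: inner_Re_cinner)
  also have "\<dots> \<le> norm (a *\<^sub>C x) * norm y"
    by (rule norm_cauchy_schwarz)
  finally show ?thesis
    by (simp add: na)
qed auto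

lemma bounded_bilinear_cinner: "bounded_bilinear (cinner :: 'a::complex_inner \<Rightarrow> 'a \<Rightarrow> complex)"
proof
  show "cinner (r *\<^sub>R a) b = r *\<^sub>R cinner a b" for r and a b :: 'a
    by (simp add: scaleR_scaleC scaleC_complex_def)
  show "cinner a (r *\<^sub>R b) = r *\<^sub>R cinner a b" for r and a b :: 'a
    by (simp add: scaleR_scaleC scaleC_complex_def)
  show "\<exists>K. \<forall>a b :: 'a. norm (cinner a b) \<le> norm a * norm b * K"
    by (rule exI[of _ 1]) (simp add: norm_cinner_le)
qed (simp_all add: cinner_add_left cinner_add_right)

lemma bounded_bilinear_scaleC: "bounded_bilinear (scaleC :: complex \<Rightarrow> 'a::complex_inner \<Rightarrow> 'a)"
proof
  show "(r *\<^sub>R a) *\<^sub>C b = r *\<^sub>R (a *\<^sub>C b)" for r a and b :: 'a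
    by (simp add: scaleR_scaleC scaleC_scaleC scaleC_complex_def)
  show "a *\<^sub>C (r *\<^sub>R b) = r *\<^sub>R (a *\<^sub>C b)" for r a and b :: 'a
    by (simp add: scaleR_scaleC scaleC_scaleC mult.commute)
  show "\<exists>K. \<forall>a. \<forall>b :: 'a. norm (a *\<^sub>C b) \<le> norm a * norm b * K"
    by (rule exI[of _ 1]) simp
qed (simp_all add: scaleC_add_left scaleC_add_right)

lemmas tendsto_cinner [tendsto_intros] = bounded_bilinear.tendsto[OF bounded_bilinear_cinner]
lemmas continuous_on_cinner [continuous_intros] =
  bounded_bilinear.continuous_on[OF bounded_bilinear_cinner]
lemmas tendsto_scaleC [tendsto_intros] = bounded_bilinear.tendsto[OF bounded_bilinear_scaleC]
lemmas continuous_on_scaleC [continuous_intros] =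
  bounded_bilinear.continuous_on[OF bounded_bilinear_scaleC]

lemma scaleC_complex [simp]: "scaleC a (x::complex) = a * x"
  by (simp add: scaleC_complex_def)

lemma scaleC_vec_nth [simp]: "(a *\<^sub>C x) $ i = a *\<^sub>C (x $ i)"
  by (simp add: scaleC_vec_def)

abbreviation csubspace :: "'a::complex_inner set \<Rightarrow> bool" where
  "csubspace \<equiv> complex_vector.subspace"

lemma csubspaceD:
  assumes "csubspace S"
  shows "0 \<in> S" "x \<in> S \<Longrightarrow> y \<in> S \<Longrightarrow> x + y \<in> S" "x \<in> S \<Longrightarrow> c *\<^sub>C x \<in> S"
    "x \<in> S \<Longrightarrow> y \<in> S \<Longrightarrow> x - y \<in> S" "x \<in> S \<Longrightarrow> - x \<in> S"
    "x \<in> S \<Longrightarrow> r *\<^sub>R x \<in> S"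
  using assms complex_vector.subspace_diff[of S] complex_vector.subspace_neg[of S]
    complex_vector.subspace_0 complex_vector.subspace_add complex_vector.subspace_scale
  by (auto simp: scaleR_scaleC)

lemma csubspace_cspan [simp]: "csubspace (cspan A)"
  by (rule complex_vector.subspace_span)

lemma csubspace_UNIV: "csubspace UNIV"
  by (simp add: complex_vector.subspace_def)

lemma csubspace_closure:
  assumes "csubspace (S :: 'a::complex_inner set)" shows "csubspace (closure S)"
  unfolding complex_vector.subspace_def
proof (intro conjI ballI allI)
  show "0 \<in> closure S" using csubspaceD(1)[OF assms] closure_subset by blast
next
  fix x y assume "x \<in> closure S" "y \<in> closure S"
  then obtain f g where "\<forall>n. f n \<in> S" "f \<longlonglongrightarrow> x" "\<forall>n. g n \<in> S" "g \<longlonglongrightarrow> y"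
    unfolding closure_sequential by blast
  then have "\<forall>n. f n + g n \<in> S" "(\<lambda>n. f n + g n) \<longlonglongrightarrow> x + y"
    using csubspaceD(2)[OF assms] by (auto intro: tendsto_add)
  then show "x + y \<in> closure S"
    unfolding closure_sequential by (intro exI[of _ "\<lambda>n. f n + g n"]) auto
next
  fix c x assume "x \<in> closure S"
  then obtain f where "\<forall>n. f n \<in> S" "f \<longlonglongrightarrow> x"
    unfolding closure_sequential by blast
  then have "\<forall>n. c *\<^sub>C f n \<in> S" "(\<lambda>n. c *\<^sub>C f n) \<longlonglongrightarrow> c *\<^sub>C x"
    using csubspaceD(3)[OF assms] by (auto intro: tendsto_intros)
  then show "c *\<^sub>C x \<in> closure S"
    unfolding closure_sequential by (intro exI[of _ "\<lambda>n. c *\<^sub>C f n"]) auto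
qed

lemma cspan_superset: "A \<subseteq> cspan A"
  by (rule complex_vector.span_superset)

lemma cspan_minimal: "A \<subseteq> S \<Longrightarrow> csubspace S \<Longrightarrow> cspan A \<subseteq> S"
  by (rule complex_vector.span_minimal)

lemma closure_cspan_minimal: "A \<subseteq> S \<Longrightarrow> csubspace S \<Longrightarrow> closed S \<Longrightarrow> closure (cspan A) \<subseteq> S"
  by (simp add: closure_minimal cspan_minimal)

lemma cspan_mono: "A \<subseteq> B \<Longrightarrow> cspan A \<subseteq> cspan B"
  by (rule complex_vector.span_mono)

text \<open>Orthogonality passes from a set to its closed span because the vectors orthogonal to a given
  one form a closed subspace.\<close>

lemma closed_csubspace_perp: "csubspace {x. cinner x y = 0}" "closed {x. cinner x y = 0}"
  "csubspace {x. cinner y x = 0}" "closed {x. cinner y x = 0}"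
  by (auto simp: complex_vector.subspace_def cinner_add_left cinner_add_right
      intro!: closed_Collect_eq continuous_intros)

lemma cinner_closure_cspan_eq_0:
  assumes "\<And>a. a \<in> A \<Longrightarrow> cinner a y = 0" and "x \<in> closure (cspan A)"
  shows "cinner x y = 0"
  using closure_cspan_minimal[of A "{x. cinner x y = 0}"] assms closed_csubspace_perp[of y]
  by auto

lemma cinner_eq_0_commute: "cinner x y = 0 \<longleftrightarrow> cinner y x = 0"
  by (metis cinner_commute complex_cnj_zero)

lemma cinner_closure_cspan_eq_0':
  assumes "\<And>a. a \<in> A \<Longrightarrow> cinner y a = 0" and "x \<in> closure (cspan A)"
  shows "cinner y x = 0"
  using cinner_closure_cspan_eq_0[of A y x] assms by (metis cinner_eq_0_commute)

section \<open>Projections, adjoints and bounded left inverses in Hilbert space\<close>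

lemma minimal_norm_orthogonal:
  fixes v :: "'a::complex_inner"
  assumes S: "csubspace S" and min: "\<And>s. s \<in> S \<Longrightarrow> norm v \<le> norm (v - s)" and s: "s \<in> S"
  shows "cinner v s = 0"
proof -
  have re: "inner v s = 0" if s: "s \<in> S" for s
  proof (cases "s = 0")
    case False
    define t where "t = inner v s / inner s s"
    have "(norm v)\<^sup>2 \<le> (norm (v - t *\<^sub>R s))\<^sup>2"
      using min csubspaceD(6)[OF S s] by (simp add: power_mono)
    also have "\<dots> = inner v v - 2 * t * inner v s + t * t * inner s s"
      by (simp add: power2_norm_eq_inner inner_diff_left inner_diff_right inner_commute algebra_simps)
    also have "\<dots> = (norm v)\<^sup>2 - (inner v s)\<^sup>2 / inner s s"
      using False by (simp add: t_def power2_norm_eq_inner) (simp add: power2_eq_square)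
    finally have "(inner v s)\<^sup>2 / inner s s \<le> 0"
      by simp
    moreover have "inner s s > 0"
      using False by simp
    ultimately have "(inner v s)\<^sup>2 \<le> 0"
      by (simp add: divide_le_0_iff)
    then show ?thesis
      by simp
  qed auto
  have "Re (cinner v s) = 0"
    using re[OF s] by (simp add: inner_Re_cinner)
  moreover have "Im (cinner v s) = 0"
    using re[OF csubspaceD(3)[OF S s, of \<i>]] by (simp add: inner_Re_cinner)
  ultimately show ?thesis
    by (simp add: complex_eq_iff)
qed

text \<open>A minimising sequence for the distance to \<open>S\<close> is Cauchy by the parallelogram law.\<close>

lemma orthogonal_projection_exists:
  fixes S :: "'a::complex_hilbert set"
  assumes S: "csubspace S" "closed S"
  shows "\<exists>y\<in>S. \<forall>s\<in>S. cinner (x - y) s = 0"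
proof -
  have ne: "S \<noteq> {}"
    using csubspaceD(1)[OF S(1)] by auto
  define d where "d = infdist x S"
  have d: "d \<le> norm (x - s)" if "s \<in> S" for s
    using infdist_le[OF that, of x] by (simp add: d_def dist_norm)
  have d0: "0 \<le> d" by (simp add: d_def infdist_nonneg)
  have "\<exists>y\<in>S. dist x y < d + 1 / Suc n" for n
  proof -
    have "(INF a\<in>S. dist x a) < d + 1 / Suc n"
      using ne by (simp add: d_def infdist_notempty)
    then show ?thesis
      by (subst (asm) cINF_less_iff[OF ne]) (auto intro: bdd_belowI[of _ 0])
  qed
  then obtain y where yS: "\<And>n. y n \<in> S" and yd: "\<And>n. dist x (y n) < d + 1 / Suc n"
    by metis
  have lim: "(\<lambda>n. norm (x - y n)) \<longlonglongrightarrow> d"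
  proof (rule tendsto_sandwich[of "\<lambda>_. d" _ _ "\<lambda>n. d + 1 / Suc n"])
    show "(\<lambda>n. d + 1 / Suc n) \<longlonglongrightarrow> d"
      using tendsto_add[OF tendsto_const[of d] LIMSEQ_inverse_real_of_nat]
      by (simp add: inverse_eq_divide)
  qed (use yd d yS in \<open>auto simp: dist_norm intro!: always_eventually less_imp_le\<close>)
  have par: "(norm (y m - y n))\<^sup>2 \<le> 2 * (norm (x - y m))\<^sup>2 + 2 * (norm (x - y n))\<^sup>2 - 4 * d\<^sup>2" for m n
  proof -
    have "(1/2) *\<^sub>R (y m + y n) \<in> S"
      by (intro csubspaceD[OF S(1)] yS)
    from d[OF this] d0 have "d\<^sup>2 \<le> (norm (x - (1/2) *\<^sub>R (y m + y n)))\<^sup>2"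
      by (simp add: power_mono)
    then show ?thesis
      by (simp add: power2_norm_eq_inner inner_diff inner_add inner_commute algebra_simps)
  qed
  have "Cauchy y"
  proof (rule metric_CauchyI)
    fix e :: real assume e: "e > 0"
    have "(\<lambda>n. (norm (x - y n))\<^sup>2) \<longlonglongrightarrow> d\<^sup>2"
      by (intro tendsto_intros lim)
    then have "\<forall>\<^sub>F n in sequentially. (norm (x - y n))\<^sup>2 < d\<^sup>2 + e\<^sup>2 / 4"
      by (rule order_tendstoD) (use e in simp)
    then obtain M where M: "\<And>n. n \<ge> M \<Longrightarrow> (norm (x - y n))\<^sup>2 < d\<^sup>2 + e\<^sup>2 / 4"
      by (auto simp: eventually_sequentially)
    have "dist (y m) (y n) < e" if "m \<ge> M" "n \<ge> M" for m n
    proof -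
      have "(norm (y m - y n))\<^sup>2 < e\<^sup>2"
        using par[of m n] M[OF that(1)] M[OF that(2)] by simp
      then show ?thesis
        using e by (simp add: dist_norm power_less_imp_less_base)
    qed
    then show "\<exists>M. \<forall>m\<ge>M. \<forall>n\<ge>M. dist (y m) (y n) < e" by blast
  qed
  then obtain z where z: "y \<longlonglongrightarrow> z"
    by (auto simp: Cauchy_convergent_iff convergent_def)
  have zS: "z \<in> S"
    using closed_sequentially[OF S(2)] yS z by blast
  have "(\<lambda>n. norm (x - y n)) \<longlonglongrightarrow> norm (x - z)"
    by (intro tendsto_intros z)
  then have "norm (x - z) = d"
    using lim LIMSEQ_unique by blast
  then have "cinner (x - z) s = 0" if "s \<in> S" for s
    using that d[OF csubspaceD(2)[OF S(1) zS]]
    by (intro minimal_norm_orthogonal[OF S(1)]) (auto simp: diff_diff_eq)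
  then show ?thesis
    using zS by blast
qed

definition proj :: "'a::complex_hilbert set \<Rightarrow> 'a \<Rightarrow> 'a" where
  "proj S x = (SOME y. y \<in> S \<and> (\<forall>s\<in>S. cinner (x - y) s = 0))"

lemma
  assumes "csubspace S" "closed S"
  shows proj_in: "proj S x \<in> S" and proj_orthogonal: "s \<in> S \<Longrightarrow> cinner (x - proj S x) s = 0"
  using someI_ex[of "\<lambda>y. y \<in> S \<and> (\<forall>s\<in>S. cinner (x - y) s = 0)"]
    orthogonal_projection_exists[OF assms, of x]
  by (auto simp: proj_def)

lemma proj_unique:
  assumes S: "csubspace S" "closed S" and y: "y \<in> S" "\<And>s. s \<in> S \<Longrightarrow> cinner (x - y) s = 0"
  shows "proj S x = y"
proof -
  have *: "y - proj S x \<in> S"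
    by (intro csubspaceD[OF S(1)] proj_in S y)
  have "cinner (y - proj S x) (y - proj S x)
      = cinner (x - proj S x) (y - proj S x) - cinner (x - y) (y - proj S x)"
    by (simp add: cinner_diff_left)
  also have "\<dots> = 0"
    using y(2)[OF *] proj_orthogonal[OF S *] by simp
  finally show ?thesis by simp
qed

lemma proj_add:
  assumes S: "csubspace S" "closed S"
  shows "proj S (x + y) = proj S x + proj S y"
proof (rule proj_unique[OF S])
  show "cinner (x + y - (proj S x + proj S y)) s = 0" if "s \<in> S" for s
    using proj_orthogonal[OF S that, of x] proj_orthogonal[OF S that, of y]
    by (simp add: cinner_add_left cinner_diff_left)
qed (intro csubspaceD(2)[OF S(1)] proj_in S)

lemma proj_scaleC:
  assumes S: "csubspace S" "closed S"
  shows "proj S (c *\<^sub>C x) = c *\<^sub>C proj S x"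
proof (rule proj_unique[OF S])
  show "cinner (c *\<^sub>C x - c *\<^sub>C proj S x) s = 0" if "s \<in> S" for s
    using proj_orthogonal[OF S that, of x] by (simp add: cinner_diff_left)
qed (intro csubspaceD(3)[OF S(1)] proj_in S)

lemma proj_ident:
  assumes "csubspace S" "closed S" "x \<in> S"
  shows "proj S x = x"
  using assms by (intro proj_unique) auto

lemma norm_proj_le:
  assumes S: "csubspace S" "closed S"
  shows "norm (proj S x) \<le> norm x"
proof -
  have "cinner x (proj S x) = cinner (proj S x) (proj S x)"
    using proj_orthogonal[OF S proj_in[OF S, of x], of x] by (simp add: cinner_diff_left)
  then have "(norm (proj S x))\<^sup>2 = norm (cinner x (proj S x))"
    by (simp add: cinner_self norm_power)
  also have "\<dots> \<le> norm x * norm (proj S x)" by (rule norm_cinner_le)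
  finally show ?thesis
    by (cases "proj S x = 0") (auto simp: power2_eq_square)
qed

lemma bounded_opD:
  assumes "bounded_op_on S S' A"
  shows "x \<in> S \<Longrightarrow> A x \<in> S'" "x \<in> S \<Longrightarrow> y \<in> S \<Longrightarrow> A (x + y) = A x + A y"
    "x \<in> S \<Longrightarrow> A (c *\<^sub>C x) = c *\<^sub>C A x"
    "csubspace S \<Longrightarrow> x \<in> S \<Longrightarrow> y \<in> S \<Longrightarrow> A (x - y) = A x - A y"
    "csubspace S \<Longrightarrow> A 0 = 0"
proof -
  show *: "x \<in> S \<Longrightarrow> A x \<in> S'" "x \<in> S \<Longrightarrow> y \<in> S \<Longrightarrow> A (x + y) = A x + A y"
    "x \<in> S \<Longrightarrow> A (c *\<^sub>C x) = c *\<^sub>C A x" for x y c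
    using assms by (auto simp: bounded_op_on_def)
  show "A (x - y) = A x - A y" if "csubspace S" "x \<in> S" "y \<in> S"
    using *(2)[of x "(-1) *\<^sub>C y"] *(3)[of y "-1"] that csubspaceD(5)[OF that(1,3)] by simp
  show "A 0 = 0" if "csubspace S"
    using *(3)[OF csubspaceD(1)[OF that], of 0] by simp
qed

lemma bounded_op_bound:
  assumes "bounded_op_on S S' A"
  obtains B where "B > 0" "\<And>x. x \<in> S \<Longrightarrow> norm (A x) \<le> B * norm x"
proof -
  obtain B where B: "\<And>x. x \<in> S \<Longrightarrow> norm (A x) \<le> B * norm x"
    using assms unfolding bounded_op_on_def by blast
  have "norm (A x) \<le> (\<bar>B\<bar> + 1) * norm x" if "x \<in> S" for x
    using B[OF that] by (rule order_trans) (simp add: mult_right_mono)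
  then show ?thesis
    using that[of "\<bar>B\<bar> + 1"] by auto
qed

lemma bounded_op_imp_bounded_linear:
  assumes "bounded_op A" shows "bounded_linear A"
proof -
  obtain B where "\<And>x. norm (A x) \<le> B * norm x"
    using assms by (auto simp: bounded_op_on_def)
  then show ?thesis
    using bounded_opD(2,3)[OF assms]
    by (intro bounded_linear_intro[of _ B]) (auto simp: scaleR_scaleC mult.commute)
qed

lemma bounded_op_sum:
  assumes "bounded_op_on S S' A" "csubspace S" "\<And>i. i \<in> I \<Longrightarrow> f i \<in> S"
  shows "A (\<Sum>i\<in>I. c i *\<^sub>C f i) = (\<Sum>i\<in>I. c i *\<^sub>C A (f i))"
  using assms(3)
proof (induction I rule: infinite_finite_induct)
  case (insert x F)
  have "(\<Sum>i\<in>F. c i *\<^sub>C f i) \<in> S"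
    using insert by (intro complex_vector.subspace_sum assms(2) csubspaceD(3)[OF assms(2)]) auto
  with insert show ?case
    by (simp add: bounded_opD[OF assms(1)] csubspaceD[OF assms(2)])
qed (use bounded_opD(5)[OF assms(1,2)] in auto)

text \<open>A nonzero functional is represented by a multiple of the component of any vector that is orthogonal
  to its kernel.\<close>

lemma riesz_representation:
  fixes \<phi> :: "'a::complex_hilbert \<Rightarrow> complex"
  assumes S: "csubspace S" "closed S" and \<phi>: "bounded_op_on S UNIV \<phi>"
  shows "\<exists>u\<in>S. \<forall>x\<in>S. \<phi> x = cinner x u"
proof (cases "\<forall>x\<in>S. \<phi> x = 0")
  case True
  then show ?thesis
    using csubspaceD(1)[OF S(1)] by (intro bexI[of _ 0]) auto
next
  case False
  then obtain x0 where x0: "x0 \<in> S" "\<phi> x0 \<noteq> 0" by blast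
  define M where "M = {x \<in> S. \<phi> x = 0}"
  note [simp] = bounded_opD[OF \<phi>] csubspaceD[OF S(1)]
  have M: "csubspace M"
    by (auto simp: M_def complex_vector.subspace_def S(1))
  obtain B where B: "\<And>x. x \<in> S \<Longrightarrow> norm (\<phi> x) \<le> B * norm x"
    using bounded_op_bound[OF \<phi>] by blast
  have "closed M"
    unfolding closed_sequential_limits
  proof (intro allI impI, elim conjE)
    fix f l assume f: "\<forall>n. f n \<in> M" "f \<longlonglongrightarrow> l"
    then have l: "l \<in> S"
      using closed_sequentially[OF S(2), of f] by (auto simp: M_def)
    have "norm (\<phi> l) \<le> B * norm (l - f n)" for n
      using B[of "l - f n"] f(1) l by (auto simp: M_def S(1))
    moreover have "(\<lambda>n. B * norm (l - f n)) \<longlonglongrightarrow> B * norm (l - l)"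
      by (intro tendsto_intros f)
    ultimately have "norm (\<phi> l) \<le> 0"
      by (intro LIMSEQ_le_const[of "\<lambda>n. B * norm (l - f n)"]) auto
    then show "l \<in> M" using l by (simp add: M_def)
  qed
  note M = M this
  define v where "v = x0 - proj M x0"
  have pM: "proj M x0 \<in> S" "\<phi> (proj M x0) = 0"
    using proj_in[OF M, of x0] by (auto simp: M_def)
  have v: "v \<in> S" "\<phi> v = \<phi> x0"
    using pM x0 by (auto simp: v_def S(1))
  have orth: "cinner x v = 0" if "x \<in> M" for x
    using proj_orthogonal[OF M that, of x0] by (simp add: v_def cinner_eq_0_commute)
  have v0: "v \<noteq> 0"
    using v x0 S(1) by auto
  define u where "u = (cnj (\<phi> v) / cinner v v) *\<^sub>C v"
  have cvv: "cnj (cinner v v) = cinner v v"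
    by (rule cinner_commute[symmetric])
  have "\<phi> x = cinner x u" if x: "x \<in> S" for x
  proof -
    have "x - (\<phi> x / \<phi> v) *\<^sub>C v \<in> M"
      using x v x0 S(1) by (auto simp: M_def)
    from orth[OF this] have "cinner x v = (\<phi> x / \<phi> v) * cinner v v"
      by (simp add: cinner_diff_left)
    then show ?thesis
      using v0 v(2) x0(2) by (simp add: u_def cvv)
  qed
  moreover have "u \<in> S"
    using v(1) by (simp add: u_def S(1))
  ultimately show ?thesis by blast
qed

lemma adjoint_on_eqI:
  assumes "csubspace S" "u \<in> S" "\<And>x. x \<in> S \<Longrightarrow> cinner (A x) y = cinner x u"
  shows "adjoint_on S A y = u"
  unfolding adjoint_on_def
proof (rule the_equality)
  fix u' assume u': "u' \<in> S \<and> (\<forall>x\<in>S. cinner (A x) y = cinner x u')"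
  then have "u' - u \<in> S"
    using assms by (auto intro: csubspaceD)
  then have "cinner (u' - u) (u' - u) = 0"
    using u' assms(3) by (simp add: cinner_diff_right)
  then show "u' = u" by simp
qed (use assms in auto)

lemma cinner_adjoint_on:
  fixes S :: "'a::complex_hilbert set" and A :: "'a \<Rightarrow> 'b::complex_inner"
  assumes S: "csubspace S" "closed S" and A: "bounded_op_on S S' A"
    and x: "x \<in> S"
  shows "cinner (A x) y = cinner x (adjoint_on S A y)"
proof -
  obtain B where B: "B > 0" "\<And>x. x \<in> S \<Longrightarrow> norm (A x) \<le> B * norm x"
    using bounded_op_bound[OF A] by blast
  have "norm (cinner (A x) y) \<le> (B * norm y) * norm x" if "x \<in> S" for x
  proof -
    have "norm (cinner (A x) y) \<le> norm (A x) * norm y" by (rule norm_cinner_le)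
    also have "\<dots> \<le> (B * norm x) * norm y"
      by (intro mult_right_mono B that) auto
    finally show ?thesis by (simp add: mult_ac)
  qed
  then have "bounded_op_on S UNIV (\<lambda>x. cinner (A x) y)"
    using bounded_opD[OF A] by (auto simp: bounded_op_on_def cinner_add_left)
  from riesz_representation[OF S this]
  obtain u where u: "u \<in> S" "\<And>x. x \<in> S \<Longrightarrow> cinner (A x) y = cinner x u"
    by blast
  have "adjoint_on S A y = u"
    by (rule adjoint_on_eqI[OF S(1) u])
  with u(2)[OF x] show ?thesis by simp
qed

text \<open>Zabreiko's lemma, from which both the open mapping theorem and the uniform boundedness
  principle can be read off. By Baire, some sublevel set of \<open>p\<close> is dense in a ball around \<open>0\<close>; every
  vector of that ball is then a sum of a series whose \<open>p\<close>-values decay geometrically.\<close>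

lemma countably_subadditive_bounded:
  fixes p :: "'a::banach \<Rightarrow> real"
  assumes nonneg: "\<And>x. 0 \<le> p x" and scale: "\<And>c x. p (c *\<^sub>R x) = \<bar>c\<bar> * p x"
    and add: "\<And>x y. p (x + y) \<le> p x + p y"
    and suminf: "\<And>f. summable f \<Longrightarrow> summable (\<lambda>n. p (f n)) \<Longrightarrow> p (suminf f) \<le> (\<Sum>n. p (f n))"
  shows "\<exists>C\<ge>0. \<forall>x. p x \<le> C * norm x"
proof -
  define A where "A n = {x. p x \<le> real n}" for n
  have "\<exists>n. interior (closure (A n)) \<noteq> {}"
  proof (rule ccontr)
    assume "\<not> ?thesis"
    then have "euclidean interior_of \<Union> (range (\<lambda>n. closure (A n))) = {}"
      by (intro Baire_category_alt) (auto simp: completely_metrizable_space_euclidean)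
    moreover have "\<Union> (range (\<lambda>n. closure (A n))) = UNIV"
    proof -
      have "x \<in> closure (A (nat \<lceil>p x\<rceil>))" for x
        by (rule subsetD[OF closure_subset]) (simp add: A_def real_nat_ceiling_ge)
      then show ?thesis by blast
    qed
    ultimately show False by simp
  qed
  then obtain n x0 where "x0 \<in> interior (closure (A n))" by blast
  then obtain r where r: "r > 0" "ball x0 r \<subseteq> closure (A n)"
    by (auto simp: mem_interior)
  define N where "N = real n"
  have N0: "N \<ge> 0" by (simp add: N_def)
  have approx0: "\<exists>a. p a \<le> N \<and> norm (y - a) < \<delta>" if y: "norm y < r" and \<delta>: "\<delta> > 0" for y \<delta>
  proof -
    have "x0 + y \<in> closure (A n)" "x0 - y \<in> closure (A n)"
      using y r(2) by (auto simp: dist_norm subset_iff)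
    then obtain a b where a: "p a \<le> N" "dist a (x0 + y) < \<delta>" and b: "p b \<le> N" "dist b (x0 - y) < \<delta>"
      using \<delta> unfolding closure_approachable A_def N_def by (metis mem_Collect_eq)
    have "p ((1/2) *\<^sub>R (a - b)) \<le> N"
      using add[of a "(-1) *\<^sub>R b"] a(1) b(1) scale[of "-1" b] scale[of "1/2" "a - b"] by simp
    moreover have "norm (y - (1/2) *\<^sub>R (a - b)) < \<delta>"
    proof -
      have "y - (1/2) *\<^sub>R (a - b) = (1/2) *\<^sub>R (((x0 + y) - a) - ((x0 - y) - b))"
        by (simp add: algebra_simps flip: scaleR_add_left)
      also have "norm \<dots> \<le> (1/2) * (norm ((x0 + y) - a) + norm ((x0 - y) - b))"
        using norm_triangle_ineq4[of "(x0 + y) - a" "(x0 - y) - b"] by simp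
      also have "\<dots> < \<delta>"
        using a(2) b(2) by (simp add: dist_norm norm_minus_commute)
      finally show ?thesis .
    qed
    ultimately show ?thesis by blast
  qed
  have approx: "\<exists>a. p a \<le> N / 2 ^ k \<and> norm (y - a) < r / 2 ^ Suc k" if y: "norm y < r / 2 ^ k" for y k
  proof -
    have "norm ((2 ^ k) *\<^sub>R y) < r"
      using y by (simp add: field_simps)
    from approx0[OF this, of "r / 2"] r obtain a where
      a: "p a \<le> N" "norm ((2 ^ k) *\<^sub>R y - a) < r / 2" by auto
    have "y - (1 / 2 ^ k) *\<^sub>R a = (1 / 2 ^ k) *\<^sub>R ((2 ^ k) *\<^sub>R y - a)"
      by (simp add: algebra_simps)
    then have "norm (y - (1 / 2 ^ k) *\<^sub>R a) = norm ((2 ^ k) *\<^sub>R y - a) / 2 ^ k"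
      by simp
    then show ?thesis
      using a by (intro exI[of _ "(1 / 2 ^ k) *\<^sub>R a"]) (auto simp: scale field_simps)
  qed
  have small: "p x \<le> 2 * N" if x: "norm x < r" for x
  proof -
    define g where "g k y = (SOME a. p a \<le> N / 2 ^ k \<and> norm (y - a) < r / 2 ^ Suc k)" for k y
    have g: "p (g k y) \<le> N / 2 ^ k" "norm (y - g k y) < r / 2 ^ Suc k" if "norm y < r / 2 ^ k" for k y
      using someI_ex[OF approx[OF that]] by (auto simp: g_def)
    define X where "X = rec_nat x (\<lambda>k y. y - g k y)"
    have X: "X 0 = x" "X (Suc k) = X k - g k (X k)" for k
      by (simp_all add: X_def)
    have nX: "norm (X k) < r / 2 ^ k" for k
      by (induction k) (use x g in \<open>auto simp: X\<close>)
    define a where "a k = g k (X k)" for k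
    have pa: "p (a k) \<le> N / 2 ^ k" for k
      using g(1)[OF nX] by (simp add: a_def)
    have "(\<Sum>k<n. a k) = x - X n" for n
      by (induction n) (auto simp: X a_def)
    moreover have "X \<longlonglongrightarrow> 0"
    proof (rule Lim_null_comparison)
      show "(\<lambda>k. r / 2 ^ k) \<longlonglongrightarrow> 0"
        using LIMSEQ_divide_realpow_zero[of 2 r] by simp
    qed (use nX in \<open>auto intro!: always_eventually less_imp_le\<close>)
    ultimately have "a sums x"
      unfolding sums_def using tendsto_diff[OF tendsto_const[of x], of X 0] by simp
    then have ax: "summable a" "suminf a = x"
      by (auto simp: sums_iff)
    have geo: "(\<lambda>k. N / 2 ^ k) sums (2 * N)"
      using sums_mult[OF geometric_sums[of "1/2 :: real"], of N] by (simp add: power_divide mult.commute)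
    have sp: "summable (\<lambda>k. p (a k))"
      using pa nonneg geo
      by (intro summable_comparison_test[OF _ sums_summable[OF geo]] exI[of _ 0]) auto
    have "p x \<le> (\<Sum>k. p (a k))"
      using suminf[OF ax(1) sp] ax(2) by simp
    also have "\<dots> \<le> (\<Sum>k. N / 2 ^ k)"
      by (intro suminf_le pa sp sums_summable[OF geo])
    finally show ?thesis
      using geo by (simp add: sums_iff)
  qed
  have "p x \<le> (4 * N / r) * norm x" for x
  proof (cases "x = 0")
    case True
    then show ?thesis using scale[of 0 0] by simp
  next
    case False
    have "p ((r / (2 * norm x)) *\<^sub>R x) \<le> 2 * N"
      by (rule small) (use False r in auto)
    then show ?thesis
      using False r by (simp add: scale field_simps)
  qed
  then show ?thesis
    using N0 r by (intro exI[of _ "4 * N / r"]) auto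
qed

text \<open>Zabreiko's lemma for the supremum of the functionals \<open>x \<mapsto> |cinner x y|\<close> over \<open>Y\<close>.\<close>

lemma uniform_boundedness:
  fixes Y :: "'a::complex_hilbert set"
  assumes weak: "\<And>x. \<exists>B. \<forall>y\<in>Y. norm (cinner x y) \<le> B"
  shows "\<exists>C\<ge>0. \<forall>y\<in>Y. norm y \<le> C"
proof (cases "Y = {}")
  case False
  define p where "p x = (SUP y\<in>Y. norm (cinner x y))" for x
  have bdd: "bdd_above ((\<lambda>y. norm (cinner x y)) ` Y)" for x
    using weak[of x] by (auto simp: bdd_above_def)
  have le: "norm (cinner x y) \<le> p x" if "y \<in> Y" for x y
    unfolding p_def by (rule cSUP_upper[OF that bdd])
  have leI: "p x \<le> B" if "\<And>y. y \<in> Y \<Longrightarrow> norm (cinner x y) \<le> B" for x B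
    unfolding p_def by (rule cSUP_least[OF False that])
  obtain y0 where y0: "y0 \<in> Y" using False by blast
  have p0: "0 \<le> p x" for x
    using le[OF y0, of x] by (rule order_trans[OF norm_ge_zero])
  have sc: "p (c *\<^sub>R x) \<le> \<bar>c\<bar> * p x" for c x
    by (rule leI) (simp add: scaleR_scaleC le mult_left_mono norm_mult)
  have sc': "p (c *\<^sub>R x) = \<bar>c\<bar> * p x" for c x
  proof (cases "c = 0")
    case True
    then show ?thesis using p0[of "c *\<^sub>R x"] sc[of c x] by simp
  next
    case False
    have "\<bar>c\<bar> * p x \<le> p (c *\<^sub>R x)"
      using sc[of "1/c" "c *\<^sub>R x"] False by (simp add: field_simps)
    then show ?thesis using sc[of c x] by simp
  qed
  have "\<exists>C\<ge>0. \<forall>x. p x \<le> C * norm x"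
  proof (rule countably_subadditive_bounded[OF p0 sc'])
    fix x y show "p (x + y) \<le> p x + p y"
    proof (rule leI)
      fix z assume "z \<in> Y"
      then show "norm (cinner (x + y) z) \<le> p x + p y"
        unfolding cinner_add_left by (intro order_trans[OF norm_triangle_ineq] add_mono le)
    qed
  next
    fix f :: "nat \<Rightarrow> 'a"
    assume f: "summable f" "summable (\<lambda>n. p (f n))"
    show "p (suminf f) \<le> (\<Sum>n. p (f n))"
    proof (rule leI)
      fix y assume y: "y \<in> Y"
      have s: "summable (\<lambda>n. norm (cinner (f n) y))"
        using le[OF y] by (intro summable_comparison_test[OF _ f(2)]) auto
      have "bounded_linear (\<lambda>x. cinner x y)"
        by (rule bounded_bilinear.bounded_linear_left[OF bounded_bilinear_cinner])
      then have "cinner (suminf f) y = (\<Sum>n. cinner (f n) y)"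
        using bounded_linear.suminf[of "\<lambda>x. cinner x y", OF _ f(1)] by simp
      also have "norm \<dots> \<le> (\<Sum>n. norm (cinner (f n) y))"
        by (rule summable_norm[OF s])
      also have "\<dots> \<le> (\<Sum>n. p (f n))"
        by (intro suminf_le s f le y)
      finally show "norm (cinner (suminf f) y) \<le> (\<Sum>n. p (f n))" .
    qed
  qed
  then obtain C where C: "C \<ge> 0" "\<And>x. p x \<le> C * norm x" by blast
  have "norm y \<le> C" if "y \<in> Y" for y
  proof -
    have "norm y * norm y \<le> C * norm y"
      using le[OF that, of y] C(2)[of y] by (simp add: cinner_self power2_eq_square norm_mult)
    then show ?thesis using C(1) by (cases "y = 0") auto
  qed
  then show ?thesis using C(1) by blast
qed (auto intro: exI[of _ 0])

text \<open>The open mapping theorem in the form needed for operators with closed range: the inverse of the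
  injective part of \<open>A\<close>, preceded by the projection onto the range, is a seminorm to which
  Zabreiko's lemma applies.\<close>

lemma closed_range_left_inverse:
  fixes A :: "'a::complex_hilbert \<Rightarrow> 'b::complex_hilbert"
  assumes A: "bounded_op A" and R: "closed (range A)"
  shows "\<exists>L. bounded_op L \<and> (\<forall>x. L (A x) = x - proj {x. A x = 0} x)"
proof -
  note Alin = bounded_opD[OF A]
  define N where "N = {x. A x = 0}"
  define P where "P = proj (range A)"
  have cA: "bounded_linear A" by (rule bounded_op_imp_bounded_linear[OF A])
  have N: "csubspace N" "closed N"
    using Alin(2,3) Alin(5)[OF csubspace_UNIV]
    by (auto simp: N_def complex_vector.subspace_def
        intro!: closed_Collect_eq linear_continuous_on cA continuous_on_const)
  have "csubspace (range A)"
    unfolding complex_vector.subspace_def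
  proof (intro conjI ballI allI)
    show "0 \<in> range A" using Alin(5)[OF csubspace_UNIV] by (metis rangeI)
  next
    fix x y assume "x \<in> range A" "y \<in> range A"
    then obtain a b where "x = A a" "y = A b" by blast
    then have "x + y = A (a + b)" using Alin(2) by simp
    then show "x + y \<in> range A" by blast
  next
    fix c x assume "x \<in> range A"
    then obtain a where "x = A a" by blast
    then have "c *\<^sub>C x = A (c *\<^sub>C a)" using Alin(3) by simp
    then show "c *\<^sub>C x \<in> range A" by blast
  qed
  note R' = this R
  define Q where "Q s y \<longleftrightarrow> (\<forall>n\<in>N. cinner s n = 0) \<and> A s = P y" for s y
  have ex: "\<exists>s. Q s y" for y
  proof -
    obtain s0 where s0: "A s0 = P y"
      using proj_in[OF R', of y] by (metis P_def rangeE)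
    have "A (proj N s0) = 0"
      using proj_in[OF N, of s0] by (simp add: N_def)
    then show ?thesis
      using s0 proj_orthogonal[OF N] Alin(4)[OF csubspace_UNIV]
      by (intro exI[of _ "s0 - proj N s0"]) (auto simp: Q_def)
  qed
  have uniq: "s = s'" if "Q s y" "Q s' y" for s s' y
  proof -
    have "s - s' \<in> N"
      using that Alin(4)[OF csubspace_UNIV] by (auto simp: Q_def N_def)
    then have "cinner (s - s') (s - s') = 0"
      using that by (simp add: Q_def cinner_diff_left)
    then show ?thesis by simp
  qed
  define L where "L y = (SOME s. Q s y)" for y
  have L: "Q (L y) y" for y
    unfolding L_def by (rule someI_ex[OF ex])
  have L_eqI: "L y = s" if "Q s y" for s y
    by (rule uniq[OF L that])
  have Ladd: "L (x + y) = L x + L y" for x y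
    using L[of x] L[of y] by (intro L_eqI) (auto simp: Q_def cinner_add_left Alin P_def proj_add[OF R'])
  have Lscale: "L (c *\<^sub>C x) = c *\<^sub>C L x" for c x
    using L[of x] by (intro L_eqI) (auto simp: Q_def Alin P_def proj_scaleC[OF R'])
  have cP: "bounded_linear P"
    using norm_proj_le[OF R']
    by (intro bounded_linear_intro[of _ 1])
       (auto simp: P_def proj_add[OF R'] scaleR_scaleC proj_scaleC[OF R'])
  have "\<exists>C\<ge>0. \<forall>x. norm (L x) \<le> C * norm x"
  proof (rule countably_subadditive_bounded)
    show "norm (L (c *\<^sub>R x)) = \<bar>c\<bar> * norm (L x)" for c x
      by (simp add: scaleR_scaleC Lscale)
    show "norm (L (x + y)) \<le> norm (L x) + norm (L y)" for x y
      by (simp add: Ladd norm_triangle_ineq)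
    fix f :: "nat \<Rightarrow> 'b"
    assume f: "summable f" "summable (\<lambda>n. norm (L (f n)))"
    have s: "summable (\<lambda>n. L (f n))"
      by (rule summable_norm_cancel[OF f(2)])
    have "L (suminf f) = (\<Sum>n. L (f n))"
    proof (rule L_eqI, unfold Q_def, intro conjI ballI)
      fix n assume n: "n \<in> N"
      have "bounded_linear (\<lambda>x. cinner x n)"
        by (rule bounded_bilinear.bounded_linear_left[OF bounded_bilinear_cinner])
      then have "cinner (\<Sum>k. L (f k)) n = (\<Sum>k. cinner (L (f k)) n)"
        using bounded_linear.suminf[of "\<lambda>x. cinner x n", OF _ s] by simp
      then show "cinner (\<Sum>k. L (f k)) n = 0"
        using L n by (simp add: Q_def)
    next
      have "A (\<Sum>k. L (f k)) = (\<Sum>k. A (L (f k)))"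
        using bounded_linear.suminf[OF cA s] by simp
      also have "\<dots> = (\<Sum>k. P (f k))"
        using L by (simp add: Q_def)
      also have "\<dots> = P (suminf f)"
        using bounded_linear.suminf[OF cP f(1)] by simp
      finally show "A (\<Sum>k. L (f k)) = P (suminf f)" .
    qed
    then show "norm (L (suminf f)) \<le> (\<Sum>n. norm (L (f n)))"
      using summable_norm[OF f(2)] by simp
  qed auto
  then have "bounded_op L"
    using Ladd Lscale by (auto simp: bounded_op_on_def)
  moreover have "L (A x) = x - proj N x" for x
    using proj_orthogonal[OF N] proj_in[OF N, of x]
    by (intro L_eqI)
       (auto simp: Q_def P_def Alin(4)[OF csubspace_UNIV] proj_ident[OF R'] N_def)
  ultimately show ?thesis
    by (intro exI[of _ L]) (simp add: N_def)
qed

section \<open>Comparable total families\<close>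

text \<open>The closure of \<open>R\<close> is the graph of the operator: the bound makes it single-valued and, by completeness,
  everywhere defined.\<close>

lemma bounded_op_of_relation:
  fixes R :: "('a::complex_hilbert \<times> 'b::complex_hilbert) set"
  assumes add: "\<And>x y x' y'. (x, y) \<in> R \<Longrightarrow> (x', y') \<in> R \<Longrightarrow> (x + x', y + y') \<in> R"
    and scale: "\<And>c x y. (x, y) \<in> R \<Longrightarrow> (c *\<^sub>C x, c *\<^sub>C y) \<in> R"
    and bound: "\<And>x y. (x, y) \<in> R \<Longrightarrow> norm y \<le> C * norm x"
    and dense: "closure (fst ` R) = UNIV"
  shows "\<exists>X. bounded_op X \<and> (\<forall>x y. (x, y) \<in> R \<longrightarrow> X x = y)"
proof -
  have diff: "(x - x', y - y') \<in> R" if "(x, y) \<in> R" "(x', y') \<in> R" for x y x' y'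
    using add[OF that(1) scale[OF that(2), of "-1"]] by simp
  define Q where "Q x y \<longleftrightarrow> (\<exists>f g. (\<forall>n::nat. (f n, g n) \<in> R) \<and> f \<longlonglongrightarrow> x \<and> g \<longlonglongrightarrow> y)" for x y
  have Qbound: "norm y \<le> C * norm x" if "Q x y" for x y
  proof -
    from that obtain f g where fg: "\<forall>n. (f n, g n) \<in> R" "f \<longlonglongrightarrow> x" "g \<longlonglongrightarrow> y"
      by (auto simp: Q_def)
    show ?thesis
      by (rule LIMSEQ_le[OF tendsto_norm[OF fg(3)] tendsto_mult_left[OF tendsto_norm[OF fg(2)]]])
         (use bound fg(1) in auto)
  qed
  have Qadd: "Q (x + x') (y + y')" if xy: "Q x y" "Q x' y'" for x y x' y'
  proof -
    from xy obtain f g f' g' where fg: "\<forall>n. (f n, g n) \<in> R" "f \<longlonglongrightarrow> x" "g \<longlonglongrightarrow> y"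
      and fg': "\<forall>n. (f' n, g' n) \<in> R" "f' \<longlonglongrightarrow> x'" "g' \<longlonglongrightarrow> y'"
      by (auto simp: Q_def)
    show ?thesis
      unfolding Q_def
      by (rule exI[of _ "\<lambda>n. f n + f' n"], rule exI[of _ "\<lambda>n. g n + g' n"])
         (use fg fg' in \<open>auto intro: add tendsto_add\<close>)
  qed
  have Qscale: "Q (c *\<^sub>C x) (c *\<^sub>C y)" if xy: "Q x y" for c x y
  proof -
    from xy obtain f g where fg: "\<forall>n. (f n, g n) \<in> R" "f \<longlonglongrightarrow> x" "g \<longlonglongrightarrow> y"
      by (auto simp: Q_def)
    show ?thesis
      unfolding Q_def
      by (rule exI[of _ "\<lambda>n. c *\<^sub>C f n"], rule exI[of _ "\<lambda>n. c *\<^sub>C g n"])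
         (use fg in \<open>auto intro: scale tendsto_scaleC\<close>)
  qed
  have Quniq: "y = y'" if "Q x y" "Q x y'" for x y y'
    using Qbound[OF Qadd[OF that(1) Qscale[OF that(2), of "-1"]]] by simp
  have Qex: "\<exists>y. Q x y" for x
  proof -
    obtain f where f: "\<And>n. f n \<in> fst ` R" "f \<longlonglongrightarrow> x"
      using dense closure_sequential[of x "fst ` R"] by auto
    then have "\<forall>n. \<exists>y. (f n, y) \<in> R" by force
    then obtain g where g: "\<And>n. (f n, g n) \<in> R" by metis
    have "Cauchy g"
    proof (rule metric_CauchyI)
      fix e :: real assume e: "e > 0"
      define D where "D = \<bar>C\<bar> + 1"
      have D: "D > 0" by (simp add: D_def)
      have "Cauchy f"
        using f(2) by (rule LIMSEQ_imp_Cauchy)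
      then obtain M where M: "\<And>m n. m \<ge> M \<Longrightarrow> n \<ge> M \<Longrightarrow> dist (f m) (f n) < e / D"
        using metric_CauchyD[of f "e / D"] e D by (auto simp: divide_pos_pos)
      have "dist (g m) (g n) < e" if "m \<ge> M" "n \<ge> M" for m n
      proof -
        have "dist (g m) (g n) \<le> C * dist (f m) (f n)"
          using bound[OF diff[OF g g]] by (simp add: dist_norm)
        also have "\<dots> \<le> D * dist (f m) (f n)"
          by (intro mult_right_mono) (auto simp: D_def)
        also have "\<dots> < e"
          using M[OF that] D by (simp add: field_simps)
        finally show ?thesis .
      qed
      then show "\<exists>M. \<forall>m\<ge>M. \<forall>n\<ge>M. dist (g m) (g n) < e" by blast
    qed
    then obtain y where "g \<longlonglongrightarrow> y"
      by (auto simp: Cauchy_convergent_iff convergent_def)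
    then show ?thesis
      using f(2) g unfolding Q_def by blast
  qed
  define X where "X x = (SOME y. Q x y)" for x
  have X: "Q x (X x)" for x
    unfolding X_def by (rule someI_ex[OF Qex])
  have "bounded_op X"
    unfolding bounded_op_on_def
    using Quniq[OF X Qadd[OF X X]] Quniq[OF X Qscale[OF X]] Qbound[OF X] by blast
  moreover have "X x = y" if "(x, y) \<in> R" for x y
  proof (rule Quniq[OF X])
    show "Q x y"
      unfolding Q_def by (rule exI[of _ "\<lambda>_. x"], rule exI[of _ "\<lambda>_. y"]) (use that in auto)
  qed
  ultimately show ?thesis
    by (intro exI[of _ X]) auto
qed

text \<open>Finite linear combinations of a family are indexed by lists of coefficients and indices, so
  that the sum of two combinations is the concatenation of the lists.\<close>

definition lincomb :: "('p \<Rightarrow> 'a::complex_inner) \<Rightarrow> (complex \<times> 'p) list \<Rightarrow> 'a" where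
  "lincomb a xs = (\<Sum>(c, p)\<leftarrow>xs. c *\<^sub>C a p)"

lemma lincomb_simps [simp]:
  "lincomb a [] = 0"
  "lincomb a ((c, p) # xs) = c *\<^sub>C a p + lincomb a xs"
  "lincomb a (xs @ ys) = lincomb a xs + lincomb a ys"
  by (simp_all add: lincomb_def)

lemma lincomb_scale: "lincomb a (map (\<lambda>(c, p). (d * c, p)) xs) = d *\<^sub>C lincomb a xs"
  by (induction xs) (auto simp: scaleC_add_right scaleC_scaleC)

lemma cspan_subset_lincomb: "cspan (a ` P) \<subseteq> {lincomb a xs |xs. snd ` set xs \<subseteq> P}"
proof (rule cspan_minimal)
  show "a ` P \<subseteq> {lincomb a xs |xs. snd ` set xs \<subseteq> P}"
  proof
    fix x assume "x \<in> a ` P"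
    then obtain p where p: "p \<in> P" "x = a p" by blast
    then have "x = lincomb a [(1, p)]" by simp
    then show "x \<in> {lincomb a xs |xs. snd ` set xs \<subseteq> P}" using p by fastforce
  qed
  show "csubspace {lincomb a xs |xs. snd ` set xs \<subseteq> P}"
    unfolding complex_vector.subspace_def
  proof (intro conjI ballI allI; clarify?)
    show "\<exists>xs. 0 = lincomb a xs \<and> snd ` set xs \<subseteq> P"
      by (rule exI[of _ "[]"]) simp
  next
    fix xs ys :: "(complex \<times> 'b) list"
    assume "snd ` set xs \<subseteq> P" "snd ` set ys \<subseteq> P"
    then show "\<exists>zs. lincomb a xs + lincomb a ys = lincomb a zs \<and> snd ` set zs \<subseteq> P"
      by (intro exI[of _ "xs @ ys"]) auto
  next
    fix d and xs :: "(complex \<times> 'b) list" assume "snd ` set xs \<subseteq> P"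
    then show "\<exists>zs. d *\<^sub>C lincomb a xs = lincomb a zs \<and> snd ` set zs \<subseteq> P"
      by (intro exI[of _ "map (\<lambda>(c, p). (d * c, p)) xs"]) (auto simp: lincomb_scale)
  qed
qed

lemma bounded_op_on_total_family:
  fixes a :: "'p \<Rightarrow> 'a::complex_hilbert" and b :: "'p \<Rightarrow> 'b::complex_hilbert"
  assumes total: "closure (cspan (a ` P)) = UNIV"
    and bound: "\<And>xs. snd ` set xs \<subseteq> P \<Longrightarrow> norm (lincomb b xs) \<le> C * norm (lincomb a xs)"
  shows "\<exists>X. bounded_op X \<and> (\<forall>p\<in>P. X (a p) = b p)"
proof -
  define R where "R = {(lincomb a xs, lincomb b xs) |xs. snd ` set xs \<subseteq> P}"
  have "\<exists>X. bounded_op X \<and> (\<forall>x y. (x, y) \<in> R \<longrightarrow> X x = y)"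
  proof (rule bounded_op_of_relation)
    fix x y x' y' assume "(x, y) \<in> R" "(x', y') \<in> R"
    then obtain xs ys where "x = lincomb a xs" "y = lincomb b xs" "snd ` set xs \<subseteq> P"
      "x' = lincomb a ys" "y' = lincomb b ys" "snd ` set ys \<subseteq> P" by (auto simp: R_def)
    then show "(x + x', y + y') \<in> R"
      unfolding R_def by (intro CollectI exI[of _ "xs @ ys"]) auto
  next
    fix d x y assume "(x, y) \<in> R"
    then obtain xs where "x = lincomb a xs" "y = lincomb b xs" "snd ` set xs \<subseteq> P"
      by (auto simp: R_def)
    then show "(d *\<^sub>C x, d *\<^sub>C y) \<in> R"
      unfolding R_def
      by (intro CollectI exI[of _ "map (\<lambda>(c, p). (d * c, p)) xs"]) (auto simp: lincomb_scale)
  next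
    show "norm y \<le> C * norm x" if "(x, y) \<in> R" for x y
      using that bound by (auto simp: R_def)
    have "cspan (a ` P) \<subseteq> fst ` R"
      using cspan_subset_lincomb[of a P] by (force simp: R_def)
    then show "closure (fst ` R) = UNIV"
      using closure_mono total by blast
  qed
  then obtain X where X: "bounded_op X" "\<And>x y. (x, y) \<in> R \<Longrightarrow> X x = y" by blast
  have "(a p, b p) \<in> R" if "p \<in> P" for p
    unfolding R_def using that by (intro CollectI exI[of _ "[(1, p)]"]) auto
  then show ?thesis using X by blast
qed

lemma bounded_op_eq_on_total:
  assumes X: "bounded_op X" and Y: "bounded_op Y" and total: "closure (cspan A) = UNIV"
    and eq: "\<And>a. a \<in> A \<Longrightarrow> X a = Y a"
  shows "X x = Y x"
proof -
  have "closure (cspan A) \<subseteq> {x. X x = Y x}"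
  proof (rule closure_cspan_minimal)
    show "csubspace {x. X x = Y x}"
      using bounded_opD(2,3)[OF X] bounded_opD(2,3)[OF Y] bounded_opD(5)[OF X] bounded_opD(5)[OF Y]
      by (auto simp: complex_vector.subspace_def)
    show "closed {x. X x = Y x}"
      by (intro closed_Collect_eq linear_continuous_on bounded_op_imp_bounded_linear X Y)
  qed (use eq in auto)
  then show ?thesis using total by auto
qed

lemma bounded_op_id: "bounded_op (\<lambda>x. x)"
  by (auto simp: bounded_op_on_def intro: exI[of _ 1])

lemma bounded_op_compose:
  assumes X: "bounded_op X" and Y: "bounded_op Y" shows "bounded_op (\<lambda>x. X (Y x))"
proof -
  obtain B where B: "B > 0" "\<And>x. norm (X x) \<le> B * norm x"
    using bounded_op_bound[OF X] by auto
  obtain B' where B': "B' > 0" "\<And>x. norm (Y x) \<le> B' * norm x"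
    using bounded_op_bound[OF Y] by auto
  have "norm (X (Y x)) \<le> B * B' * norm x" for x
  proof -
    have "norm (X (Y x)) \<le> B * norm (Y x)" by (rule B)
    also have "\<dots> \<le> B * (B' * norm x)" using B B' by (intro mult_left_mono) auto
    finally show ?thesis by simp
  qed
  then show ?thesis
    using bounded_opD(2,3)[OF X] bounded_opD(2,3)[OF Y] by (auto simp: bounded_op_on_def)
qed

text \<open>Families with comparable combinations are carried to each other by mutually inverse operators, and
  these intertwine the tuples because they do so on joint eigenvectors.\<close>

lemma similar_of_eigenvectors:
  fixes T :: "'m \<Rightarrow> 'a::complex_hilbert \<Rightarrow> 'a" and S :: "'m \<Rightarrow> 'b::complex_hilbert \<Rightarrow> 'b"
  assumes T: "\<And>i. bounded_op (T i)" and S: "\<And>i. bounded_op (S i)"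
    and a: "closure (cspan (a ` P)) = UNIV" and b: "closure (cspan (b ` P)) = UNIV"
    and Ta: "\<And>i p. p \<in> P \<Longrightarrow> T i (a p) = \<mu> i p *\<^sub>C a p"
    and Sb: "\<And>i p. p \<in> P \<Longrightarrow> S i (b p) = \<mu> i p *\<^sub>C b p"
    and ab: "\<And>xs. snd ` set xs \<subseteq> P \<Longrightarrow> norm (lincomb b xs) \<le> C * norm (lincomb a xs)"
    and ba: "\<And>xs. snd ` set xs \<subseteq> P \<Longrightarrow> norm (lincomb a xs) \<le> D * norm (lincomb b xs)"
  shows "similar T S"
proof -
  obtain X where X: "bounded_op X" "\<And>p. p \<in> P \<Longrightarrow> X (a p) = b p"
    using bounded_op_on_total_family[OF a ab] by blast
  obtain Y where Y: "bounded_op Y" "\<And>p. p \<in> P \<Longrightarrow> Y (b p) = a p"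
    using bounded_op_on_total_family[OF b ba] by blast
  have "Y (X x) = x" for x
    by (rule bounded_op_eq_on_total[OF bounded_op_compose[OF Y(1) X(1)] bounded_op_id a]) (use X Y in auto)
  moreover have "X (Y y) = y" for y
    by (rule bounded_op_eq_on_total[OF bounded_op_compose[OF X(1) Y(1)] bounded_op_id b]) (use X Y in auto)
  moreover have "X (T i x) = S i (X x)" for i x
    by (rule bounded_op_eq_on_total[OF bounded_op_compose[OF X(1) T] bounded_op_compose[OF S X(1)] a])
       (use X bounded_opD(3)[OF X(1)] Ta Sb in auto)
  ultimately show ?thesis
    unfolding similar_def using X(1) Y(1) by blast
qed

section \<open>Orthogonal series\<close>

lemma norm_sum_orthogonal:
  assumes "finite F" "\<And>i j. i \<in> F \<Longrightarrow> j \<in> F \<Longrightarrow> i \<noteq> j \<Longrightarrow> cinner (x i) (x j) = 0"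
  shows "(norm (\<Sum>i\<in>F. x i))\<^sup>2 = (\<Sum>i\<in>F. (norm (x i))\<^sup>2)"
proof -
  have "of_real ((norm (\<Sum>i\<in>F. x i))\<^sup>2) = (\<Sum>i\<in>F. \<Sum>j\<in>F. cinner (x i) (x j))"
    by (simp only: cinner_self[symmetric] cinner_sum_left cinner_sum_right)
       (rule sum.swap)
  also have "\<dots> = (\<Sum>i\<in>F. \<Sum>j\<in>F. if i = j then cinner (x i) (x i) else 0)"
    using assms(2) by (intro sum.cong) auto
  also have "\<dots> = of_real (\<Sum>i\<in>F. (norm (x i))\<^sup>2)"
    using assms(1) by (simp add: cinner_self)
  finally show ?thesis
    using of_real_eq_iff by blast
qed

text \<open>By Pythagoras, the differences of partial sums are controlled by those of the series of squares.\<close>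

lemma orthogonal_summable_on:
  fixes x :: "'i \<Rightarrow> 'a::complex_hilbert"
  assumes orth: "\<And>i j. i \<in> N \<Longrightarrow> j \<in> N \<Longrightarrow> i \<noteq> j \<Longrightarrow> cinner (x i) (x j) = 0"
    and sq: "(\<lambda>i. (norm (x i))\<^sup>2) summable_on N"
  shows "x summable_on N"
proof -
  define s where "s = (\<Sum>\<^sub>\<infinity>i\<in>N. (norm (x i))\<^sup>2)"
  have s: "((\<lambda>i. (norm (x i))\<^sup>2) has_sum s) N"
    using sq by (simp add: s_def)
  have "cauchy_filter (filtermap (sum x) (finite_subsets_at_top N))"
    unfolding cauchy_filter_metric_filtermap
  proof (intro allI impI)
    fix e :: real assume e: "e > 0"
    have "\<forall>\<^sub>F F in finite_subsets_at_top N. dist (\<Sum>i\<in>F. (norm (x i))\<^sup>2) s < e\<^sup>2 / 8"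
      by (rule tendstoD[OF s[unfolded has_sum_def]]) (use e in simp)
    then obtain F0 where *: "finite F0 \<and> F0 \<subseteq> N \<and>
        (\<forall>F. finite F \<and> F0 \<subseteq> F \<and> F \<subseteq> N \<longrightarrow> dist (\<Sum>i\<in>F. (norm (x i))\<^sup>2) s < e\<^sup>2 / 8)"
      unfolding eventually_finite_subsets_at_top ..
    have F0: "finite F0" "F0 \<subseteq> N"
      "\<And>F. finite F \<Longrightarrow> F0 \<subseteq> F \<Longrightarrow> F \<subseteq> N \<Longrightarrow> dist (\<Sum>i\<in>F. (norm (x i))\<^sup>2) s < e\<^sup>2 / 8"
      using * by simp_all
    have close: "dist (sum x F) (sum x F0) < e / 2"
      if F: "finite F" "F0 \<subseteq> F" "F \<subseteq> N" for F
    proof -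
      have "sum x F - sum x F0 = sum x (F - F0)"
        using F by (simp add: sum_diff)
      then have "(dist (sum x F) (sum x F0))\<^sup>2 = (\<Sum>i\<in>F - F0. (norm (x i))\<^sup>2)"
        using F orth norm_sum_orthogonal[of "F - F0" x] by (auto simp: dist_norm subset_iff)
      also have "\<dots> = (\<Sum>i\<in>F. (norm (x i))\<^sup>2) - (\<Sum>i\<in>F0. (norm (x i))\<^sup>2)"
        using F by (simp add: sum_diff)
      also have "\<dots> < (e / 2)\<^sup>2"
      proof -
        have "a - b < 2 * q" if "dist a s < q" "dist b s < q" for a b q
          using that unfolding dist_real_def by linarith
        from this[OF F0(3)[OF F] F0(3)[OF F0(1) order_refl F0(2)]] show ?thesis
          by (simp add: power_divide)
      qed
      finally show ?thesis
        by (rule power_less_imp_less_base) (use e in simp)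
    qed
    show "\<exists>P. eventually P (finite_subsets_at_top N) \<and>
        (\<forall>F G. P F \<and> P G \<longrightarrow> dist (sum x F) (sum x G) < e)"
    proof (intro exI conjI allI impI)
      show "eventually (\<lambda>F. finite F \<and> F0 \<subseteq> F \<and> F \<subseteq> N) (finite_subsets_at_top N)"
        using F0 unfolding eventually_finite_subsets_at_top by blast
      fix F G assume "(finite F \<and> F0 \<subseteq> F \<and> F \<subseteq> N) \<and> finite G \<and> F0 \<subseteq> G \<and> G \<subseteq> N"
      then show "dist (sum x F) (sum x G) < e"
        by (intro dist_triangle_half_l[OF close close]) simp_all
    qed
  qed
  then obtain l where "filtermap (sum x) (finite_subsets_at_top N) \<le> nhds l"
    using cauchy_filter_complete_converges[of "filtermap (sum x) (finite_subsets_at_top N)" UNIV]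
      complete_UNIV
    by (auto simp: filtermap_bot_iff)
  then show ?thesis
    by (auto simp: summable_on_def has_sum_def filterlim_def)
qed

text \<open>Bessel's inequality: \<open>comp\<close> says that \<open>v i\<close> is the orthogonal projection of \<open>x\<close> to the line
  spanned by \<open>v i\<close>.\<close>

lemma bessel:
  fixes x :: "'a::complex_inner"
  assumes orth: "\<And>i j. i \<in> N \<Longrightarrow> j \<in> N \<Longrightarrow> i \<noteq> j \<Longrightarrow> cinner (v i) (v j) = 0"
    and comp: "\<And>i. i \<in> N \<Longrightarrow> cinner x (v i) = cinner (v i) (v i)"
  shows "(\<lambda>i. (norm (v i))\<^sup>2) summable_on N"
proof (rule nonneg_bdd_above_summable_on)
  show "bdd_above (sum (\<lambda>i. (norm (v i))\<^sup>2) ` {F. F \<subseteq> N \<and> finite F})"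
  proof (rule bdd_aboveI2)
    fix F assume "F \<in> {F. F \<subseteq> N \<and> finite F}"
    then have F: "F \<subseteq> N" "finite F" by auto
    have n: "(norm (sum v F))\<^sup>2 = (\<Sum>i\<in>F. (norm (v i))\<^sup>2)"
      using F orth by (intro norm_sum_orthogonal) auto
    have "cinner x (sum v F) = (\<Sum>i\<in>F. of_real ((norm (v i))\<^sup>2))"
      using F comp by (simp add: cinner_sum_right subset_iff cinner_self)
    also have "\<dots> = of_real ((norm (sum v F))\<^sup>2)"
      by (simp add: n)
    finally have "(norm (sum v F))\<^sup>2 = norm (cinner x (sum v F))"
      by (simp add: norm_power)
    also have "\<dots> \<le> norm x * norm (sum v F)" by (rule norm_cinner_le)
    finally have "norm (sum v F) \<le> norm x"
      by (cases "sum v F = 0") (auto simp: power2_eq_square)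
    then show "(\<Sum>i\<in>F. (norm (v i))\<^sup>2) \<le> (norm x)\<^sup>2"
      unfolding n[symmetric] by (simp add: power_mono)
  qed
qed auto

definition onb_on :: "nat set \<Rightarrow> (nat \<Rightarrow> 'a::complex_inner) \<Rightarrow> 'a set \<Rightarrow> bool" where
  "onb_on N e S \<longleftrightarrow> e ` N \<subseteq> S \<and> orthonormal_on N e \<and>
     (\<forall>x\<in>S. (\<forall>k\<in>N. cinner x (e k) = 0) \<longrightarrow> x = 0)"

text \<open>Gram-Schmidt without recursion: the \<open>n\<close>-th vector is the component of \<open>q n\<close> orthogonal to the
  closed span of the earlier ones, normalised if it does not vanish.\<close>

lemma onb_exists:
  fixes q :: "nat \<Rightarrow> 'a::complex_hilbert"
  shows "\<exists>N e. onb_on N e (closure (cspan (range q)))"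
proof -
  define M where "M n = closure (cspan (q ` {..<n}))" for n
  define S where "S = closure (cspan (range q))"
  have M: "csubspace (M n)" "closed (M n)" for n
    by (simp_all add: M_def csubspace_closure)
  have S: "csubspace S" "closed S"
    by (simp_all add: S_def csubspace_closure)
  have qM: "q i \<in> M n" if "i < n" for i n
    unfolding M_def using that by (intro subsetD[OF closure_subset] subsetD[OF cspan_superset]) auto
  have Mmono: "M m \<subseteq> M n" if "m \<le> n" for m n
    unfolding M_def using that by (intro closure_mono cspan_mono) auto
  have MS: "M n \<subseteq> S" for n
    unfolding M_def S_def by (intro closure_mono cspan_mono) auto
  have qS: "q n \<in> S" for n
    using qM[of n "Suc n"] MS by blast
  define r where "r n = q n - proj (M n) (q n)" for n
  have r_orth: "cinner (r n) x = 0" if "x \<in> M n" for n x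
    unfolding r_def by (rule proj_orthogonal[OF M that])
  have rM: "r m \<in> M n" if "m < n" for m n
    using qM[OF that] proj_in[OF M, of m "q m"] Mmono[of m n] that
    unfolding r_def by (intro csubspaceD(4)[OF M(1)]) auto
  have rS: "r n \<in> S" for n
    using rM[of n "Suc n"] MS by blast
  have rr: "cinner (r m) (r n) = 0" if "m \<noteq> n" for m n
    using that r_orth rM cinner_eq_0_commute by (metis linorder_neqE_nat)
  define N where "N = {n. r n \<noteq> 0}"
  define e where "e n = (1 / of_real (norm (r n))) *\<^sub>C r n" for n
  have "orthonormal_on N e"
    unfolding orthonormal_on_def
    by (auto simp: e_def N_def rr cinner_self power2_eq_square)
  moreover have "e ` N \<subseteq> S"
    using rS by (auto simp: e_def intro!: csubspaceD(3)[OF S(1)])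
  moreover have "x = 0" if x: "x \<in> S" "\<forall>k\<in>N. cinner x (e k) = 0" for x
  proof -
    have xr: "cinner x (r k) = 0" for k
      using x(2) by (cases "k \<in> N") (auto simp: e_def N_def)
    have xM: "cinner x (q n) = 0" for n
    proof (induction n rule: less_induct)
      case (less n)
      have "cinner x y = 0" if "y \<in> M n" for y
        by (rule cinner_closure_cspan_eq_0'[OF _ that[unfolded M_def]]) (use less in auto)
      from this[OF proj_in[OF M]] have "cinner x (proj (M n) (q n)) = 0" .
      then show ?case
        using xr[of n] by (simp add: r_def cinner_diff_right)
    qed
    have "cinner x x = 0"
      by (rule cinner_closure_cspan_eq_0'[OF _ x(1)[unfolded S_def]]) (use xM in auto)
    then show ?thesis by simp
  qed
  ultimately show ?thesis
    unfolding onb_on_def S_def by blast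
qed

lemma has_sum_in_closed_csubspace:
  assumes S: "csubspace S" "closed S" and f: "(f has_sum x) N" "\<And>i. i \<in> N \<Longrightarrow> f i \<in> S"
  shows "x \<in> S"
proof (rule Lim_in_closed_set[OF S(2)])
  show "\<forall>\<^sub>F F in finite_subsets_at_top N. sum f F \<in> S"
    by (rule eventually_finite_subsets_at_top_weakI)
       (use f(2) in \<open>auto intro!: complex_vector.subspace_sum S\<close>)
qed (use f(1) in \<open>auto simp: has_sum_def\<close>)

lemma has_sum_cinner_left:
  assumes "(f has_sum x) N" shows "((\<lambda>i. cinner (f i) y) has_sum cinner x y) N"
  using has_sum_bounded_linear[OF bounded_bilinear.bounded_linear_left[OF bounded_bilinear_cinner] assms]
  by (simp add: o_def)

text \<open>The series converges by Bessel, and \<open>y\<close> minus its sum is orthogonal to the whole basis.\<close>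

lemma onb_expansion:
  fixes S :: "'a::complex_hilbert set"
  assumes S: "csubspace S" "closed S" and e: "onb_on N e S" and y: "y \<in> S"
  shows "((\<lambda>k. cinner y (e k) *\<^sub>C e k) has_sum y) N"
proof -
  have eN: "\<And>i j. i \<in> N \<Longrightarrow> j \<in> N \<Longrightarrow> cinner (e i) (e j) = (if i = j then 1 else 0)"
    "\<And>i. i \<in> N \<Longrightarrow> e i \<in> S"
    using e by (auto simp: onb_on_def orthonormal_on_def)
  let ?v = "\<lambda>k. cinner y (e k) *\<^sub>C e k"
  have orth: "cinner (?v i) (?v j) = 0" if "i \<in> N" "j \<in> N" "i \<noteq> j" for i j
    using that by (simp add: eN)
  have "(\<lambda>k. (norm (?v k))\<^sup>2) summable_on N"
    by (rule bessel[of N ?v y]) (simp_all add: eN)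
  then have "?v summable_on N"
    using orth by (intro orthogonal_summable_on) auto
  then obtain z where z: "(?v has_sum z) N"
    by (auto simp: summable_on_def)
  have zS: "z \<in> S"
    by (rule has_sum_in_closed_csubspace[OF S z]) (auto intro: csubspaceD[OF S(1)] eN)
  have "cinner (y - z) (e j) = 0" if j: "j \<in> N" for j
  proof -
    have "((\<lambda>k. cinner (?v k) (e j)) has_sum cinner z (e j)) N"
      by (rule has_sum_cinner_left[OF z])
    moreover have "((\<lambda>k. cinner (?v k) (e j)) has_sum cinner y (e j)) N"
      using has_sum_finite_neutralI[of "{j}" N "\<lambda>k. cinner (?v k) (e j)"] j by (auto simp: eN)
    ultimately have "cinner z (e j) = cinner y (e j)"
      by (rule has_sum_unique)
    then show ?thesis by (simp add: cinner_diff_left)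
  qed
  then have "y - z = 0"
    using e csubspaceD(4)[OF S(1) y zS] unfolding onb_on_def by blast
  then show ?thesis using z by simp
qed

section \<open>Multipliers and Hilbert space tensor products\<close>

lemma hilbert_tensorD:
  assumes "hilbert_tensor tens"
  shows "tens (k + k') e = tens k e + tens k' e" "tens k (e + e') = tens k e + tens k e'"
    "tens (c *\<^sub>C k) e = c *\<^sub>C tens k e" "tens k (c *\<^sub>C e) = c *\<^sub>C tens k e"
    "cinner (tens k e) (tens k' e') = cinner k k' * cinner e e'"
    "closure (cspan {tens k e |k e. True}) = UNIV"
  using assms unfolding hilbert_tensor_def by blast+

lemma norm_tensor:
  assumes "hilbert_tensor tens" shows "norm (tens k e) = norm k * norm e"
proof -
  have "complex_of_real ((norm (tens k e))\<^sup>2) = of_real ((norm k * norm e)\<^sup>2)"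
    unfolding cinner_self[symmetric] hilbert_tensorD(5)[OF assms]
    by (simp add: cinner_self power_mult_distrib)
  then have "(norm (tens k e))\<^sup>2 = (norm k * norm e)\<^sup>2"
    using of_real_eq_iff by blast
  then show ?thesis
    by (simp add: power2_eq_iff_nonneg)
qed

lemma bounded_op_tensor:
  assumes t: "hilbert_tensor tens"
  shows "bounded_op (\<lambda>k. tens k e)" "bounded_op (tens k)"
  using hilbert_tensorD(1-4)[OF t] norm_tensor[OF t]
  by (auto simp: bounded_op_on_def mult.commute intro: exI[of _ "norm e"] exI[of _ "norm k"])

text \<open>The \<open>r\<close>-fold direct sum as tensor product with \<open>complex^'r\<close>.\<close>

definition vec_tensor :: "'k::complex_inner \<Rightarrow> complex^'r \<Rightarrow> 'k^'r" where
  "vec_tensor k c = (\<chi> l. (c $ l) *\<^sub>C k)"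

lemma hilbert_tensor_vec_tensor: "hilbert_tensor (vec_tensor :: 'k::complex_hilbert \<Rightarrow> complex^'r \<Rightarrow> 'k^'r)"
proof -
  let ?t = "vec_tensor :: 'k \<Rightarrow> complex^'r \<Rightarrow> 'k^'r"
  have "x \<in> cspan {?t k e |k e. True}" for x
  proof -
    have "x = (\<Sum>l\<in>UNIV. ?t (x $ l) (axis l 1))"
      by (simp add: vec_eq_iff vec_tensor_def axis_def if_distrib[of "\<lambda>c. c *\<^sub>C _"] cong: if_cong)
    also have "\<dots> \<in> cspan {?t k e |k e. True}"
      by (intro complex_vector.subspace_sum csubspace_cspan subsetD[OF cspan_superset]) blast
    finally show ?thesis .
  qed
  then have "closure (cspan {?t k e |k e. True}) = UNIV"
    using closure_subset by blast
  then show ?thesis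
    unfolding hilbert_tensor_def
    by (auto simp: vec_tensor_def vec_eq_iff scaleC_add_right scaleC_add_left scaleC_scaleC mult.commute
        cinner_vec_def sum_distrib_left cinner_complex_def mult_ac)
qed

text \<open>\<open>outer \<xi> e\<close> is the elementary tensor \<open>\<xi> \<otimes> e\<close>, and \<open>represents ev k w \<xi>\<close> says that \<open>k\<close> is the
  function \<open>K(\<cdot>, w)\<xi>\<close>, through its reproducing property.\<close>

definition outer :: "complex^'d \<Rightarrow> 'e::complex_inner \<Rightarrow> 'e^'d" where
  "outer \<xi> e = (\<chi> a. (\<xi> $ a) *\<^sub>C e)"

definition represents ::
    "('k::complex_inner \<Rightarrow> complex^'m \<Rightarrow> complex^'d) \<Rightarrow> 'k \<Rightarrow> complex^'m \<Rightarrow> complex^'d \<Rightarrow> bool" where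
  "represents ev k w \<xi> \<longleftrightarrow> (\<forall>f. cinner f k = cinner (ev f w) \<xi>)"

lemma cinner_outer_outer: "cinner (outer \<xi> e) (outer \<xi>' e') = cinner \<xi> \<xi>' * cinner e e'"
  by (simp add: outer_def cinner_vec_def sum_distrib_left cinner_complex_def mult_ac)

lemma norm_outer: "norm (outer \<xi> e) = norm \<xi> * norm e"
proof -
  have "complex_of_real ((norm (outer \<xi> e))\<^sup>2) = of_real ((norm \<xi> * norm e)\<^sup>2)"
    unfolding cinner_self[symmetric] cinner_outer_outer
    by (simp add: cinner_self power_mult_distrib)
  then have "(norm (outer \<xi> e))\<^sup>2 = (norm \<xi> * norm e)\<^sup>2"
    using of_real_eq_iff by blast
  then show ?thesis
    by (simp add: power2_eq_iff_nonneg)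
qed

lemma represents_scaleC: "represents ev k w \<xi> \<Longrightarrow> represents ev (c *\<^sub>C k) w (c *\<^sub>C \<xi>)"
  by (simp add: represents_def)

lemma tensor_functionsI:
  assumes "e ` N \<subseteq> S" "orthonormal_on N e" "(\<lambda>k. (norm (h k))\<^sup>2) summable_on N"
    "\<And>z. z \<in> unit_ball \<Longrightarrow> ((\<lambda>k. outer (ev (h k) z) (e k)) has_sum F z) (N :: nat set)"
  shows "F \<in> tensor_functions ev S"
  unfolding tensor_functions_def
  by (rule CollectI, rule exI[of _ N], rule exI[of _ h], rule exI[of _ e])
     (use assms in \<open>simp add: outer_def\<close>)

lemma tensor_functionsE:
  assumes "F \<in> tensor_functions ev S"
  obtains N h e where "e ` N \<subseteq> S" "orthonormal_on N e" "(\<lambda>k. (norm (h k))\<^sup>2) summable_on N"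
    "\<And>z. z \<in> unit_ball \<Longrightarrow> ((\<lambda>k. outer (ev (h k) z) (e k)) has_sum F z) (N :: nat set)"
proof -
  from assms obtain N h e where *: "e ` N \<subseteq> S \<and> orthonormal_on N e \<and>
           (\<lambda>k. (norm (h k))\<^sup>2) summable_on N \<and>
           (\<forall>z\<in>unit_ball. ((\<lambda>k. \<chi> a. (ev (h k) z $ a) *\<^sub>C e k) has_sum F z) (N :: nat set))"
    unfolding tensor_functions_def mem_Collect_eq by (elim exE)
  then show ?thesis
    by (intro that[of e N h]) (simp_all add: outer_def)
qed

text \<open>The abstract tensor product and \<open>tensor_functions\<close> are two models of one space. Their elements
  are matched by testing against kernel functions, which is all that duality will need.\<close>

definition corresponds ::
    "('k::complex_hilbert \<Rightarrow> complex^'m \<Rightarrow> complex^'d) \<Rightarrow> ('k \<Rightarrow> 'e::complex_hilbert \<Rightarrow> 't::complex_hilbert) \<Rightarrow>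
     'e set \<Rightarrow> 't \<Rightarrow> (complex^'m \<Rightarrow> 'e^'d) \<Rightarrow> bool" where
  "corresponds ev tens S x F \<longleftrightarrow>
     (\<forall>z\<in>unit_ball. \<forall>k \<xi>. \<forall>e\<in>S. represents ev k z \<xi> \<longrightarrow>
        cinner x (tens k e) = cinner (F z) (outer \<xi> e))"

text \<open>The summands \<open>h k \<otimes> e k\<close> are orthogonal in the tensor product, so they can be summed there.\<close>

lemma vector_of_tensor_function:
  fixes ev :: "'k::complex_hilbert \<Rightarrow> complex^'m \<Rightarrow> complex^'d"
  assumes t: "hilbert_tensor tens" and F: "F \<in> tensor_functions ev S"
  shows "\<exists>x. corresponds ev tens UNIV x F"
proof -
  obtain N h e where "e ` N \<subseteq> S" and e: "orthonormal_on N e" and h: "(\<lambda>k. (norm (h k))\<^sup>2) summable_on N"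
    and Fz: "\<And>z. z \<in> unit_ball \<Longrightarrow> ((\<lambda>k. outer (ev (h k) z) (e k)) has_sum F z) (N :: nat set)"
    by (rule tensor_functionsE[OF F]) (rule that)
  have ee: "cinner (e i) (e j) = (if i = j then 1 else 0)" if "i \<in> N" "j \<in> N" for i j
    using e that by (auto simp: orthonormal_on_def)
  have ne: "norm (e i) = 1" if "i \<in> N" for i
    using ee[OF that that] by (simp add: norm_eq_sqrt_inner inner_Re_cinner)
  have "(\<lambda>k. tens (h k) (e k)) summable_on N"
  proof (rule orthogonal_summable_on)
    show "cinner (tens (h i) (e i)) (tens (h j) (e j)) = 0" if "i \<in> N" "j \<in> N" "i \<noteq> j" for i j
      using that by (simp add: hilbert_tensorD(5)[OF t] ee)
    show "(\<lambda>k. (norm (tens (h k) (e k)))\<^sup>2) summable_on N"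
      using h by (rule summable_on_cong[THEN iffD1, rotated]) (simp add: norm_tensor[OF t] ne)
  qed
  then obtain x where x: "((\<lambda>k. tens (h k) (e k)) has_sum x) N"
    by (auto simp: summable_on_def)
  have "cinner x (tens k e') = cinner (F z) (outer \<xi> e')"
    if z: "z \<in> unit_ball" and k: "represents ev k z \<xi>" for z k \<xi> e'
  proof -
    have "((\<lambda>i. cinner (tens (h i) (e i)) (tens k e')) has_sum cinner x (tens k e')) N"
      by (rule has_sum_cinner_left[OF x])
    moreover have "((\<lambda>i. cinner (outer (ev (h i) z) (e i)) (outer \<xi> e')) has_sum
        cinner (F z) (outer \<xi> e')) N"
      by (rule has_sum_cinner_left[OF Fz[OF z]])
    moreover have "cinner (tens (h i) (e i)) (tens k e')
        = cinner (outer (ev (h i) z) (e i)) (outer \<xi> e')" for i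
      using k by (simp add: hilbert_tensorD(5)[OF t] cinner_outer_outer represents_def)
    ultimately show ?thesis
      using has_sum_unique by simp
  qed
  then show ?thesis
    unfolding corresponds_def by (intro exI[of _ x] ballI allI impI)
qed

lemma evaluation_bounded:
  assumes ev: "rkhs ev K" and z: "z \<in> unit_ball"
  shows "\<exists>C\<ge>0. \<forall>f. norm (ev f z) \<le> C * norm f"
proof -
  have "\<exists>k. \<forall>f. cinner f k = cinner (ev f z) \<xi>" for \<xi>
  proof -
    have "\<exists>k. (\<forall>z'\<in>unit_ball. ev k z' = K z' z *v \<xi>) \<and> (\<forall>f. cinner f k = cinner (ev f z) \<xi>)"
      using ev z unfolding rkhs_def by (elim conjE) simp
    then show ?thesis by (elim exE conjE) (rule exI)
  qed
  then obtain k where k: "\<And>\<xi> f. cinner f (k \<xi>) = cinner (ev f z) \<xi>"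
    by metis
  define C where "C = (\<Sum>a\<in>UNIV. norm (k (axis a 1)))"
  have "norm (ev f z) \<le> C * norm f" for f
  proof -
    have "cinner f (k (axis a 1)) = ev f z $ a" for a
      by (simp add: k cinner_vec_def axis_def cinner_complex_def if_distrib cong: if_cong)
    then have "norm (ev f z $ a) \<le> norm f * norm (k (axis a 1))" for a
      using norm_cinner_le[of f "k (axis a 1)"] by simp
    then have "norm (ev f z) \<le> (\<Sum>a\<in>UNIV. norm f * norm (k (axis a 1)))"
      unfolding norm_vec_def by (intro order_trans[OF L2_set_le_sum] sum_mono) auto
    then show ?thesis
      by (simp add: C_def sum_distrib_left mult.commute)
  qed
  then show ?thesis
    by (intro exI[of _ C]) (auto simp: C_def sum_nonneg)
qed

text \<open>The coefficient \<open>h k\<close> is the partial inner product of \<open>x\<close> with \<open>e k\<close>, for an orthonormal basis \<open>e\<close> of \<open>S\<close>;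
  Bessel's inequality makes the squared norms summable.\<close>

lemma tensor_function_of_vector:
  fixes ev :: "'k::complex_hilbert \<Rightarrow> complex^'m \<Rightarrow> complex^'d"
    and tens :: "'k \<Rightarrow> 'e::complex_hilbert \<Rightarrow> 't::complex_hilbert" and q :: "nat \<Rightarrow> 'e"
  assumes ev: "rkhs ev K" and t: "hilbert_tensor tens" and S_def: "S = closure (cspan (range q))"
  shows "\<exists>F\<in>tensor_functions ev S. corresponds ev tens S x F"
proof -
  have S: "csubspace S" "closed S"
    by (simp_all add: S_def csubspace_closure)
  obtain N e where onb: "onb_on N e S"
    using onb_exists[of q] unfolding S_def by blast
  have ee: "cinner (e i) (e j) = (if i = j then 1 else 0)" if "i \<in> N" "j \<in> N" for i j
    using onb that by (auto simp: orthonormal_on_def onb_on_def)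
  have ne: "norm (e i) = 1" if "i \<in> N" for i
    using ee[OF that that] by (simp add: norm_eq_sqrt_inner inner_Re_cinner)
  have "\<exists>u. \<forall>k. cinner k u = cinner (tens k (e i)) x" for i
    using cinner_adjoint_on[OF csubspace_UNIV closed_UNIV bounded_op_tensor(1)[OF t, of "e i"]]
    by (metis UNIV_I)
  then obtain h where h: "\<And>i k. cinner k (h i) = cinner (tens k (e i)) x"
    by metis
  have h': "cinner (h i) k = cinner x (tens k (e i))" for i k
    using h[of k i] by (metis cinner_commute)
  have "(\<lambda>k. (norm (tens (h k) (e k)))\<^sup>2) summable_on N"
  proof (rule bessel[of N _ x])
    show "cinner (tens (h i) (e i)) (tens (h j) (e j)) = 0" if "i \<in> N" "j \<in> N" "i \<noteq> j" for i j
      using that by (simp add: hilbert_tensorD(5)[OF t] ee)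
    show "cinner x (tens (h i) (e i)) = cinner (tens (h i) (e i)) (tens (h i) (e i))" if "i \<in> N" for i
      using that by (simp add: hilbert_tensorD(5)[OF t] ee h')
  qed
  then have hs: "(\<lambda>k. (norm (h k))\<^sup>2) summable_on N"
    by (rule summable_on_cong[THEN iffD1, rotated]) (simp add: norm_tensor[OF t] ne)
  have "\<exists>y. ((\<lambda>k. outer (ev (h k) z) (e k)) has_sum y) N" if z: "z \<in> unit_ball" for z
  proof -
    obtain C where C: "C \<ge> 0" "\<And>f. norm (ev f z) \<le> C * norm f"
      using evaluation_bounded[OF ev z] by blast
    have "(\<lambda>k. outer (ev (h k) z) (e k)) summable_on N"
    proof (rule orthogonal_summable_on)
      show "cinner (outer (ev (h i) z) (e i)) (outer (ev (h j) z) (e j)) = 0"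
        if "i \<in> N" "j \<in> N" "i \<noteq> j" for i j
        using that by (simp add: cinner_outer_outer ee)
      have "(\<lambda>k. C\<^sup>2 * (norm (h k))\<^sup>2) summable_on N"
        by (intro summable_on_cmult_right hs)
      then show "(\<lambda>k. (norm (outer (ev (h k) z) (e k)))\<^sup>2) summable_on N"
      proof (rule summable_on_comparison_test)
        fix i assume "i \<in> N"
        then show "(norm (outer (ev (h i) z) (e i)))\<^sup>2 \<le> C\<^sup>2 * (norm (h i))\<^sup>2"
          using C(2)[of "h i"] by (simp add: norm_outer ne power_mono flip: power_mult_distrib)
      qed auto
    qed
    then show ?thesis by (auto simp: summable_on_def)
  qed
  then obtain F where F: "\<And>z. z \<in> unit_ball \<Longrightarrow> ((\<lambda>k. outer (ev (h k) z) (e k)) has_sum F z) N"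
    by metis
  have "F \<in> tensor_functions ev S"
    by (rule tensor_functionsI[OF _ _ hs F]) (use onb in \<open>auto simp: onb_on_def\<close>)
  moreover have "cinner x (tens k e') = cinner (F z) (outer \<xi> e')"
    if z: "z \<in> unit_ball" and k: "represents ev k z \<xi>" and e': "e' \<in> S" for z k \<xi> e'
  proof -
    obtain y where y: "\<And>d. cinner (tens k d) x = cinner d y"
      using cinner_adjoint_on[OF csubspace_UNIV closed_UNIV bounded_op_tensor(2)[OF t, of k]]
      by (metis UNIV_I)
    have y': "cinner x (tens k d) = cinner (proj S y) d" if "d \<in> S" for d
    proof -
      have "cinner x (tens k d) = cinner y d"
        using y[of d] by (metis cinner_commute)
      then show ?thesis
        using proj_orthogonal[OF S that, of y] by (simp add: cinner_diff_left)
    qed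
    have "((\<lambda>i. cinner (cinner (proj S y) (e i) *\<^sub>C e i) e') has_sum cinner (proj S y) e') N"
      by (intro has_sum_cinner_left onb_expansion[OF S onb] proj_in S)
    moreover have "((\<lambda>i. cinner (outer (ev (h i) z) (e i)) (outer \<xi> e')) has_sum
        cinner (F z) (outer \<xi> e')) N"
      by (rule has_sum_cinner_left[OF F[OF z]])
    moreover have "cinner (cinner (proj S y) (e i) *\<^sub>C e i) e'
        = cinner (outer (ev (h i) z) (e i)) (outer \<xi> e')" if "i \<in> N" for i
    proof -
      have "e i \<in> S" using onb that by (auto simp: onb_on_def)
      then have "cinner (proj S y) (e i) = cinner (h i) k"
        using y'[of "e i"] by (simp add: h')
      then show ?thesis
        using k by (simp add: cinner_outer_outer represents_def)
    qed
    ultimately have "cinner (proj S y) e' = cinner (F z) (outer \<xi> e')"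
      using has_sum_cong[of N] has_sum_unique by (smt (verit))
    then show ?thesis
      by (simp add: y'[OF e'])
  qed
  ultimately show ?thesis
    unfolding corresponds_def by (intro bexI[of _ F] ballI allI impI)
qed

text \<open>The bound comes from uniform boundedness: pairing the left hand combination with a fixed
  vector \<open>x\<close> is, by duality, pairing the right hand one with the vector that the multiplier makes
  of \<open>x\<close>.\<close>

lemma multiplier_adjoint_bound:
  fixes ev :: "'k::complex_hilbert \<Rightarrow> complex^'m \<Rightarrow> complex^'d"
    and tens :: "'k \<Rightarrow> 'e::complex_hilbert \<Rightarrow> 't::complex_hilbert" and q :: "nat \<Rightarrow> 'e"
    and tens' :: "'k \<Rightarrow> 'f::complex_hilbert \<Rightarrow> 'u::complex_hilbert"
    and A :: "complex^'m \<Rightarrow> 'f \<Rightarrow> 'e"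
  assumes ev: "rkhs ev K" and t: "hilbert_tensor tens" and t': "hilbert_tensor tens'"
    and S_def: "S = closure (cspan (range q))" and S': "csubspace S'" "closed S'"
    and A: "\<And>w. w \<in> unit_ball \<Longrightarrow> bounded_op_on S' S (A w)"
    and mult: "(\<lambda>z. adjoint_on S' (A (cnj_vec z))) \<in> Mult ev S S'"
  defines "valid \<equiv> \<lambda>(w, k, e). w \<in> unit_ball \<and> (\<exists>\<xi>. represents ev k (cnj_vec w) \<xi>) \<and> e \<in> S'"
  shows "\<exists>C\<ge>0. \<forall>xs. (\<forall>p\<in>set xs. valid p) \<longrightarrow>
    norm (\<Sum>(w, k, e)\<leftarrow>xs. tens k (A w e)) \<le> C * norm (\<Sum>(w, k, e)\<leftarrow>xs. tens' k e)"
proof -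
  define L where "L xs = (\<Sum>(w, k, e)\<leftarrow>xs. tens k (A w e))" for xs
  define R where "R xs = (\<Sum>(w, k, e)\<leftarrow>xs. tens' k e)" for xs :: "((complex^'m) \<times> 'k \<times> 'f) list"
  have cnj2: "cnj_vec (cnj_vec w) = w" for w :: "complex^'m"
    by (simp add: cnj_vec_def vec_eq_iff)
  have ncnj: "cnj_vec w \<in> unit_ball" if "w \<in> unit_ball" for w :: "complex^'m"
    using that by (simp add: cnj_vec_def norm_vec_def)
  have dual: "\<exists>x'. \<forall>xs. (\<forall>p\<in>set xs. valid p) \<longrightarrow> cinner x (L xs) = cinner x' (R xs)" for x
  proof -
    obtain F where F: "F \<in> tensor_functions ev S" "corresponds ev tens S x F"
      using tensor_function_of_vector[OF ev t S_def] by blast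
    define F' where "F' z = (\<chi> a. adjoint_on S' (A (cnj_vec z)) (F z $ a))" for z
    have "F' \<in> tensor_functions ev S'"
      using mult F(1) unfolding F'_def Mult_def by blast
    from vector_of_tensor_function[OF t' this]
    obtain x' where x': "corresponds ev tens' UNIV x' F'" by blast
    have "cinner x (tens k (A w e)) = cinner x' (tens' k e)" if v: "valid (w, k, e)" for w k e
    proof -
      obtain \<xi> where w: "w \<in> unit_ball" and k: "represents ev k (cnj_vec w) \<xi>" and e: "e \<in> S'"
        using v by (auto simp: valid_def)
      note Aw = A[OF w]
      have "cinner x (tens k (A w e)) = cinner (F (cnj_vec w)) (outer \<xi> (A w e))"
        using F(2) k ncnj[OF w] bounded_opD(1)[OF Aw e] unfolding corresponds_def by simp
      also have "\<dots> = (\<Sum>a\<in>UNIV. cnj (\<xi> $ a) * cinner (F (cnj_vec w) $ a) (A w e))"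
        by (simp add: cinner_vec_def outer_def)
      also have "\<dots> = (\<Sum>a\<in>UNIV. cnj (\<xi> $ a) * cinner (F' (cnj_vec w) $ a) e)"
      proof (rule sum.cong[OF refl])
        fix a
        have "cinner (F (cnj_vec w) $ a) (A w e) = cinner (F' (cnj_vec w) $ a) e"
          using cinner_adjoint_on[OF S' Aw e, of "F (cnj_vec w) $ a"]
          by (simp add: F'_def cnj2) (metis cinner_commute)
        then show "cnj (\<xi> $ a) * cinner (F (cnj_vec w) $ a) (A w e)
            = cnj (\<xi> $ a) * cinner (F' (cnj_vec w) $ a) e" by simp
      qed
      also have "\<dots> = cinner (F' (cnj_vec w)) (outer \<xi> e)"
        by (simp add: cinner_vec_def outer_def)
      also have "\<dots> = cinner x' (tens' k e)"
        using x' k ncnj[OF w] unfolding corresponds_def by simp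
      finally show ?thesis .
    qed
    then have "cinner x (L xs) = cinner x' (R xs)" if "\<forall>p\<in>set xs. valid p" for xs
      using that unfolding L_def R_def by (induction xs) (auto simp: cinner_add_right)
    then show ?thesis by blast
  qed
  define Y where "Y = {L xs |xs. (\<forall>p\<in>set xs. valid p) \<and> norm (R xs) \<le> 1}"
  have "\<exists>B. \<forall>y\<in>Y. norm (cinner x y) \<le> B" for x
  proof -
    obtain x' where x': "\<And>xs. \<forall>p\<in>set xs. valid p \<Longrightarrow> cinner x (L xs) = cinner x' (R xs)"
      using dual by metis
    have "norm (cinner x y) \<le> norm x'" if y: "y \<in> Y" for y
    proof -
      obtain xs where xs: "y = L xs" "\<forall>p\<in>set xs. valid p" "norm (R xs) \<le> 1"
        using y unfolding Y_def by blast
      have "norm (cinner x y) \<le> norm x' * norm (R xs)"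
        unfolding xs(1) x'[OF xs(2)] by (rule norm_cinner_le)
      also have "\<dots> \<le> norm x' * 1"
        by (intro mult_left_mono xs) auto
      finally show ?thesis by simp
    qed
    then show ?thesis by blast
  qed
  from uniform_boundedness[OF this]
  obtain C where C: "C \<ge> 0" "\<And>y. y \<in> Y \<Longrightarrow> norm y \<le> C" by blast
  have "norm (L xs) \<le> C * norm (R xs)" if xs: "\<forall>p\<in>set xs. valid p" for xs
  proof -
    define sc where "sc c = map (\<lambda>(w, k, e). (w, c *\<^sub>C k, e)) xs" for c
    have sc: "L (sc c) = c *\<^sub>C L xs" "R (sc c) = c *\<^sub>C R xs" for c
      unfolding sc_def L_def R_def
      by (induction xs) (auto simp: scaleC_add_right hilbert_tensorD(3)[OF t] hilbert_tensorD(3)[OF t'])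
    have vsc: "\<forall>p\<in>set (sc c). valid p" for c
      using xs represents_scaleC unfolding sc_def valid_def by fastforce
    have bd: "norm (L xs) \<le> C * r" if r: "r > norm (R xs)" for r
    proof -
      have r0: "r > 0" using r by (rule order.strict_trans1[OF norm_ge_zero])
      define c where "c = complex_of_real (1 / r)"
      have "norm (R (sc c)) \<le> 1"
        using r r0 by (simp add: sc c_def norm_divide)
      then have "L (sc c) \<in> Y"
        using vsc unfolding Y_def by blast
      from C(2)[OF this] show ?thesis
        using r0 by (simp add: sc c_def norm_divide field_simps)
    qed
    have "((\<lambda>r. C * r) \<longlongrightarrow> C * norm (R xs)) (at_right (norm (R xs)))"
      by (intro tendsto_intros)
    then show ?thesis
      by (rule tendsto_lowerbound) (use bd in \<open>auto simp: eventually_at_right_field intro: gt_ex\<close>)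
  qed
  then show ?thesis
    using C(1) unfolding L_def R_def by blast
qed

section \<open>Holomorphic functions of several variables\<close>

lemma holo_onD:
  assumes "holo_on U f" "w \<in> U"
  shows "(f has_derivative frechet_derivative f (at w)) (at w)"
    "frechet_derivative f (at w) (c *\<^sub>C v) = c *\<^sub>C frechet_derivative f (at w) v"
proof -
  obtain D where D: "(f has_derivative D) (at w)" "\<And>c v. D (c *\<^sub>C v) = c *\<^sub>C D v"
    using assms unfolding holo_on_def by blast
  have [simp]: "frechet_derivative f (at w) = D"
    using frechet_derivative_at[OF D(1)] by simp
  show "(f has_derivative frechet_derivative f (at w)) (at w)"
    "frechet_derivative f (at w) (c *\<^sub>C v) = c *\<^sub>C frechet_derivative f (at w) v"
    using D by simp_all
qed

lemma holo_onI:
  assumes "\<And>w. w \<in> U \<Longrightarrow> (f has_derivative D w) (at w)" "\<And>w c v. w \<in> U \<Longrightarrow> D w (c *\<^sub>C v) = c *\<^sub>C D w v"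
  shows "holo_on U f"
  using assms unfolding holo_on_def by blast

lemma holo_on_subset: "holo_on U f \<Longrightarrow> V \<subseteq> U \<Longrightarrow> holo_on V f"
  by (auto simp: holo_on_def)

lemma holo_on_continuous: "holo_on U f \<Longrightarrow> continuous_on U f"
  by (meson continuous_at_imp_continuous_on has_derivative_continuous holo_onD(1))

lemma eventually_nhds_of_open: "open U \<Longrightarrow> w \<in> U \<Longrightarrow> (\<And>x. x \<in> U \<Longrightarrow> P x) \<Longrightarrow> \<forall>\<^sub>F x in nhds w. P x"
  using eventually_nhds by blast

lemma frechet_derivative_cong_open:
  assumes "open U" "w \<in> U" "\<And>x. x \<in> U \<Longrightarrow> f x = g x"
  shows "frechet_derivative f (at w) = frechet_derivative g (at w)"
proof -
  have "(f has_derivative D) (at w) \<longleftrightarrow> (g has_derivative D) (at w)" for D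
    using assms has_derivative_transform_within_open[of f D w UNIV U g]
      has_derivative_transform_within_open[of g D w UNIV U f] by auto
  then show ?thesis
    by (simp add: frechet_derivative_def)
qed

lemma holo_on_cong:
  assumes "open U" "\<And>x. x \<in> U \<Longrightarrow> f x = g x" "holo_on U f"
  shows "holo_on U g"
  unfolding holo_on_def
proof
  fix w assume w: "w \<in> U"
  then obtain D where D: "(f has_derivative D) (at w)" "\<forall>c v. D (c *\<^sub>C v) = c *\<^sub>C D v"
    using assms(3) unfolding holo_on_def by blast
  have "(g has_derivative D) (at w)"
    using has_derivative_transform_within_open[OF D(1) assms(1) w] assms(2) by simp
  with D(2) show "\<exists>D. (g has_derivative D) (at w) \<and> (\<forall>c v. D (c *\<^sub>C v) = c *\<^sub>C D v)"
    by blast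
qed

lemma bounded_linear_scaleC_line: "bounded_linear (\<lambda>\<zeta>::complex. \<zeta> *\<^sub>C (v::'a::complex_inner))"
  by (rule bounded_bilinear.bounded_linear_left[OF bounded_bilinear_scaleC])

lemma holo_on_line_derivative:
  fixes f :: "complex^'N \<Rightarrow> complex"
  assumes f: "holo_on U f" and w: "w + \<zeta> *\<^sub>C v \<in> U"
  shows "((\<lambda>\<zeta>. f (w + \<zeta> *\<^sub>C v)) has_field_derivative frechet_derivative f (at (w + \<zeta> *\<^sub>C v)) v) (at \<zeta>)"
proof -
  have "((\<lambda>\<zeta>. w + \<zeta> *\<^sub>C v) has_derivative (\<lambda>\<zeta>. \<zeta> *\<^sub>C v)) (at \<zeta>)"
    using has_derivative_add[OF has_derivative_const
        bounded_linear_imp_has_derivative[OF bounded_linear_scaleC_line]] by simp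
  from diff_chain_at[OF this holo_onD(1)[OF f w]] show ?thesis
    by (simp add: o_def has_field_derivative_def holo_onD(2)[OF f w] mult_commute_abs)
qed

definition circ :: "real \<Rightarrow> real \<Rightarrow> complex" where
  "circ \<rho> t = \<rho> * exp (2 * of_real pi * \<i> * t)"

lemma circ_nonzero: "\<rho> > 0 \<Longrightarrow> circ \<rho> t \<noteq> 0" and norm_circ: "\<rho> > 0 \<Longrightarrow> norm (circ \<rho> t) = \<rho>"
  by (auto simp: circ_def norm_mult)

lemma continuous_on_circ [continuous_intros]: "continuous_on A (circ \<rho>)"
  unfolding circ_def by (intro continuous_intros)

text \<open>Cauchy's formula for the derivative in the direction \<open>v\<close>, on a circle of radius \<open>\<rho>\<close> in the
  complex line through \<open>w\<close>.\<close>

lemma directional_derivative_integral: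
  fixes f :: "complex^'N \<Rightarrow> complex"
  assumes f: "holo_on U f" and \<rho>: "\<rho> > 0" and U: "\<And>\<zeta>. norm \<zeta> \<le> \<rho> \<Longrightarrow> w + \<zeta> *\<^sub>C v \<in> U"
  shows "frechet_derivative f (at w) v = integral {0..1} (\<lambda>t. f (w + circ \<rho> t *\<^sub>C v) / circ \<rho> t)"
proof -
  define g where "g \<zeta> = f (w + \<zeta> *\<^sub>C v)" for \<zeta>
  have dg: "(g has_field_derivative frechet_derivative f (at (w + \<zeta> *\<^sub>C v)) v) (at \<zeta>)"
    if "norm \<zeta> \<le> \<rho>" for \<zeta>
    unfolding g_def by (rule holo_on_line_derivative[OF f U[OF that]])
  have "continuous_on (cball 0 \<rho>) g"
    by (intro continuous_at_imp_continuous_on) (auto intro!: DERIV_isCont[OF dg])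
  moreover have "g holomorphic_on ball 0 \<rho>"
    unfolding holomorphic_on_def using dg
    by (metis dist_0_norm field_differentiable_at_within field_differentiable_def less_imp_le mem_ball)
  ultimately have *: "(\<lambda>u. g u / (u - 0)^2) contour_integrable_on (circlepath 0 \<rho>)"
    "(g has_field_derivative (1 / (2 * of_real pi * \<i>)
        * contour_integral (circlepath 0 \<rho>) (\<lambda>u. g u / (u - 0)^2))) (at 0)"
    using Cauchy_derivative_integral_circlepath[of 0 \<rho> g 0] \<rho> by auto
  have "frechet_derivative f (at w) v
      = 1 / (2 * of_real pi * \<i>) * contour_integral (circlepath 0 \<rho>) (\<lambda>u. g u / (u - 0)^2)"
    using DERIV_unique[OF dg[of 0] *(2)] \<rho> by simp
  also have "contour_integral (circlepath 0 \<rho>) (\<lambda>u. g u / (u - 0)^2)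
      = integral {0..1} (\<lambda>t. (2 * of_real pi * \<i>) * (g (circ \<rho> t) / circ \<rho> t))"
  proof -
    have "contour_integral (circlepath 0 \<rho>) (\<lambda>u. g u / (u - 0)^2)
       = integral {0..1} (\<lambda>t. g (circlepath 0 \<rho> t) / (circlepath 0 \<rho> t - 0)^2
            * vector_derivative (circlepath 0 \<rho>) (at t))"
      using has_contour_integral_integral[OF *(1)] unfolding has_contour_integral
      by (intro integral_unique[symmetric])
    also have "\<dots> = integral {0..1} (\<lambda>t. (2 * of_real pi * \<i>) * (g (circ \<rho> t) / circ \<rho> t))"
    proof (rule arg_cong[where f = "integral {0..1}"], rule ext)
      fix t :: real
      have c: "circlepath 0 \<rho> t = circ \<rho> t"
        by (simp add: circlepath circ_def)
      have v: "vector_derivative (circlepath 0 \<rho>) (at t) = (2 * of_real pi * \<i>) * circ \<rho> t"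
        by (simp add: vector_derivative_circlepath circ_def mult_ac)
      show "g (circlepath 0 \<rho> t) / (circlepath 0 \<rho> t - 0)^2 * vector_derivative (circlepath 0 \<rho>) (at t)
          = (2 * of_real pi * \<i>) * (g (circ \<rho> t) / circ \<rho> t)"
        unfolding c v using circ_nonzero[OF \<rho>, of t] by (simp add: power2_eq_square)
    qed
    finally show ?thesis .
  qed
  also have "\<dots> = (2 * of_real pi * \<i>) * integral {0..1} (\<lambda>t. g (circ \<rho> t) / circ \<rho> t)"
    by (rule integral_mult_right)
  finally show ?thesis
    by (simp add: g_def)
qed

text \<open>Cauchy's formula will be differentiated with respect to the centre of the circle, so its radius
  must not depend on the centre.\<close>

lemma uniform_circle:
  fixes v :: "complex^'N"
  assumes "open U" "w0 \<in> U"
  obtains e \<rho> where "e > 0" "\<rho> > 0" "ball w0 e \<subseteq> U"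
    "\<And>w \<zeta>. w \<in> ball w0 e \<Longrightarrow> norm \<zeta> \<le> \<rho> \<Longrightarrow> w + \<zeta> *\<^sub>C v \<in> U"
proof -
  obtain e where e: "e > 0" "ball w0 e \<subseteq> U"
    using assms open_contains_ball by blast
  define \<rho> where "\<rho> = (e / 2) / (norm v + 1)"
  have nv: "norm v + 1 > 0"
    using norm_ge_zero[of v] by linarith
  have \<rho>: "\<rho> > 0" "\<rho> * norm v < e / 2"
    using e nv by (auto simp: \<rho>_def field_simps)
  have "w + \<zeta> *\<^sub>C v \<in> U" if "w \<in> ball w0 (e/2)" "norm \<zeta> \<le> \<rho>" for w \<zeta>
  proof -
    have "norm (\<zeta> *\<^sub>C v) \<le> \<rho> * norm v"
      using that by (simp add: mult_right_mono)
    then have "dist w (w + \<zeta> *\<^sub>C v) < e / 2"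
      using \<rho> by (simp add: dist_norm norm_minus_commute)
    then have "w + \<zeta> *\<^sub>C v \<in> ball w0 e"
      using that(1) dist_triangle[of w0 "w + \<zeta> *\<^sub>C v" w] by (simp add: dist_commute)
    then show ?thesis using e by blast
  qed
  then show ?thesis
    using that[of "e/2" \<rho>] e \<rho> by (auto simp: subset_iff)
qed

lemma continuous_on_directional_derivative:
  fixes f :: "complex^'N \<Rightarrow> complex"
  assumes U: "open U" and f: "holo_on U f"
  shows "continuous_on U (\<lambda>w. frechet_derivative f (at w) v)"
proof (rule continuous_at_imp_continuous_on, rule)
  fix w0 assume "w0 \<in> U"
  then obtain e \<rho> where e: "e > 0" "\<rho> > 0" "ball w0 e \<subseteq> U"
    and in_U: "\<And>w \<zeta>. w \<in> ball w0 e \<Longrightarrow> norm \<zeta> \<le> \<rho> \<Longrightarrow> w + \<zeta> *\<^sub>C v \<in> U"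
    using uniform_circle[OF U, of w0 v] by blast
  have "continuous_on (ball w0 e) (\<lambda>w. integral (cbox 0 1) (\<lambda>t. f (w + circ \<rho> t *\<^sub>C v) / circ \<rho> t))"
  proof (rule integral_continuous_on_param)
    have "continuous_on (ball w0 e \<times> cbox 0 1) (\<lambda>x. f (fst x + circ \<rho> (snd x) *\<^sub>C v))"
      by (rule continuous_on_compose2[OF holo_on_continuous[OF f]])
         (auto intro!: continuous_intros continuous_on_compose2[OF continuous_on_circ[of UNIV]] in_U
           simp: norm_circ e(2))
    then show "continuous_on (ball w0 e \<times> cbox 0 1) (\<lambda>(w, t). f (w + circ \<rho> t *\<^sub>C v) / circ \<rho> t)"
      using circ_nonzero[OF e(2)]
      by (auto simp: case_prod_unfold
          intro!: continuous_intros continuous_on_compose2[OF continuous_on_circ[of UNIV]])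
  qed
  then have "continuous_on (ball w0 e) (\<lambda>w. frechet_derivative f (at w) v)"
    by (rule continuous_on_eq) (simp add: directional_derivative_integral[OF f e(2) in_U])
  then show "isCont (\<lambda>w. frechet_derivative f (at w) v) w0"
    using e(1) by (simp add: continuous_on_eq_continuous_at)
qed

text \<open>Differentiating the Cauchy integral under the integral sign shows that directional derivatives
  are holomorphic again, and that mixed second derivatives are symmetric.\<close>

lemma directional_derivative_aux:
  fixes f :: "complex^'N \<Rightarrow> complex"
  assumes U: "open U" and f: "holo_on U f" and w0: "w0 \<in> U"
  obtains D \<rho> where "((\<lambda>w. frechet_derivative f (at w) v) has_derivative D) (at w0)"
    "\<rho> > 0" "\<And>\<zeta>. norm \<zeta> \<le> \<rho> \<Longrightarrow> w0 + \<zeta> *\<^sub>C v \<in> U"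
    "\<And>u. D u = integral {0..1} (\<lambda>t. frechet_derivative f (at (w0 + circ \<rho> t *\<^sub>C v)) u / circ \<rho> t)"
proof -
  obtain e \<rho> where e: "e > 0" "\<rho> > 0" "ball w0 e \<subseteq> U"
    and in_U: "\<And>w \<zeta>. w \<in> ball w0 e \<Longrightarrow> norm \<zeta> \<le> \<rho> \<Longrightarrow> w + \<zeta> *\<^sub>C v \<in> U"
    using uniform_circle[OF U w0, of v] by blast
  define B where "B = ball w0 e"
  have w0B: "w0 \<in> B" using e by (simp add: B_def)
  have in_U': "w + circ \<rho> t *\<^sub>C v \<in> U" if "w \<in> B" for w t
    using in_U[of w "circ \<rho> t"] that norm_circ[OF e(2)] by (simp add: B_def)
  define F where "F = (\<lambda>w t. f (w + circ \<rho> t *\<^sub>C v) / circ \<rho> t)"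
  define F' where "F' = (\<lambda>w t u. frechet_derivative f (at (w + circ \<rho> t *\<^sub>C v)) u / circ \<rho> t)"
  have FF': "((\<lambda>w. F w t) has_derivative F' w t) (at w)" if "w \<in> B" for w t
  proof -
    have "((\<lambda>w. w + circ \<rho> t *\<^sub>C v) has_derivative (\<lambda>u. u)) (at w)"
      by (auto intro!: derivative_eq_intros)
    from diff_chain_at[OF this holo_onD(1)[OF f in_U'[OF that]]]
    have "((\<lambda>w. f (w + circ \<rho> t *\<^sub>C v)) has_derivative
        frechet_derivative f (at (w + circ \<rho> t *\<^sub>C v))) (at w)"
      by (simp add: o_def)
    from has_derivative_divide'[OF this has_derivative_const[of "circ \<rho> t"] circ_nonzero[OF e(2)]]
    show ?thesis
      using circ_nonzero[OF e(2), of t]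
      by (simp add: F_def F'_def power2_eq_square)
  qed
  have bl: "bounded_linear (F' w t)" if "w \<in> B" for w t
    using FF'[OF that] has_derivative_bounded_linear by blast
  have cont_F': "continuous_on (B \<times> cbox 0 1) (\<lambda>x. F' (fst x) (snd x) u)" for u
  proof -
    have "continuous_on (B \<times> cbox 0 1) (\<lambda>x. frechet_derivative f (at (fst x + circ \<rho> (snd x) *\<^sub>C v)) u)"
      by (rule continuous_on_compose2[OF continuous_on_directional_derivative[OF U f]])
         (auto intro!: continuous_intros continuous_on_compose2[OF continuous_on_circ[of UNIV]] in_U')
    then show ?thesis
      unfolding F'_def using circ_nonzero[OF e(2)]
      by (auto intro!: continuous_intros continuous_on_compose2[OF continuous_on_circ[of UNIV]])
  qed
  have cont_B: "continuous_on (B \<times> cbox 0 1) (\<lambda>(w, t). Blinfun (F' w t))"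
  proof (rule continuous_on_blinfun_componentwise)
    fix i :: "complex^'N"
    show "continuous_on (B \<times> cbox 0 1) (\<lambda>x. blinfun_apply (case x of (w, t) \<Rightarrow> Blinfun (F' w t)) i)"
      by (rule continuous_on_eq[OF cont_F'[of i]]) (auto simp: bounded_linear_Blinfun_apply bl)
  qed
  have "((\<lambda>w. integral (cbox 0 1) (F w)) has_derivative
      integral (cbox 0 1) (\<lambda>t. Blinfun (F' w0 t))) (at w0 within B)"
  proof (rule leibniz_rule[OF _ _ cont_B w0B])
    show "((\<lambda>w. F w t) has_derivative blinfun_apply (Blinfun (F' w t))) (at w within B)"
      if "w \<in> B" for w t
      using FF'[OF that] bl[OF that] by (simp add: bounded_linear_Blinfun_apply has_derivative_at_withinI)
    show "F w integrable_on cbox 0 1" if w: "w \<in> B" for w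
    proof (rule integrable_continuous)
      have "continuous_on (cbox 0 1) (\<lambda>t. f (w + circ \<rho> t *\<^sub>C v))"
        by (rule continuous_on_compose2[OF holo_on_continuous[OF f]])
           (auto intro!: continuous_intros in_U' w)
      then show "continuous_on (cbox 0 1) (F w)"
        unfolding F_def using circ_nonzero[OF e(2)] by (auto intro!: continuous_intros)
    qed
    show "convex B" by (simp add: B_def)
  qed
  then have *: "((\<lambda>w. integral (cbox 0 1) (F w)) has_derivative
      integral (cbox 0 1) (\<lambda>t. Blinfun (F' w0 t))) (at w0)"
    by (subst (asm) at_within_open[OF w0B]) (simp_all add: B_def)
  have d1: "((\<lambda>w. frechet_derivative f (at w) v) has_derivative
      integral (cbox 0 1) (\<lambda>t. Blinfun (F' w0 t))) (at w0)"
  proof (rule has_derivative_transform_within_open[OF * _ w0B])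
    show "integral (cbox 0 1) (F w) = frechet_derivative f (at w) v" if "w \<in> B" for w
      using directional_derivative_integral[OF f e(2) in_U[OF that[unfolded B_def]]]
      by (simp add: F_def)
  qed (simp add: B_def)
  have d2: "blinfun_apply (integral (cbox 0 1) (\<lambda>t. Blinfun (F' w0 t))) u
      = integral {0..1} (\<lambda>t. F' w0 t u)" for u
  proof -
    have "continuous_on (cbox 0 1) (\<lambda>t. Blinfun (F' w0 t))"
    proof -
      have "continuous_on (cbox 0 1) (\<lambda>t::real. (w0, t))" by (intro continuous_intros)
      from continuous_on_compose2[OF cont_B this] show ?thesis using w0B by auto
    qed
    from blinfun_apply_integral[OF integrable_continuous[OF this]] show ?thesis
      by (simp add: bounded_linear_Blinfun_apply bl[OF w0B])
  qed
  show ?thesis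
    by (rule that[OF d1 e(2) in_U[OF w0B[unfolded B_def]]]) (simp, subst d2, simp add: F'_def)
qed

lemma holo_on_directional_derivative:
  fixes f :: "complex^'N \<Rightarrow> complex"
  assumes U: "open U" and f: "holo_on U f"
  shows "holo_on U (\<lambda>w. frechet_derivative f (at w) v)"
  unfolding holo_on_def
proof
  fix w0 assume w0: "w0 \<in> U"
  obtain D \<rho> where D: "((\<lambda>w. frechet_derivative f (at w) v) has_derivative D) (at w0)"
    and \<rho>: "\<rho> > 0" "\<And>\<zeta>. norm \<zeta> \<le> \<rho> \<Longrightarrow> w0 + \<zeta> *\<^sub>C v \<in> U"
    and Du: "\<And>u. D u = integral {0..1} (\<lambda>t. frechet_derivative f (at (w0 + circ \<rho> t *\<^sub>C v)) u / circ \<rho> t)"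
    using directional_derivative_aux[OF U f w0, of v] by blast
  have "D (c *\<^sub>C u) = c *\<^sub>C D u" for c u
  proof -
    have "D (c *\<^sub>C u) = integral {0..1} (\<lambda>t. c * (frechet_derivative f (at (w0 + circ \<rho> t *\<^sub>C v)) u / circ \<rho> t))"
      unfolding Du using \<rho> by (simp add: holo_onD(2)[OF f] norm_circ)
    also have "\<dots> = c * integral {0..1} (\<lambda>t. frechet_derivative f (at (w0 + circ \<rho> t *\<^sub>C v)) u / circ \<rho> t)"
      by (rule integral_mult_right)
    finally show ?thesis
      by (simp only: Du scaleC_complex)
  qed
  with D show "\<exists>D. ((\<lambda>w. frechet_derivative f (at w) v) has_derivative D) (at w0) \<and>
      (\<forall>c v. D (c *\<^sub>C v) = c *\<^sub>C D v)" by blast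
qed

lemma symmetric_second_derivative:
  fixes f :: "complex^'N \<Rightarrow> complex"
  assumes U: "open U" and f: "holo_on U f" and w0: "w0 \<in> U"
  shows "frechet_derivative (\<lambda>w. frechet_derivative f (at w) v) (at w0) u
       = frechet_derivative (\<lambda>w. frechet_derivative f (at w) u) (at w0) v"
proof -
  obtain D \<rho> where D: "((\<lambda>w. frechet_derivative f (at w) v) has_derivative D) (at w0)"
    and \<rho>: "\<rho> > 0" "\<And>\<zeta>. norm \<zeta> \<le> \<rho> \<Longrightarrow> w0 + \<zeta> *\<^sub>C v \<in> U"
    and Du: "\<And>u. D u = integral {0..1} (\<lambda>t. frechet_derivative f (at (w0 + circ \<rho> t *\<^sub>C v)) u / circ \<rho> t)"
    using directional_derivative_aux[OF U f w0, of v] by blast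
  have "frechet_derivative (\<lambda>w. frechet_derivative f (at w) v) (at w0) u = D u"
    using frechet_derivative_at[OF D] by simp
  also have "\<dots> = frechet_derivative (\<lambda>w. frechet_derivative f (at w) u) (at w0) v"
    unfolding Du
    by (rule directional_derivative_integral[OF holo_on_directional_derivative[OF U f] \<rho>, symmetric])
  finally show ?thesis .
qed

section \<open>Partial derivatives of matrix-valued functions\<close>

lemma bounded_linear_axis: "bounded_linear (axis i :: 'a::real_normed_vector \<Rightarrow> 'a^'n)"
proof (rule bounded_linear_intro[of _ 1])
  fix x :: 'a
  have "norm (axis i x :: 'a^'n) \<le> (\<Sum>j\<in>UNIV. norm ((axis i x :: 'a^'n) $ j))"
    unfolding norm_vec_def by (rule L2_set_le_sum) simp
  also have "\<dots> = (\<Sum>j\<in>UNIV. if j = i then norm x else 0)"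
    by (intro sum.cong) (auto simp: axis_def)
  finally show "norm (axis i x :: 'a^'n) \<le> norm x * 1" by simp
qed (auto simp: axis_def vec_eq_iff)

lemma sum_axis_nth: "(\<Sum>i\<in>UNIV. axis i (x $ i)) = (x :: 'a::real_normed_vector^'n)"
  by (simp add: vec_eq_iff axis_def)

lemma has_derivative_vecI:
  fixes f :: "'b::real_normed_vector \<Rightarrow> 'a::real_normed_vector^'n"
  assumes "\<And>i. ((\<lambda>x. f x $ i) has_derivative (\<lambda>v. D v $ i)) F"
  shows "(f has_derivative D) F"
proof -
  have "((\<lambda>x. \<Sum>i\<in>UNIV. axis i (f x $ i) :: 'a^'n) has_derivative (\<lambda>v. \<Sum>i\<in>UNIV. axis i (D v $ i))) F"
    by (intro has_derivative_sum bounded_linear.has_derivative[OF bounded_linear_axis] assms)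
  then show ?thesis by (simp add: sum_axis_nth)
qed

lemma has_derivative_nth:
  "(f has_derivative D) F \<Longrightarrow> ((\<lambda>x. f x $ i) has_derivative (\<lambda>v. D v $ i)) F"
  by (rule bounded_linear.has_derivative[OF bounded_linear_vec_nth])

lemma holo_on_vec_iff: "holo_on U f \<longleftrightarrow> (\<forall>i. holo_on U (\<lambda>w. f w $ i))"
proof (intro iffI allI)
  fix i assume f: "holo_on U f"
  show "holo_on U (\<lambda>w. f w $ i)"
    by (rule holo_onI[OF has_derivative_nth[OF holo_onD(1)[OF f]]]) (auto simp: holo_onD(2)[OF f])
next
  assume f: "\<forall>i. holo_on U (\<lambda>w. f w $ i)"
  show "holo_on U f"
  proof (rule holo_onI)
    fix w assume w: "w \<in> U"
    show "(f has_derivative (\<lambda>v. \<chi> i. frechet_derivative (\<lambda>w. f w $ i) (at w) v)) (at w)"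
      by (rule has_derivative_vecI) (use f w holo_onD(1) in auto)
    show "(\<chi> i. frechet_derivative (\<lambda>w. f w $ i) (at w) (c *\<^sub>C v))
        = c *\<^sub>C (\<chi> i. frechet_derivative (\<lambda>w. f w $ i) (at w) v)" for c v
      using holo_onD(2)[OF f[rule_format] w] by (simp add: vec_eq_iff)
  qed
qed

lemma frechet_derivative_nth:
  assumes "holo_on U f" "w \<in> U"
  shows "frechet_derivative (\<lambda>w. f w $ i) (at w) v = frechet_derivative f (at w) v $ i"
  using frechet_derivative_at[OF has_derivative_nth[OF holo_onD(1)[OF assms]], of i]
  by (simp add: fun_eq_iff)

definition pd :: "'N \<Rightarrow> (complex^'N \<Rightarrow> 'a::complex_inner) \<Rightarrow> complex^'N \<Rightarrow> 'a" where
  "pd k f w = frechet_derivative f (at w) (axis k 1)"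

primrec pdl :: "'N list \<Rightarrow> (complex^'N \<Rightarrow> 'a::complex_inner) \<Rightarrow> complex^'N \<Rightarrow> 'a" where
  "pdl [] f = f"
| "pdl (k # I) f = pd k (pdl I f)"

lemma pdl_append: "pdl (I @ J) f = pdl I (pdl J f)"
  by (induction I) auto

lemma pd_cong:
  assumes "open U" "\<And>w. w \<in> U \<Longrightarrow> f w = g w" "w \<in> U"
  shows "pd k f w = pd k g w"
  unfolding pd_def using frechet_derivative_cong_open[OF assms(1,3,2)] by simp

lemma pdl_cong:
  assumes U: "open U" and fg: "\<And>w. w \<in> U \<Longrightarrow> f w = g w" and "w \<in> U"
  shows "pdl I f w = pdl I g w"
  using assms(3) by (induction I arbitrary: w) (auto intro: pd_cong[OF U] fg)

lemma pdI: "(f has_derivative D) (at w) \<Longrightarrow> pd k f w = D (axis k 1)"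
  unfolding pd_def using frechet_derivative_at by metis

lemma frechet_derivative_eq_sum_pd:
  assumes "holo_on U f" "w \<in> U"
  shows "frechet_derivative f (at w) v = (\<Sum>k\<in>UNIV. (v $ k) *\<^sub>C pd k f w)"
proof -
  note D = holo_onD[OF assms]
  have lin: "linear (frechet_derivative f (at w))"
    using D(1) has_derivative_bounded_linear bounded_linear.linear by blast
  have "v = (\<Sum>k\<in>UNIV. (v $ k) *\<^sub>C axis k 1)"
    by (simp add: vec_eq_iff axis_def if_distrib cong: if_cong)
  then have "frechet_derivative f (at w) v
      = (\<Sum>k\<in>UNIV. frechet_derivative f (at w) ((v $ k) *\<^sub>C axis k 1))"
    using linear_sum[OF lin] by metis
  then show ?thesis
    by (simp add: D(2) pd_def)
qed

text \<open>Matrix-valued functions are reduced entry by entry to the scalar statements above.\<close>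

lemma holo_on_matrix_iff:
  fixes f :: "complex^'N \<Rightarrow> complex^'b^'a"
  shows "holo_on U f \<longleftrightarrow> (\<forall>i j. holo_on U (\<lambda>w. f w $ i $ j))"
  by (subst holo_on_vec_iff, subst holo_on_vec_iff) simp

lemma pd_nth_nth:
  fixes f :: "complex^'N \<Rightarrow> complex^'b^'a"
  assumes f: "holo_on U f" "w \<in> U"
  shows "pd k f w $ i $ j = pd k (\<lambda>w. f w $ i $ j) w"
proof -
  have "holo_on U (\<lambda>w. f w $ i)"
    using f(1) holo_on_vec_iff by blast
  from frechet_derivative_nth[OF this f(2)] frechet_derivative_nth[OF f] show ?thesis
    by (simp add: pd_def)
qed

lemma holo_on_pd:
  fixes f :: "complex^'N \<Rightarrow> complex^'b^'a"
  assumes U: "open U" and f: "holo_on U f"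
  shows "holo_on U (pd k f)"
  unfolding holo_on_matrix_iff
proof (intro allI)
  fix i j
  have "holo_on U (\<lambda>w. f w $ i $ j)"
    using f by (simp add: holo_on_matrix_iff)
  from holo_on_directional_derivative[OF U this, of "axis k 1"]
  show "holo_on U (\<lambda>w. pd k f w $ i $ j)"
    by (rule holo_on_cong[OF U, rotated]) (simp add: pd_nth_nth[OF f] pd_def[symmetric])
qed

lemma holo_on_pdl:
  fixes f :: "complex^'N \<Rightarrow> complex^'b^'a"
  assumes U: "open U" and f: "holo_on U f"
  shows "holo_on U (pdl I f)"
  by (induction I) (auto intro: holo_on_pd[OF U] f)

lemma pd_commute:
  fixes f :: "complex^'N \<Rightarrow> complex^'b^'a"
  assumes U: "open U" and f: "holo_on U f" and w: "w \<in> U"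
  shows "pd k (pd l f) w = pd l (pd k f) w"
proof -
  have "pd k (pd l f) w $ i $ j = pd l (pd k f) w $ i $ j" for i j
  proof -
    let ?g = "\<lambda>w. f w $ i $ j"
    have g: "holo_on U ?g"
      using f by (simp add: holo_on_matrix_iff)
    have *: "pd k (pd l f) w $ i $ j = pd k (pd l ?g) w" for k l
      using pd_nth_nth[OF holo_on_pd[OF U f] w]
        pd_cong[OF U _ w, of "\<lambda>w. pd l f w $ i $ j" "pd l ?g"] pd_nth_nth[OF f]
      by simp
    have "pd k (pd l ?g) w = pd l (pd k ?g) w"
      using symmetric_second_derivative[OF U g w, of "axis l 1" "axis k 1"]
      by (simp add: pd_def[abs_def])
    then show ?thesis
      by (simp add: *)
  qed
  then show ?thesis by (simp add: vec_eq_iff)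
qed

lemma
  assumes f: "holo_on U f" and g: "holo_on U g"
  shows holo_on_add: "holo_on U (\<lambda>w. f w + g w)"
    and pd_add: "w \<in> U \<Longrightarrow> pd k (\<lambda>w. f w + g w) w = pd k f w + pd k g w"
proof -
  note * = has_derivative_add[OF holo_onD(1)[OF f] holo_onD(1)[OF g]]
  show "holo_on U (\<lambda>w. f w + g w)"
    by (rule holo_onI[OF *]) (auto simp: holo_onD(2)[OF f] holo_onD(2)[OF g] scaleC_add_right)
  show "pd k (\<lambda>w. f w + g w) w = pd k f w + pd k g w" if "w \<in> U"
    using pdI[OF *[OF that that]] by (simp add: pd_def)
qed

lemma
  assumes f: "holo_on U f" and g: "holo_on U g"
  shows holo_on_diff: "holo_on U (\<lambda>w. f w - g w)"
    and pd_diff: "w \<in> U \<Longrightarrow> pd k (\<lambda>w. f w - g w) w = pd k f w - pd k g w"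
proof -
  note * = has_derivative_diff[OF holo_onD(1)[OF f] holo_onD(1)[OF g]]
  show "holo_on U (\<lambda>w. f w - g w)"
    by (rule holo_onI[OF *]) (auto simp: holo_onD(2)[OF f] holo_onD(2)[OF g] scaleC_diff_right)
  show "pd k (\<lambda>w. f w - g w) w = pd k f w - pd k g w" if "w \<in> U"
    using pdI[OF *[OF that that]] by (simp add: pd_def)
qed

lemma
  assumes f: "holo_on U f"
  shows holo_on_minus: "holo_on U (\<lambda>w. - f w)"
    and pd_minus: "w \<in> U \<Longrightarrow> pd k (\<lambda>w. - f w) w = - pd k f w"
proof -
  note * = has_derivative_minus[OF holo_onD(1)[OF f]]
  show "holo_on U (\<lambda>w. - f w)"
    by (rule holo_onI[OF *]) (auto simp: holo_onD(2)[OF f])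
  show "pd k (\<lambda>w. - f w) w = - pd k f w" if "w \<in> U"
    using pdI[OF *[OF that]] by (simp add: pd_def)
qed

lemma holo_on_const [simp]: "holo_on U (\<lambda>w. c)"
  by (rule holo_onI[where D = "\<lambda>_ _. 0"]) auto

lemma pd_const [simp]: "pd k (\<lambda>w. c) w = 0"
  by (rule pdI) simp

text \<open>One product rule for matrix products, Kronecker products and products of scalars.\<close>

locale complex_bilinear =
  fixes h :: "'a::complex_inner \<Rightarrow> 'b::complex_inner \<Rightarrow> 'c::complex_inner"
  assumes bb: "bounded_bilinear h"
    and scale_left: "h (c *\<^sub>C x) y = c *\<^sub>C h x y" and scale_right: "h x (c *\<^sub>C y) = c *\<^sub>C h x y"
begin

lemma
  assumes f: "holo_on U f" and g: "holo_on U g"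
  shows holo: "holo_on U (\<lambda>w. h (f w) (g w))"
    and pd: "w \<in> U \<Longrightarrow> pd k (\<lambda>w. h (f w) (g w)) w = h (f w) (pd k g w) + h (pd k f w) (g w)"
proof -
  have *: "((\<lambda>w. h (f w) (g w)) has_derivative (\<lambda>v. h (f w) (frechet_derivative g (at w) v)
      + h (frechet_derivative f (at w) v) (g w))) (at w)" if "w \<in> U" for w
    by (rule bounded_bilinear.FDERIV[OF bb holo_onD(1)[OF f that] holo_onD(1)[OF g that]])
  show "holo_on U (\<lambda>w. h (f w) (g w))"
    by (rule holo_onI[OF *])
       (auto simp: holo_onD(2)[OF f] holo_onD(2)[OF g] scale_left scale_right scaleC_add_right)
  show "pd k (\<lambda>w. h (f w) (g w)) w = h (f w) (pd k g w) + h (pd k f w) (g w)" if "w \<in> U"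
    using pdI[OF *[OF that]] by (simp add: pd_def)
qed

end

lemma bounded_bilinear_matrix_mult:
  "bounded_bilinear ((**) :: complex^'b^'a \<Rightarrow> complex^'c^'b \<Rightarrow> complex^'c^'a)"
  unfolding bilinear_conv_bounded_bilinear[symmetric] bilinear_def
  by (auto intro!: linearI simp: vec_eq_iff
      matrix_matrix_mult_def scaleR_sum_right sum.distrib ring_distribs)

interpretation matmul: complex_bilinear "(**) :: complex^'b^'a \<Rightarrow> complex^'c^'b \<Rightarrow> complex^'c^'a"
  by (rule complex_bilinear.intro)
     (simp_all add: bounded_bilinear_matrix_mult vec_eq_iff matrix_matrix_mult_def sum_distrib_left
       mult_ac)

interpretation cmul: complex_bilinear "(*) :: complex \<Rightarrow> complex \<Rightarrow> complex"
  by (rule complex_bilinear.intro) (simp_all add: bounded_bilinear_mult)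

lemma holo_on_sum: "(\<And>i. i \<in> A \<Longrightarrow> holo_on U (f i)) \<Longrightarrow> holo_on U (\<lambda>w. \<Sum>i\<in>A. f i w)"
  by (induction A rule: infinite_finite_induct) (auto intro: holo_on_add)

lemma holo_on_prod: 
  fixes f :: "'i \<Rightarrow> complex^'N \<Rightarrow> complex"
  shows "(\<And>i. i \<in> A \<Longrightarrow> holo_on U (f i)) \<Longrightarrow> holo_on U (\<lambda>w. \<Prod>i\<in>A. f i w)"
  by (induction A rule: infinite_finite_induct) (auto intro: cmul.holo)

lemma holo_on_det:
  fixes A :: "complex^'N \<Rightarrow> complex^'n^'n"
  assumes "\<And>i j. holo_on U (\<lambda>w. A w $ i $ j)"
  shows "holo_on U (\<lambda>w. det (A w))"
  unfolding det_def by (intro holo_on_sum cmul.holo holo_on_prod holo_on_const assms)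

lemma holo_on_inverse:
  fixes f :: "complex^'N \<Rightarrow> complex"
  assumes f: "holo_on U f" and nz: "\<And>w. w \<in> U \<Longrightarrow> f w \<noteq> 0"
  shows "holo_on U (\<lambda>w. inverse (f w))"
proof (rule holo_onI)
  fix w assume w: "w \<in> U"
  show "((\<lambda>w. inverse (f w)) has_derivative
      (\<lambda>v. - (inverse (f w) * frechet_derivative f (at w) v * inverse (f w)))) (at w)"
    by (rule Deriv.has_derivative_inverse[OF nz[OF w] holo_onD(1)[OF f w]])
qed (auto simp: holo_onD(2)[OF f])

lemma
  fixes A :: "complex^'n^'n"
  assumes "invertible A"
  shows matrix_inv_right: "A ** matrix_inv A = mat 1" and matrix_inv_left: "matrix_inv A ** A = mat 1"
  using someI_ex[of "\<lambda>A'. A ** A' = mat 1 \<and> A' ** A = mat 1"] assms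
  by (auto simp: matrix_inv_def invertible_def)

lemma matrix_inv_eqI:
  fixes A :: "complex^'n^'n"
  assumes "B ** A = mat 1"
  shows "matrix_inv A = B" "invertible A"
proof -
  have "A ** B = mat 1"
    using assms matrix_left_right_inverse by blast
  then show inv: "invertible A"
    using assms by (auto simp: invertible_def)
  have "matrix_inv A = (B ** A) ** matrix_inv A"
    by (simp add: assms)
  also have "\<dots> = B"
    by (simp add: matrix_mul_assoc[symmetric] matrix_inv_right[OF inv])
  finally show "matrix_inv A = B" .
qed

text \<open>By Cramer's rule the entries are quotients of determinants.\<close>

lemma holo_on_matrix_inv:
  fixes A :: "complex^'N \<Rightarrow> complex^'n^'n"
  assumes U: "open U" and A: "holo_on U A" and inv: "\<And>w. w \<in> U \<Longrightarrow> invertible (A w)"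
  shows "holo_on U (\<lambda>w. matrix_inv (A w))"
  unfolding holo_on_matrix_iff
proof (intro allI)
  fix k l
  have nz: "det (A w) \<noteq> 0" if "w \<in> U" for w
    using inv[OF that] by (simp add: invertible_det_nz)
  let ?N = "\<lambda>w. \<chi> i j. if j = k then (axis l 1 :: complex^'n) $ i else A w $ i $ j"
  have entries: "holo_on U (\<lambda>w. A w $ i $ j)" for i j
    using A by (simp add: holo_on_matrix_iff)
  have h: "holo_on U (\<lambda>w. det (?N w) * inverse (det (A w)))"
  proof (intro cmul.holo holo_on_inverse holo_on_det nz entries)
    show "holo_on U (\<lambda>w. ?N w $ i $ j)" for i j
      by (cases "j = k") (simp_all add: entries)
  qed
  have eq: "matrix_inv (A w) $ k $ l = det (?N w) * inverse (det (A w))" if w: "w \<in> U" for w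
  proof -
    have "A w *v (matrix_inv (A w) *v axis l 1) = axis l 1"
      by (simp add: matrix_vector_mul_assoc matrix_inv_right[OF inv[OF w]])
    then have "matrix_inv (A w) *v axis l 1
        = (\<chi> k. det (\<chi> i j. if j = k then (axis l 1 :: complex^'n) $ i else A w $ i $ j) / det (A w))"
      using cramer[OF nz[OF w]] by blast
    moreover have "(matrix_inv (A w) *v axis l 1) $ k = matrix_inv (A w) $ k $ l"
      by (simp add: matrix_vector_mult_def axis_def if_distrib cong: if_cong)
    ultimately show ?thesis
      by (simp add: divide_inverse)
  qed
  show "holo_on U (\<lambda>w. matrix_inv (A w) $ k $ l)"
    by (rule holo_on_cong[OF U eq[symmetric] h])
qed

text \<open>Differentiate \<open>A\<^sup>-\<^sup>1 A = 1\<close>.\<close>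

lemma pd_matrix_inv:
  fixes A :: "complex^'N \<Rightarrow> complex^'n^'n"
  assumes U: "open U" and A: "holo_on U A" and inv: "\<And>w. w \<in> U \<Longrightarrow> invertible (A w)" and w: "w \<in> U"
  shows "pd k (\<lambda>w. matrix_inv (A w)) w = - (matrix_inv (A w) ** pd k A w ** matrix_inv (A w))"
proof -
  note hi = holo_on_matrix_inv[OF U A inv]
  have "0 = pd k (\<lambda>w. matrix_inv (A w) ** A w) w"
    using pd_cong[OF U _ w, of "\<lambda>w. matrix_inv (A w) ** A w" "\<lambda>w. mat 1"] matrix_inv_left[OF inv]
    by simp
  also have "\<dots> = matrix_inv (A w) ** pd k A w + pd k (\<lambda>w. matrix_inv (A w)) w ** A w"
    by (rule matmul.pd[OF hi A w])
  finally have *: "pd k (\<lambda>w. matrix_inv (A w)) w ** A w = - (matrix_inv (A w) ** pd k A w)"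
    by (simp add: add_eq_0_iff)
  have neg: "(- X) ** Y = - (X ** Y)" for X Y :: "complex^'n^'n"
    by (simp add: vec_eq_iff matrix_matrix_mult_def sum_negf)
  have "pd k (\<lambda>w. matrix_inv (A w)) w
      = (pd k (\<lambda>w. matrix_inv (A w)) w ** A w) ** matrix_inv (A w)"
    by (simp only: matrix_mul_assoc[symmetric] matrix_inv_right[OF inv[OF w]] matrix_mul_rid)
  also have "\<dots> = - (matrix_inv (A w) ** pd k A w ** matrix_inv (A w))"
    by (simp only: * neg)
  finally show ?thesis .
qed

text \<open>The identity theorem along a complex line. The directional derivative along \<open>x\<close> preserves the
  hypothesis, so all derivatives of the one-variable restriction vanish at \<open>0\<close>.\<close>

lemma pdl_lincomb:
  fixes f :: "'i \<Rightarrow> complex^'N \<Rightarrow> complex^'b^'a"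
  assumes U: "open U" and f: "\<And>i. holo_on U (f i)" and w: "w \<in> U"
  shows "pdl I (\<lambda>w. \<Sum>i\<in>A. c i *\<^sub>C f i w) w = (\<Sum>i\<in>A. c i *\<^sub>C pdl I (f i) w)"
  using w
proof (induction I arbitrary: w)
  case (Cons k I)
  have "pdl (k # I) (\<lambda>w. \<Sum>i\<in>A. c i *\<^sub>C f i w) w = pd k (\<lambda>w. \<Sum>i\<in>A. c i *\<^sub>C pdl I (f i) w) w"
    unfolding pdl.simps by (rule pd_cong[OF U Cons.IH Cons.prems])
  also have "((\<lambda>w. \<Sum>i\<in>A. c i *\<^sub>C pdl I (f i) w) has_derivative
      (\<lambda>v. \<Sum>i\<in>A. c i *\<^sub>C frechet_derivative (pdl I (f i)) (at w) v)) (at w)"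
    by (intro has_derivative_sum
        bounded_linear.has_derivative[OF bounded_bilinear.bounded_linear_right[OF bounded_bilinear_scaleC]]
        holo_onD(1)[OF holo_on_pdl[OF U f] Cons.prems])
  from pdI[OF this] have "pd k (\<lambda>w. \<Sum>i\<in>A. c i *\<^sub>C pdl I (f i) w) w = (\<Sum>i\<in>A. c i *\<^sub>C pdl (k # I) (f i) w)"
    by (simp add: pd_def)
  finally show ?case .
qed auto

lemma vanishing_jet_on_line:
  fixes f :: "complex^'N \<Rightarrow> complex^'b^'a"
  assumes U: "open U" and f: "holo_on U f" and R: "R > 1"
    and line: "\<And>s. norm s < R \<Longrightarrow> x0 + s *\<^sub>C x \<in> U"
    and x: "\<And>k. k \<notin> \<Lambda> \<Longrightarrow> x $ k = 0"
    and jet: "\<And>I. set I \<subseteq> \<Lambda> \<Longrightarrow> pdl I f x0 = 0"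
  shows "f (x0 + x) = 0"
proof -
  have x0: "x0 \<in> U"
    using line[of 0] R by simp
  define P where "P g \<longleftrightarrow> holo_on U g \<and> (\<forall>I. set I \<subseteq> \<Lambda> \<longrightarrow> pdl I g x0 = 0)"
    for g :: "complex^'N \<Rightarrow> complex^'b^'a"
  define D where "D g = (\<lambda>w. \<Sum>k\<in>UNIV. (x $ k) *\<^sub>C pd k g w)" for g :: "complex^'N \<Rightarrow> complex^'b^'a"
  have PD: "P (D g)" if g: "P g" for g
  proof -
    have hg: "holo_on U g" using g by (simp add: P_def)
    have "holo_on U (D g)"
      unfolding D_def holo_on_matrix_iff using holo_on_pd[OF U hg, unfolded holo_on_matrix_iff]
      by (auto intro!: holo_on_sum cmul.holo)
    moreover have "pdl I (D g) x0 = 0" if I: "set I \<subseteq> \<Lambda>" for I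
    proof -
      have "pdl I (D g) x0 = (\<Sum>k\<in>UNIV. (x $ k) *\<^sub>C pdl I (pd k g) x0)"
        unfolding D_def by (rule pdl_lincomb[OF U holo_on_pd[OF U hg] x0])
      also have "\<dots> = 0"
      proof (rule sum.neutral, rule)
        fix k
        show "(x $ k) *\<^sub>C pdl I (pd k g) x0 = 0"
        proof (cases "k \<in> \<Lambda>")
          case True
          then have "pdl (I @ [k]) g x0 = 0"
            using g I unfolding P_def by (metis Un_subset_iff empty_subsetI insert_subset list.set set_append)
          then show ?thesis by (simp add: pdl_append)
        qed (use x in auto)
      qed
      finally show ?thesis .
    qed
    ultimately show ?thesis by (simp add: P_def)
  qed
  define \<phi> where "\<phi> a b g s = g (x0 + s *\<^sub>C x) $ a $ b" for a b and g :: "complex^'N \<Rightarrow> complex^'b^'a" and s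
  have d\<phi>: "(\<phi> a b g has_field_derivative \<phi> a b (D g) s) (at s)" if g: "P g" and s: "norm s < R" for a b g s
  proof -
    have hg: "holo_on U g" using g by (simp add: P_def)
    have "holo_on U (\<lambda>w. g w $ a $ b)"
      using hg by (simp add: holo_on_matrix_iff)
    from holo_on_line_derivative[OF this line[OF s]]
      frechet_derivative_eq_sum_pd[OF this line[OF s], of x]
    show ?thesis
      by (simp add: \<phi>_def[abs_def] D_def pd_nth_nth[OF hg line[OF s]])
  qed
  have jet0: "(deriv ^^ n) (\<phi> a b g) 0 = 0" if "P g" for n a b g
    using that
  proof (induction n arbitrary: g)
    case 0
    then have "pdl [] g x0 = 0" unfolding P_def by (metis empty_subsetI empty_set)
    then show ?case by (simp add: \<phi>_def)
  next
    case (Suc n)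
    have "\<forall>\<^sub>F s in nhds 0. deriv (\<phi> a b g) s = \<phi> a b (D g) s"
      using R by (intro eventually_nhds_of_open[of "ball 0 R"]) (auto intro!: DERIV_imp_deriv d\<phi> Suc.prems)
    then have "(deriv ^^ n) (deriv (\<phi> a b g)) 0 = (deriv ^^ n) (\<phi> a b (D g)) 0"
      by (intro higher_deriv_cong_ev) auto
    then show ?case
      using Suc.IH[OF PD[OF Suc.prems]] by (simp add: funpow_Suc_right del: funpow.simps)
  qed
  have Pf: "P f" using f jet by (simp add: P_def)
  have "\<phi> a b f 1 = 0" for a b
  proof (rule holomorphic_fun_eq_0_on_ball[where f = "\<phi> a b f" and w = 1 and z = 0 and r = R])
    show "\<phi> a b f holomorphic_on ball 0 R"
      unfolding holomorphic_on_open[OF open_ball]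
      by (intro ballI exI, rule d\<phi>[OF Pf]) simp
  qed (use R jet0[OF Pf] in auto)
  then show ?thesis
    by (simp add: \<phi>_def vec_eq_iff)
qed

lemma (in complex_bilinear) pdl_left:
  assumes U: "open U" and f: "\<And>I. holo_on U (pdl I f)" and w: "w \<in> U"
  shows "pdl I (\<lambda>x. h (f x) c) w = h (pdl I f w) c"
  using w
proof (induction I arbitrary: w)
  case (Cons k I)
  have "pdl (k # I) (\<lambda>x. h (f x) c) w = pd k (\<lambda>x. h (pdl I f x) c) w"
    unfolding pdl.simps by (rule pd_cong[OF U Cons.IH Cons.prems])
  also have "\<dots> = h (pdl (k # I) f w) c"
    by (subst pd[OF f holo_on_const Cons.prems]) (simp add: bounded_bilinear.zero_right[OF bb])
  finally show ?case .
qed simp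

lemma (in complex_bilinear) pdl_right:
  assumes U: "open U" and f: "\<And>I. holo_on U (pdl I f)" and w: "w \<in> U"
  shows "pdl I (\<lambda>x. h c (f x)) w = h c (pdl I f w)"
  using w
proof (induction I arbitrary: w)
  case (Cons k I)
  have "pdl (k # I) (\<lambda>x. h c (f x)) w = pd k (\<lambda>x. h c (pdl I f x)) w"
    unfolding pdl.simps by (rule pd_cong[OF U Cons.IH Cons.prems])
  also have "\<dots> = h c (pdl (k # I) f w)"
    by (subst pd[OF holo_on_const f Cons.prems]) (simp add: bounded_bilinear.zero_left[OF bb])
  finally show ?case .
qed simp

lemma pdl_diff:
  fixes f g :: "complex^'N \<Rightarrow> complex^'b^'a"
  assumes U: "open U" and f: "holo_on U f" and g: "holo_on U g" and w: "w \<in> U"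
  shows "pdl I (\<lambda>x. f x - g x) w = pdl I f w - pdl I g w"
  using w
proof (induction I arbitrary: w)
  case (Cons k I)
  have "pdl (k # I) (\<lambda>x. f x - g x) w = pd k (\<lambda>x. pdl I f x - pdl I g x) w"
    unfolding pdl.simps by (rule pd_cong[OF U Cons.IH Cons.prems])
  also have "\<dots> = pdl (k # I) f w - pdl (k # I) g w"
    by (subst pd_diff[OF holo_on_pdl[OF U f] holo_on_pdl[OF U g] Cons.prems]) simp
  finally show ?case .
qed simp

lemma pdl_add:
  fixes f g :: "complex^'N \<Rightarrow> complex^'b^'a"
  assumes U: "open U" and f: "holo_on U f" and g: "holo_on U g" and w: "w \<in> U"
  shows "pdl I (\<lambda>x. f x + g x) w = pdl I f w + pdl I g w"
  using w
proof (induction I arbitrary: w)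
  case (Cons k I)
  have "pdl (k # I) (\<lambda>x. f x + g x) w = pd k (\<lambda>x. pdl I f x + pdl I g x) w"
    unfolding pdl.simps by (rule pd_cong[OF U Cons.IH Cons.prems])
  also have "\<dots> = pdl (k # I) f w + pdl (k # I) g w"
    by (subst pd_add[OF holo_on_pdl[OF U f] holo_on_pdl[OF U g] Cons.prems]) simp
  finally show ?case .
qed simp

lemma pdl_minus:
  fixes f :: "complex^'N \<Rightarrow> complex^'b^'a"
  assumes U: "open U" and f: "holo_on U f" and w: "w \<in> U"
  shows "pdl I (\<lambda>x. - f x) w = - pdl I f w"
  using w
proof (induction I arbitrary: w)
  case (Cons k I)
  have "pdl (k # I) (\<lambda>x. - f x) w = pd k (\<lambda>x. - pdl I f x) w"
    unfolding pdl.simps by (rule pd_cong[OF U Cons.IH Cons.prems])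
  also have "\<dots> = - pdl (k # I) f w"
    by (subst pd_minus[OF holo_on_pdl[OF U f] Cons.prems]) simp
  finally show ?case .
qed simp

lemma pdl_zero: "pdl I (\<lambda>x. 0) = (\<lambda>w. 0)"
proof (induction I)
  case (Cons k I)
  show ?case
    by (simp only: pdl.simps Cons) (rule ext, simp)
qed simp

lemmas matrix_distribs =
  bounded_bilinear.add_left[OF bounded_bilinear_matrix_mult]
  bounded_bilinear.add_right[OF bounded_bilinear_matrix_mult]
  bounded_bilinear.diff_left[OF bounded_bilinear_matrix_mult]
  bounded_bilinear.diff_right[OF bounded_bilinear_matrix_mult]
  bounded_bilinear.minus_left[OF bounded_bilinear_matrix_mult]
  bounded_bilinear.minus_right[OF bounded_bilinear_matrix_mult]
  bounded_bilinear.zero_left[OF bounded_bilinear_matrix_mult]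
  bounded_bilinear.zero_right[OF bounded_bilinear_matrix_mult]

section \<open>Polarization\<close>

definition join :: "complex^'m::finite \<Rightarrow> complex^'m \<Rightarrow> complex^('m + 'm)" where
  "join z u = (\<chi> k. case k of Inl i \<Rightarrow> z $ i | Inr i \<Rightarrow> u $ i)"

definition diag :: "complex^'m::finite \<Rightarrow> complex^('m + 'm)" where
  "diag w = join w (cnj_vec w)"

definition zpart :: "complex^('m::finite + 'm) \<Rightarrow> complex^'m" where
  "zpart x = (\<chi> i. x $ Inl i)"

definition upart :: "complex^('m::finite + 'm) \<Rightarrow> complex^'m" where
  "upart x = (\<chi> i. x $ Inr i)"

lemma join_simps [simp]: "join z u $ Inl i = z $ i" "join z u $ Inr i = u $ i"
  "zpart (join z u) = z" "upart (join z u) = u" "join (zpart x) (upart x) = x"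
  by (simp_all add: join_def zpart_def upart_def vec_eq_iff split: sum.splits)

lemma vec_sum_eq_iff: "x = y \<longleftrightarrow> (\<forall>i. x $ Inl i = y $ Inl i) \<and> (\<forall>i. x $ Inr i = y $ Inr i)"
  by (auto simp: vec_eq_iff) (metis sum.exhaust)

lemma join_add: "join z u + join z' u' = join (z + z') (u + u')"
  by (simp add: vec_sum_eq_iff)

lemma join_scaleC: "c *\<^sub>C join z u = join (c *\<^sub>C z) (c *\<^sub>C u)"
  by (simp add: vec_sum_eq_iff)

lemma join_0 [simp]: "join 0 0 = 0" and diag_0 [simp]: "diag 0 = 0"
  by (simp_all add: vec_sum_eq_iff diag_def cnj_vec_def)

lemma bounded_linear_zpart: "bounded_linear zpart" and bounded_linear_upart: "bounded_linear upart"
  by (auto intro!: linear_conv_bounded_linear[THEN iffD1] linearI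
      simp: vec_eq_iff zpart_def upart_def)

lemma bounded_linear_diag: "bounded_linear diag"
proof (rule linear_conv_bounded_linear[THEN iffD1], rule linearI)
  show "diag (x + y) = diag x + diag y" for x y :: "complex^'m"
    by (simp add: vec_sum_eq_iff diag_def cnj_vec_def)
  show "diag (r *\<^sub>R x) = r *\<^sub>R diag x" for r and x :: "complex^'m"
    by (simp add: vec_sum_eq_iff diag_def cnj_vec_def)
qed

lemma diag_axis:
  "diag (axis i 1) = axis (Inl i) 1 + axis (Inr i) 1"
  "diag (axis i \<i>) = \<i> *\<^sub>C axis (Inl i) 1 - \<i> *\<^sub>C axis (Inr i) 1"
  by (simp_all add: vec_sum_eq_iff diag_def cnj_vec_def axis_def)

text \<open>The combination of the real directions \<open>1\<close> and \<open>\<i>\<close> in \<open>dz\<close> annihilates the antiholomorphic half of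
  the embedding \<open>diag\<close>, and that in \<open>dzbar\<close> the holomorphic half. This turns the real calculus in the
  definition of curvature into holomorphic calculus in twice as many variables.\<close>

lemma
  assumes \<Phi>: "holo_on W \<Phi>" and w: "diag w \<in> W"
  shows dz_diag: "dz i (\<lambda>w. \<Phi> (diag w)) w = pd (Inl i) \<Phi> (diag w)"
    and dzbar_diag: "dzbar i (\<lambda>w. \<Phi> (diag w)) w = pd (Inr i) \<Phi> (diag w)"
proof -
  define D where "D = frechet_derivative \<Phi> (at (diag w))"
  have D: "(\<Phi> has_derivative D) (at (diag w))" "\<And>c v. D (c *\<^sub>C v) = c *\<^sub>C D v"
    using holo_onD[OF \<Phi> w] by (simp_all add: D_def)
  have lin: "linear D"
    using D(1) has_derivative_bounded_linear bounded_linear.linear by blast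
  have "((\<lambda>w. \<Phi> (diag w)) has_derivative (\<lambda>v. D (diag v))) (at w)"
    using diff_chain_at[OF bounded_linear_imp_has_derivative[OF bounded_linear_diag] D(1)]
    by (simp add: o_def)
  then have fr: "frechet_derivative (\<lambda>w. \<Phi> (diag w)) (at w) = (\<lambda>v. D (diag v))"
    using frechet_derivative_at by metis
  define p q where "p = D (axis (Inl i) 1)" and "q = D (axis (Inr i) 1)"
  have half: "(1/2) *\<^sub>C x + (1/2) *\<^sub>C x = x" for x :: 'b
    by (simp flip: scaleC_add_left)
  have e1: "D (diag (axis i 1)) = p + q"
    by (simp add: diag_axis linear_add[OF lin] p_def q_def)
  have e2: "\<i> *\<^sub>C D (diag (axis i \<i>)) = q - p"
    by (simp add: diag_axis linear_diff[OF lin] D(2) scaleC_diff_right scaleC_scaleC p_def q_def)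
  show "dz i (\<lambda>w. \<Phi> (diag w)) w = pd (Inl i) \<Phi> (diag w)"
    by (simp add: dz_def fr e1 e2 pd_def flip: D_def p_def)
       (simp add: scaleC_add_right half)
  show "dzbar i (\<lambda>w. \<Phi> (diag w)) w = pd (Inr i) \<Phi> (diag w)"
    by (simp add: dzbar_def fr e1 e2 pd_def flip: D_def q_def)
       (simp add: scaleC_add_right half)
qed

lemma
  assumes "open U" "w \<in> U" "\<And>w. w \<in> U \<Longrightarrow> f w = g w"
  shows dz_cong: "dz i f w = dz i g w" and dzbar_cong: "dzbar i f w = dzbar i g w"
  using frechet_derivative_cong_open[OF assms] by (simp_all add: dz_def dzbar_def)

text \<open>Derivatives in the directions of the second group of variables only see the slice \<open>z = 0\<close>,
  to which they are tangent.\<close>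

lemma pdl_on_slice:
  fixes f g :: "complex^('m::finite + 'm) \<Rightarrow> complex^'b^'a"
  assumes W: "open W" and f: "holo_on W f" and g: "holo_on W g"
    and eq: "\<And>u. join 0 u \<in> W \<Longrightarrow> f (join 0 u) = g (join 0 u)" and u: "join 0 u \<in> W"
  shows "pdl (map Inr J) f (join 0 u) = pdl (map Inr J) g (join 0 u)"
  using u
proof (induction J arbitrary: u)
  case (Cons j J)
  define d where "d x = pdl (map Inr J) f x - pdl (map Inr J) g x" for x
  have hd: "holo_on W d"
    unfolding d_def by (intro holo_on_diff holo_on_pdl W f g)
  let ?c = "\<lambda>t::real. join 0 u + t *\<^sub>R axis (Inr j) 1"
  have dc: "(?c has_derivative (\<lambda>t. t *\<^sub>R axis (Inr j) 1)) (at 0)"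
    by (auto intro!: derivative_eq_intros)
  have c0: "?c 0 = join 0 u" by simp
  have dd: "((\<lambda>t. d (?c t)) has_derivative (\<lambda>t. frechet_derivative d (at (join 0 u)) (t *\<^sub>R axis (Inr j) 1))) (at 0)"
    using diff_chain_at[OF dc, of d "frechet_derivative d (at (join 0 u))"] holo_onD(1)[OF hd Cons.prems]
    unfolding c0 by (simp add: o_def)
  have "open (?c -` W)"
    by (intro open_vimage W continuous_intros)
  moreover have "d (?c t) = 0" if "t \<in> ?c -` W" for t
  proof -
    have "?c t = join 0 (u + t *\<^sub>R axis j 1)"
      by (simp add: vec_sum_eq_iff axis_def)
    then show ?thesis
      using Cons.IH that by (simp add: d_def)
  qed
  ultimately have "((\<lambda>t. 0) has_derivative (\<lambda>t. frechet_derivative d (at (join 0 u)) (t *\<^sub>R axis (Inr j) 1))) (at (0::real))"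
    using Cons.prems by (intro has_derivative_transform_within_open[OF dd]) auto
  then have "(\<lambda>t. frechet_derivative d (at (join 0 u)) (t *\<^sub>R axis (Inr j) 1)) = (\<lambda>t::real. 0)"
    by (rule has_derivative_unique[OF _ has_derivative_const])
  then have "frechet_derivative d (at (join 0 u)) (1 *\<^sub>R axis (Inr j) 1) = 0"
    by meson
  then have "pd (Inr j) d (join 0 u) = 0"
    by (simp add: pd_def)
  moreover have "pd (Inr j) d (join 0 u) = pdl (map Inr (j # J)) f (join 0 u) - pdl (map Inr (j # J)) g (join 0 u)"
    unfolding d_def using pd_diff[OF holo_on_pdl[OF W f] holo_on_pdl[OF W g] Cons.prems] by simp
  ultimately show ?case by simp
qed (use eq in simp)

section \<open>Curvature in a polarized metric\<close>

text \<open>\<open>B\<close> is a polarized metric, normalised to be the identity on the slice \<open>z = 0\<close>. Multiplying a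
  polarized metric from the left by a function of \<open>u\<close> changes neither the connection nor, therefore,
  the curvature, so that every metric can be normalised in this way without changing the frame.\<close>

locale polarized_connection =
  fixes W :: "(complex^('m::finite + 'm)) set" and U :: "(complex^'m) set"
    and B :: "complex^('m + 'm) \<Rightarrow> complex^'n^'n" and h :: "complex^'m \<Rightarrow> complex^'n^'n"
  assumes W: "open W" and U: "open U" and diag_in: "w \<in> U \<Longrightarrow> diag w \<in> W" and U0: "0 \<in> U"
    and B: "holo_on W B" and inv: "x \<in> W \<Longrightarrow> invertible (B x)"
    and unit: "join 0 u \<in> W \<Longrightarrow> B (join 0 u) = mat 1"
    and conn: "w \<in> U \<Longrightarrow> connection h i w = matrix_inv (B (diag w)) ** pd (Inl i) B (diag w)"
begin

abbreviation "Bi \<equiv> \<lambda>x. matrix_inv (B x)"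

definition \<Psi> :: "'m \<Rightarrow> complex^('m + 'm) \<Rightarrow> complex^'n^'n" where
  "\<Psi> j x = pd (Inr j) B x ** Bi x"

lemma Bi: "holo_on W Bi"
  by (rule holo_on_matrix_inv[OF W B inv])

lemma holo_\<Psi>: "holo_on W (\<Psi> j)"
  unfolding \<Psi>_def[abs_def] by (intro matmul.holo holo_on_pd W B Bi)

text \<open>Conjugation by \<open>B\<close> turns the covariant derivative into the ordinary one: differentiating the two
  factors \<open>B\<close> produces the commutator with the connection.\<close>

lemma covariant_derivative_conjugate:
  fixes k
  assumes Y: "holo_on W Y" and x: "x \<in> W"
  defines "M \<equiv> \<lambda>x. Bi x ** Y x ** B x" and "\<Theta> \<equiv> Bi x ** pd k B x"
  shows "pd k M x + (\<Theta> ** M x - M x ** \<Theta>) = Bi x ** pd k Y x ** B x"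
proof -
  have "pd k M x = (Bi x ** Y x) ** pd k B x + pd k (\<lambda>x. Bi x ** Y x) x ** B x"
    unfolding M_def by (rule matmul.pd[OF matmul.holo[OF Bi Y] B x])
  also have "pd k (\<lambda>x. Bi x ** Y x) x = Bi x ** pd k Y x + pd k Bi x ** Y x"
    by (rule matmul.pd[OF Bi Y x])
  also have "pd k Bi x = - (Bi x ** pd k B x ** Bi x)"
    by (rule pd_matrix_inv[OF W B inv x])
  finally have 1: "pd k M x = Bi x ** Y x ** pd k B x + (Bi x ** pd k Y x ** B x - \<Theta> ** M x)"
    by (simp add: matrix_distribs M_def \<Theta>_def matrix_mul_assoc)
  have "M x ** \<Theta> = Bi x ** Y x ** (B x ** Bi x) ** pd k B x"
    by (simp add: M_def \<Theta>_def matrix_mul_assoc)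
  then have "M x ** \<Theta> = Bi x ** Y x ** pd k B x"
    by (simp add: matrix_inv_right[OF inv[OF x]])
  with 1 show ?thesis by simp
qed

text \<open>Conjugated by \<open>B\<close>, the curvature is itself a \<open>z\<close>-derivative, by symmetry of the mixed derivatives of \<open>B\<close>.\<close>

lemma curvature_matrix_polarized:
  assumes w: "w \<in> U"
  shows "curvature_matrix h i j w = Bi (diag w) ** (- pd (Inl i) (\<Psi> j) (diag w)) ** B (diag w)"
proof -
  let ?x = "diag w"
  note x = diag_in[OF w]
  have "dzbar j (connection h i) w = dzbar j (\<lambda>w. Bi (diag w) ** pd (Inl i) B (diag w)) w"
    by (rule dzbar_cong[OF U w conn])
  also have "\<dots> = pd (Inr j) (\<lambda>x. Bi x ** pd (Inl i) B x) ?x"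
    by (rule dzbar_diag[OF matmul.holo[OF Bi holo_on_pd[OF W B]] x])
  also have "\<dots> = Bi ?x ** pd (Inr j) (pd (Inl i) B) ?x + pd (Inr j) Bi ?x ** pd (Inl i) B ?x"
    by (rule matmul.pd[OF Bi holo_on_pd[OF W B] x])
  also have "pd (Inr j) Bi ?x = - (Bi ?x ** pd (Inr j) B ?x ** Bi ?x)"
    by (rule pd_matrix_inv[OF W B inv x])
  finally have 1: "dzbar j (connection h i) w = Bi ?x ** pd (Inr j) (pd (Inl i) B) ?x
      - Bi ?x ** pd (Inr j) B ?x ** Bi ?x ** pd (Inl i) B ?x"
    by (simp add: matrix_distribs)
  have "pd (Inl i) (\<Psi> j) ?x = pd (Inr j) B ?x ** pd (Inl i) Bi ?x + pd (Inl i) (pd (Inr j) B) ?x ** Bi ?x"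
    unfolding \<Psi>_def[abs_def] by (rule matmul.pd[OF holo_on_pd[OF W B] Bi x])
  also have "pd (Inl i) Bi ?x = - (Bi ?x ** pd (Inl i) B ?x ** Bi ?x)"
    by (rule pd_matrix_inv[OF W B inv x])
  also have "pd (Inl i) (pd (Inr j) B) ?x = pd (Inr j) (pd (Inl i) B) ?x"
    by (rule pd_commute[OF W B x])
  finally have "Bi ?x ** pd (Inl i) (\<Psi> j) ?x ** B ?x =
      Bi ?x ** pd (Inr j) (pd (Inl i) B) ?x ** (Bi ?x ** B ?x)
      - Bi ?x ** pd (Inr j) B ?x ** Bi ?x ** pd (Inl i) B ?x ** (Bi ?x ** B ?x)"
    by (simp add: matrix_distribs matrix_mul_assoc)
  then have "Bi ?x ** pd (Inl i) (\<Psi> j) ?x ** B ?x = dzbar j (connection h i) w"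
    by (simp add: matrix_inv_left[OF inv[OF x]] 1)
  then show ?thesis
    by (simp add: curvature_matrix_def matrix_distribs)
qed

lemma covariant_dz_polarized:
  assumes w: "w \<in> U"
  shows "covariant_dz h (curvature_matrix h i j) I w =
    Bi (diag w) ** pdl (map Inl I) (\<lambda>x. - pd (Inl i) (\<Psi> j) x) (diag w) ** B (diag w)"
  using w
proof (induction I arbitrary: w)
  case Nil
  then show ?case by (simp add: curvature_matrix_polarized)
next
  case (Cons k I)
  let ?Y = "pdl (map Inl I) (\<lambda>x. - pd (Inl i) (\<Psi> j) x)"
  have Y: "holo_on W ?Y"
    by (intro holo_on_pdl holo_on_minus holo_on_pd W holo_\<Psi>)
  let ?M = "\<lambda>x. Bi x ** ?Y x ** B x"
  have "dz k (covariant_dz h (curvature_matrix h i j) I) w = dz k (\<lambda>w. ?M (diag w)) w"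
    by (rule dz_cong[OF U Cons.prems Cons.IH])
  also have "\<dots> = pd (Inl k) ?M (diag w)"
    by (rule dz_diag[OF matmul.holo[OF matmul.holo[OF Bi Y] B] diag_in[OF Cons.prems]])
  finally show ?case
    using covariant_derivative_conjugate[OF Y diag_in[OF Cons.prems], of "Inl k"]
    by (simp add: Cons.IH[OF Cons.prems] conn[OF Cons.prems])
qed

text \<open>The derivatives in \<open>u\<close> may be computed on the slice \<open>z = 0\<close>, where conjugation by \<open>B\<close> is trivial.\<close>

lemma curvature_derivative_polarized:
  "curvature_derivative_matrix h I J i j 0
     = - pdl (map Inr J) (pdl (map Inl I) (pd (Inl i) (\<Psi> j))) 0"
proof -
  let ?Y = "pdl (map Inl I) (\<lambda>x. - pd (Inl i) (\<Psi> j) x)"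
  have Y: "holo_on W ?Y"
    by (intro holo_on_pdl holo_on_minus holo_on_pd W holo_\<Psi>)
  let ?M = "\<lambda>x. Bi x ** ?Y x ** B x"
  have M: "holo_on W ?M"
    by (intro matmul.holo Bi Y B)
  have *: "covariant_dzbar (covariant_dz h (curvature_matrix h i j) I) J w = pdl (map Inr J) ?M (diag w)"
    if "w \<in> U" for w
    using that
  proof (induction J arbitrary: w)
    case Nil
    then show ?case by (simp add: covariant_dz_polarized)
  next
    case (Cons k J)
    have "dzbar k (covariant_dzbar (covariant_dz h (curvature_matrix h i j) I) J) w
        = dzbar k (\<lambda>w. pdl (map Inr J) ?M (diag w)) w"
      by (rule dzbar_cong[OF U Cons.prems Cons.IH])
    also have "\<dots> = pd (Inr k) (pdl (map Inr J) ?M) (diag w)"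
      by (rule dzbar_diag[OF holo_on_pdl[OF W M] diag_in[OF Cons.prems]])
    finally show ?case by simp
  qed
  have W0: "0 \<in> W" "join 0 0 \<in> W"
    using diag_in[OF U0] by simp_all
  have "pdl (map Inr J) ?M (join 0 0) = pdl (map Inr J) ?Y (join 0 0)"
  proof (rule pdl_on_slice[OF W M Y _ W0(2)])
    show "?M (join 0 u) = ?Y (join 0 u)" if "join 0 u \<in> W" for u
      using matrix_inv_eqI(1)[of "mat 1" "mat 1 :: complex^'n^'n"] by (simp add: unit[OF that])
  qed
  also have "\<dots> = pdl (map Inr J) (\<lambda>x. - pdl (map Inl I) (pd (Inl i) (\<Psi> j)) x) (join 0 0)"
    by (rule pdl_cong[OF W pdl_minus[OF W holo_on_pd[OF W holo_\<Psi>]] W0(2)])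
  also have "\<dots> = - pdl (map Inr J) (pdl (map Inl I) (pd (Inl i) (\<Psi> j))) (join 0 0)"
    by (rule pdl_minus[OF W holo_on_pdl[OF W holo_on_pd[OF W holo_\<Psi>]] W0(2)])
  finally show ?thesis
    using *[OF U0] by (simp add: curvature_derivative_matrix_def)
qed

end

section \<open>Local rigidity\<close>

definition polydisc :: "real \<Rightarrow> (complex^('m::finite + 'm)) set" where
  "polydisc r = {x. norm (zpart x) < r \<and> norm (upart x) < r}"

lemma join_in_polydisc: "join z u \<in> polydisc r \<longleftrightarrow> norm z < r \<and> norm u < r"
  by (simp add: polydisc_def)

lemma open_polydisc: "open (polydisc r)"
  unfolding polydisc_def
  by (intro open_Collect_conj open_Collect_less continuous_intros continuous_on_norm
      linear_continuous_on bounded_linear_zpart bounded_linear_upart)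

lemma norm_cnj_vec [simp]: "norm (cnj_vec w) = norm w"
  by (simp add: cnj_vec_def norm_vec_def)

lemma diag_in_polydisc: "norm w < r \<Longrightarrow> diag w \<in> polydisc r"
  by (simp add: diag_def join_in_polydisc)

text \<open>A line through a point of the polydisc stays inside a little beyond the unit disc of parameters.\<close>

lemma dilation_exists:
  fixes a r :: real
  assumes "0 \<le> a" "a < r" obtains R where "R > 1" "R * a < r"
proof (cases "a = 0")
  case True
  then show ?thesis using that[of 2] assms by simp
next
  case False
  obtain q where "a < q" "q < r" using dense assms by blast
  then show ?thesis
    using that[of "q / a"] False assms by simp
qed

lemma
  fixes f :: "complex^('m::finite + 'm) \<Rightarrow> complex^'b^'a"
  assumes f: "holo_on (polydisc r) f" and z: "norm z < r" and u: "norm u < r"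
  shows vanishing_in_u: "(\<And>J. pdl (map Inr J) f (join z 0) = 0) \<Longrightarrow> f (join z u) = 0"
    and vanishing_in_z: "(\<And>I. pdl (map Inl I) f (join 0 u) = 0) \<Longrightarrow> f (join z u) = 0"
proof -
  assume jet: "\<And>J. pdl (map Inr J) f (join z 0) = 0"
  obtain R where R: "R > 1" "R * norm u < r"
    using dilation_exists[of "norm u" r] u by auto
  have "f (join z 0 + join 0 u) = 0"
  proof (rule vanishing_jet_on_line[OF open_polydisc f R(1), where \<Lambda> = "range Inr"])
    fix s :: complex assume s: "norm s < R"
    have "norm s * norm u < r"
      using mult_right_mono[of "norm s" R "norm u"] s R(2) by simp
    then show "join z 0 + s *\<^sub>C join 0 u \<in> polydisc r"
      using z by (simp add: join_add join_scaleC join_in_polydisc)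
  next
    fix k :: "'m + 'm" assume "k \<notin> range Inr"
    then show "join 0 u $ k = 0" by (cases k) auto
  next
    fix I :: "('m + 'm) list" assume "set I \<subseteq> range Inr"
    then obtain J where "I = map Inr J" by (metis ex_map_conv in_mono rangeE)
    then show "pdl I f (join z 0) = 0" using jet by simp
  qed
  then show "f (join z u) = 0" by (simp add: join_add)
next
  assume jet: "\<And>I. pdl (map Inl I) f (join 0 u) = 0"
  obtain R where R: "R > 1" "R * norm z < r"
    using dilation_exists[of "norm z" r] z by auto
  have "f (join 0 u + join z 0) = 0"
  proof (rule vanishing_jet_on_line[OF open_polydisc f R(1), where \<Lambda> = "range Inl"])
    fix s :: complex assume s: "norm s < R"
    have "norm s * norm z < r"
      using mult_right_mono[of "norm s" R "norm z"] s R(2) by simp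
    then show "join 0 u + s *\<^sub>C join z 0 \<in> polydisc r"
      using u by (simp add: join_add join_scaleC join_in_polydisc)
  next
    fix k :: "'m + 'm" assume "k \<notin> range Inl"
    then show "join z 0 $ k = 0" by (cases k) auto
  next
    fix I :: "('m + 'm) list" assume "set I \<subseteq> range Inl"
    then obtain J where "I = map Inl J" by (metis ex_map_conv in_mono rangeE)
    then show "pdl I f (join 0 u) = 0" using jet by simp
  qed
  then show "f (join z u) = 0" by (simp add: join_add)
qed

text \<open>The logarithmic \<open>u\<close>-derivative of a polarized metric. Up to sign, its \<open>z\<close>-derivatives on the
  slice \<open>z = 0\<close> are the covariant derivatives of the curvature.\<close>

definition logder :: "(complex^('m::finite + 'm) \<Rightarrow> complex^'n^'n) \<Rightarrow> 'm \<Rightarrow>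
    complex^('m + 'm) \<Rightarrow> complex^'n^'n" where
  "logder B j x = pd (Inr j) B x ** matrix_inv (B x)"

locale normalized_metric =
  fixes r :: real and B :: "complex^('m::finite + 'm) \<Rightarrow> complex^'n^'n"
  assumes r: "r > 0" and B: "holo_on (polydisc r) B"
    and inv: "x \<in> polydisc r \<Longrightarrow> invertible (B x)"
    and unit: "norm u < r \<Longrightarrow> B (join 0 u) = mat 1"
begin

lemma Bi: "holo_on (polydisc r) (\<lambda>x. matrix_inv (B x))"
  by (rule holo_on_matrix_inv[OF open_polydisc B inv])

lemma holo_logder: "holo_on (polydisc r) (logder B j)"
  unfolding logder_def[abs_def] by (intro matmul.holo holo_on_pd open_polydisc B Bi)

lemma logder_slice:
  assumes "norm u < r" shows "logder B j (join 0 u) = 0"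
proof -
  have "pdl (map Inr [j]) B (join 0 u) = pdl (map Inr [j]) (\<lambda>x. mat 1) (join 0 u)"
    by (rule pdl_on_slice[OF open_polydisc B]) (use assms r in \<open>auto simp: unit join_in_polydisc\<close>)
  then show ?thesis by (simp add: logder_def matrix_distribs)
qed

end

text \<open>Equal curvature data force equal logarithmic derivatives, because a holomorphic function is
  determined by its \<open>u\<close>-jets on the slice and then by its \<open>z\<close>-jets. Metrics with the same
  logarithmic \<open>u\<close>-derivative differ by a factor depending on \<open>z\<close> only.\<close>

lemma normalized_metrics_rigid:
  fixes B1 B2 :: "complex^('m::finite + 'm) \<Rightarrow> complex^'n^'n" and A :: "complex^'n^'n"
  assumes "normalized_metric r B1" "normalized_metric r B2"
    and data: "\<And>I J i j. A ** pdl (map Inr J) (pdl (map Inl I) (pd (Inl i) (logder B1 j))) 0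
       = pdl (map Inr J) (pdl (map Inl I) (pd (Inl i) (logder B2 j))) 0 ** A"
    and z: "norm z < r" and u: "norm u < r"
  shows "A ** B1 (join z u) = B2 (join z u) ** (matrix_inv (B2 (join z 0)) ** A ** B1 (join z 0))"
proof -
  interpret M1: normalized_metric r B1 by fact
  interpret M2: normalized_metric r B2 by fact
  note W = open_polydisc[of r, where ?'a = 'm]
  define \<Delta> where "\<Delta> j x = A ** logder B1 j x - logder B2 j x ** A" for j x
  have h: "holo_on (polydisc r) (\<lambda>x. A ** logder B1 j x)" "holo_on (polydisc r) (\<lambda>x. logder B2 j x ** A)" for j
    by (intro matmul.holo holo_on_const M1.holo_logder M2.holo_logder)+
  have \<Delta>: "holo_on (polydisc r) (\<Delta> j)" for j
    unfolding \<Delta>_def by (rule holo_on_diff[OF h])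
  have pdl\<Delta>: "pdl I (\<Delta> j) x = A ** pdl I (logder B1 j) x - pdl I (logder B2 j) x ** A"
    if "x \<in> polydisc r" for I j x
    unfolding \<Delta>_def pdl_diff[OF W h that]
    by (simp add: matmul.pdl_left[OF W holo_on_pdl[OF W M2.holo_logder] that]
        matmul.pdl_right[OF W holo_on_pdl[OF W M1.holo_logder] that])
  have zero_in: "0 \<in> polydisc r"
    using join_in_polydisc[of 0 0 r] M1.r by simp
  have slice: "pdl (map Inl I) (\<Delta> j) (join 0 u) = 0" if u: "norm u < r" for I j u
  proof (cases I rule: rev_cases)
    case Nil
    then show ?thesis by (simp add: \<Delta>_def M1.logder_slice[OF u] M2.logder_slice[OF u] matrix_distribs)
  next
    case (snoc I' i)
    show ?thesis
    proof (rule vanishing_in_u[OF holo_on_pdl[OF W \<Delta>] _ u])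
      fix J
      have "pdl (map Inr J) (pdl (map Inl I) (\<Delta> j)) 0 = pdl (map Inr J @ map Inl I) (\<Delta> j) 0"
        by (simp add: pdl_append)
      also have "\<dots> = 0"
        unfolding pdl\<Delta>[OF zero_in] using data[of J I' i j] by (simp add: snoc pdl_append)
      finally show "pdl (map Inr J) (pdl (map Inl I) (\<Delta> j)) (join 0 0) = 0" by simp
    qed (simp add: M1.r)
  qed
  have eq: "A ** logder B1 j x = logder B2 j x ** A" if "x \<in> polydisc r" for j x
  proof -
    have "\<Delta> j (join (zpart x) (upart x)) = 0"
      using that by (intro vanishing_in_z[OF \<Delta>] slice) (auto simp: polydisc_def)
    then show ?thesis by (simp add: \<Delta>_def)
  qed
  define C where "C x = matrix_inv (B2 x) ** A ** B1 x" for x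
  have h1: "holo_on (polydisc r) (\<lambda>x. matrix_inv (B2 x) ** A)"
    by (intro matmul.holo holo_on_const M2.Bi)
  have C: "holo_on (polydisc r) C"
    unfolding C_def by (rule matmul.holo[OF h1 M1.B])
  have pdC: "pd (Inr j) C x = 0" if x: "x \<in> polydisc r" for j x
  proof -
    have "pd (Inr j) C x = (matrix_inv (B2 x) ** A) ** pd (Inr j) B1 x
        + pd (Inr j) (\<lambda>x. matrix_inv (B2 x) ** A) x ** B1 x"
      unfolding C_def by (rule matmul.pd[OF h1 M1.B x])
    also have "pd (Inr j) (\<lambda>x. matrix_inv (B2 x) ** A) x = pd (Inr j) (\<lambda>x. matrix_inv (B2 x)) x ** A"
      by (subst matmul.pd[OF M2.Bi holo_on_const x]) (simp add: matrix_distribs)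
    also have "pd (Inr j) (\<lambda>x. matrix_inv (B2 x)) x
        = - (matrix_inv (B2 x) ** logder B2 j x)"
      by (subst pd_matrix_inv[OF W M2.B M2.inv x]) (simp_all add: logder_def matrix_mul_assoc)
    also have "pd (Inr j) B1 x = logder B1 j x ** B1 x"
      by (simp add: logder_def matrix_mul_assoc[symmetric] matrix_inv_left[OF M1.inv[OF x]])
    finally have "pd (Inr j) C x = matrix_inv (B2 x) ** (A ** logder B1 j x - logder B2 j x ** A) ** B1 x"
      by (simp add: matrix_distribs matrix_mul_assoc)
    then show ?thesis
      by (simp add: eq[OF x] matrix_distribs)
  qed
  have "C (join z u) - C (join z 0) = 0"
  proof (rule vanishing_in_u[OF holo_on_diff[OF C holo_on_const] z u])
    fix J :: "'m list"
    have zin: "join z 0 \<in> polydisc r" using z M1.r by (simp add: join_in_polydisc)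
    show "pdl (map Inr J) (\<lambda>x. C x - C (join z 0)) (join z 0) = 0"
    proof (cases J rule: rev_cases)
      case (snoc J' j)
      have "pdl (map Inr J') (pd (Inr j) (\<lambda>x. C x - C (join z 0))) (join z 0)
          = pdl (map Inr J') (\<lambda>x. 0) (join z 0)"
        by (rule pdl_cong[OF W _ zin]) (simp add: pd_diff[OF C holo_on_const] pdC)
      then show ?thesis by (simp add: snoc pdl_append pdl_zero)
    qed simp
  qed
  then have "B2 (join z u) ** C (join z u) = B2 (join z u) ** C (join z 0)" by simp
  moreover have "B2 (join z u) ** C (join z u)
      = (B2 (join z u) ** matrix_inv (B2 (join z u))) ** A ** B1 (join z u)"
    by (simp add: C_def matrix_mul_assoc)
  ultimately show ?thesis
    using z u by (simp add: matrix_inv_right[OF M2.inv] join_in_polydisc C_def)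
qed

section \<open>Kronecker products\<close>

text \<open>The Kronecker product of an \<open>'a\<times>'a\<close> and a \<open>'b\<times>'b\<close> matrix, with rows and columns indexed by
  a type \<open>'n\<close> in bijection with the pairs, because it is to be compared with matrices over \<open>'n\<close>.\<close>

definition kron :: "('n \<Rightarrow> 'a \<times> 'b) \<Rightarrow> complex^'a^'a \<Rightarrow> complex^'b^'b \<Rightarrow> complex^'n^'n" where
  "kron \<beta> X Y = (\<chi> l l'. X $ fst (\<beta> l) $ fst (\<beta> l') * Y $ snd (\<beta> l) $ snd (\<beta> l'))"

lemma sum_bij_pairs:
  fixes \<beta> :: "'n::finite \<Rightarrow> 'a::finite \<times> 'b::finite"
  assumes "bij \<beta>"
  shows "(\<Sum>l\<in>UNIV. g (fst (\<beta> l)) (snd (\<beta> l))) = (\<Sum>a\<in>UNIV. \<Sum>b\<in>UNIV. g a b)"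
proof -
  have "(\<Sum>l\<in>UNIV. g (fst (\<beta> l)) (snd (\<beta> l))) = (\<Sum>p\<in>UNIV. g (fst p) (snd p))"
    using sum.reindex_bij_betw[OF assms, of "\<lambda>p. g (fst p) (snd p)"] by simp
  also have "\<dots> = (\<Sum>a\<in>UNIV. \<Sum>b\<in>UNIV. g a b)"
    by (simp add: sum.cartesian_product case_prod_unfold flip: UNIV_Times_UNIV)
  finally show ?thesis .
qed

interpretation kron: complex_bilinear "kron \<beta> :: complex^'a^'a \<Rightarrow> complex^'b^'b \<Rightarrow> complex^'n^'n"
  by (rule complex_bilinear.intro)
     (auto intro!: linearI simp: bilinear_conv_bounded_bilinear[symmetric] bilinear_def vec_eq_iff
        kron_def algebra_simps)

lemma kron_mult:
  fixes \<beta> :: "'n::finite \<Rightarrow> 'a::finite \<times> 'b::finite"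
  assumes "bij \<beta>"
  shows "kron \<beta> X Y ** kron \<beta> X' Y' = kron \<beta> (X ** X') (Y ** Y')"
proof -
  have "(\<Sum>k\<in>UNIV. X $ fst (\<beta> i) $ fst (\<beta> k) * Y $ snd (\<beta> i) $ snd (\<beta> k) *
      (X' $ fst (\<beta> k) $ fst (\<beta> j) * Y' $ snd (\<beta> k) $ snd (\<beta> j)))
    = (\<Sum>a\<in>UNIV. X $ fst (\<beta> i) $ a * X' $ a $ fst (\<beta> j)) * (\<Sum>b\<in>UNIV. Y $ snd (\<beta> i) $ b * Y' $ b $ snd (\<beta> j))"
    for i j
    by (subst sum_bij_pairs[OF assms, of "\<lambda>a b. X $ fst (\<beta> i) $ a * Y $ snd (\<beta> i) $ b *
      (X' $ a $ fst (\<beta> j) * Y' $ b $ snd (\<beta> j))"]) (simp add: sum_product mult_ac)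
  then show ?thesis
    by (simp add: vec_eq_iff kron_def matrix_matrix_mult_def)
qed

lemma kron_unit:
  fixes \<beta> :: "'n::finite \<Rightarrow> 'a::finite \<times> 'b::finite"
  assumes "bij \<beta>"
  shows "kron \<beta> (mat 1) (mat 1) = mat 1"
proof -
  have "i = j" if "fst (\<beta> i) = fst (\<beta> j)" "snd (\<beta> i) = snd (\<beta> j)" for i j
    using injD[OF bij_is_inj[OF assms], of i j] that by (simp add: prod_eq_iff)
  then show ?thesis
    by (auto simp: vec_eq_iff kron_def mat_def)
qed

lemma
  fixes \<beta> :: "'n::finite \<Rightarrow> 'a::finite \<times> 'b::finite"
  assumes \<beta>: "bij \<beta>" and X: "invertible X" and Y: "invertible Y"
  shows matrix_inv_kron: "matrix_inv (kron \<beta> X Y) = kron \<beta> (matrix_inv X) (matrix_inv Y)"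
    and invertible_kron: "invertible (kron \<beta> X Y)"
proof -
  have *: "kron \<beta> (matrix_inv X) (matrix_inv Y) ** kron \<beta> X Y = mat 1"
    by (simp add: kron_mult[OF \<beta>] matrix_inv_left[OF X] matrix_inv_left[OF Y] kron_unit[OF \<beta>])
  show "matrix_inv (kron \<beta> X Y) = kron \<beta> (matrix_inv X) (matrix_inv Y)" "invertible (kron \<beta> X Y)"
    by (rule matrix_inv_eqI[OF *])+
qed

lemma normalized_metric_kron:
  fixes \<beta> :: "'n::finite \<Rightarrow> 'a::finite \<times> 'b::finite"
    and X :: "complex^('m::finite + 'm) \<Rightarrow> complex^'a^'a"
  assumes \<beta>: "bij \<beta>" and X: "normalized_metric r X" and Y: "normalized_metric r Y"
  shows "normalized_metric r (\<lambda>x. kron \<beta> (X x) (Y x))"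
    and "x \<in> polydisc r \<Longrightarrow> logder (\<lambda>x. kron \<beta> (X x) (Y x)) j x
       = kron \<beta> (logder X j x) (mat 1) + kron \<beta> (mat 1) (logder Y j x)"
proof -
  interpret X: normalized_metric r X by fact
  interpret Y: normalized_metric r Y by fact
  show "normalized_metric r (\<lambda>x. kron \<beta> (X x) (Y x))"
    by unfold_locales
       (auto intro: X.r kron.holo X.B Y.B invertible_kron[OF \<beta>] X.inv Y.inv
         simp: X.unit Y.unit kron_unit[OF \<beta>])
  assume x: "x \<in> polydisc r"
  show "logder (\<lambda>x. kron \<beta> (X x) (Y x)) j x
       = kron \<beta> (logder X j x) (mat 1) + kron \<beta> (mat 1) (logder Y j x)"
    unfolding logder_def kron.pd[OF X.B Y.B x] matrix_inv_kron[OF \<beta> X.inv[OF x] Y.inv[OF x]]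
    by (simp add: matrix_distribs kron_mult[OF \<beta>] matrix_inv_right[OF X.inv[OF x]]
        matrix_inv_right[OF Y.inv[OF x]])
qed

text \<open>This is \<open>K \<otimes> I + I \<otimes> K'\<close> for the curvature of a tensor product and all its derivatives: the
  logarithmic derivative turns the product into a sum.\<close>

lemma curvature_data_kron:
  fixes \<beta> :: "'n::finite \<Rightarrow> 'a::finite \<times> 'b::finite"
    and X :: "complex^('m::finite + 'm) \<Rightarrow> complex^'a^'a"
  assumes \<beta>: "bij \<beta>" and X: "normalized_metric r X" and Y: "normalized_metric r Y"
    and x: "x \<in> polydisc r"
  shows "pdl I (logder (\<lambda>x. kron \<beta> (X x) (Y x)) j) x
     = kron \<beta> (pdl I (logder X j) x) (mat 1) + kron \<beta> (mat 1) (pdl I (logder Y j) x)"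
proof -
  interpret X: normalized_metric r X by fact
  interpret Y: normalized_metric r Y by fact
  note W = open_polydisc[of r, where ?'a = 'm]
  have "pdl I (logder (\<lambda>x. kron \<beta> (X x) (Y x)) j) x
      = pdl I (\<lambda>x. kron \<beta> (logder X j x) (mat 1) + kron \<beta> (mat 1) (logder Y j x)) x"
    by (rule pdl_cong[OF W normalized_metric_kron(2)[OF \<beta> X Y] x])
  also have "\<dots> = pdl I (\<lambda>x. kron \<beta> (logder X j x) (mat 1)) x + pdl I (\<lambda>x. kron \<beta> (mat 1) (logder Y j x)) x"
    by (rule pdl_add[OF W kron.holo[OF X.holo_logder holo_on_const]
          kron.holo[OF holo_on_const Y.holo_logder] x])
  also have "\<dots> = kron \<beta> (pdl I (logder X j) x) (mat 1) + kron \<beta> (mat 1) (pdl I (logder Y j) x)"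
    by (simp add: kron.pdl_left[OF W holo_on_pdl[OF W X.holo_logder] x]
        kron.pdl_right[OF W holo_on_pdl[OF W Y.holo_logder] x])
  finally show ?thesis .
qed

section \<open>Gram matrices of holomorphic frames\<close>

definition polarized_gram ::
    "('n::finite \<Rightarrow> complex^'m::finite \<Rightarrow> 'a::complex_inner) \<Rightarrow> complex^('m + 'm) \<Rightarrow> complex^'n^'n" where
  "polarized_gram \<sigma> x = (\<chi> i j. cinner (\<sigma> j (zpart x)) (\<sigma> i (cnj_vec (upart x))))"

definition normalized_gram ::
    "('n::finite \<Rightarrow> complex^'m::finite \<Rightarrow> 'a::complex_inner) \<Rightarrow> complex^('m + 'm) \<Rightarrow> complex^'n^'n" where
  "normalized_gram \<sigma> x = matrix_inv (polarized_gram \<sigma> (join 0 (upart x))) ** polarized_gram \<sigma> x"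

lemma cnj_vec_cnj_vec [simp]: "cnj_vec (cnj_vec w) = w"
  and cnj_vec_0 [simp]: "cnj_vec 0 = 0"
  by (simp_all add: cnj_vec_def vec_eq_iff)

lemma polarized_gram_diag: "polarized_gram \<sigma> (diag w) = gram \<sigma> w"
  by (simp add: polarized_gram_def gram_def diag_def)

lemma bounded_linear_cnj_vec: "bounded_linear cnj_vec"
  by (auto intro!: linear_conv_bounded_linear[THEN iffD1] linearI simp: vec_eq_iff cnj_vec_def)

lemma part_scaleC: "zpart (c *\<^sub>C v) = c *\<^sub>C zpart v" "upart (c *\<^sub>C v) = c *\<^sub>C upart v"
  "cnj_vec (c *\<^sub>C y) = cnj c *\<^sub>C cnj_vec y"
  by (simp_all add: vec_eq_iff zpart_def upart_def cnj_vec_def)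

lemma holo_on_polarized_gram:
  fixes \<sigma> :: "'n::finite \<Rightarrow> complex^'m::finite \<Rightarrow> 'a::complex_inner"
  assumes \<sigma>: "\<And>i. holo_on (ball 0 r) (\<sigma> i)"
  shows "holo_on (polydisc r) (polarized_gram \<sigma>)"
  unfolding holo_on_matrix_iff
proof (intro allI)
  fix i j
  define Dz where "Dz x = frechet_derivative (\<sigma> j) (at (zpart x))" for x
  define Du where "Du x = frechet_derivative (\<sigma> i) (at (cnj_vec (upart x)))" for x
  show "holo_on (polydisc r) (\<lambda>x. polarized_gram \<sigma> x $ i $ j)"
  proof (rule holo_onI)
    fix x :: "complex^('m + 'm)" assume "x \<in> polydisc r"
    then have x: "zpart x \<in> ball 0 r" "cnj_vec (upart x) \<in> ball 0 r"
      by (auto simp: polydisc_def)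
    have "((\<lambda>x. \<sigma> j (zpart x)) has_derivative (\<lambda>v. Dz x (zpart v))) (at x)"
      using diff_chain_at[OF bounded_linear_imp_has_derivative[OF bounded_linear_zpart] holo_onD(1)[OF \<sigma> x(1)]]
      by (simp add: o_def Dz_def)
    moreover have "((\<lambda>x. \<sigma> i (cnj_vec (upart x))) has_derivative (\<lambda>v. Du x (cnj_vec (upart v)))) (at x)"
      using diff_chain_at[OF bounded_linear_imp_has_derivative[OF
            bounded_linear_compose[OF bounded_linear_cnj_vec bounded_linear_upart]] holo_onD(1)[OF \<sigma> x(2)]]
      by (simp add: o_def Du_def)
    ultimately show "((\<lambda>x. polarized_gram \<sigma> x $ i $ j) has_derivative
        (\<lambda>v. cinner (\<sigma> j (zpart x)) (Du x (cnj_vec (upart v))) + cinner (Dz x (zpart v)) (\<sigma> i (cnj_vec (upart x)))))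
        (at x)"
      unfolding polarized_gram_def by simp (rule bounded_bilinear.FDERIV[OF bounded_bilinear_cinner])
    show "cinner (\<sigma> j (zpart x)) (Du x (cnj_vec (upart (c *\<^sub>C v)))) + cinner (Dz x (zpart (c *\<^sub>C v))) (\<sigma> i (cnj_vec (upart x)))
      = c *\<^sub>C (cinner (\<sigma> j (zpart x)) (Du x (cnj_vec (upart v))) + cinner (Dz x (zpart v)) (\<sigma> i (cnj_vec (upart x))))"
      for c v
      using holo_onD(2)[OF \<sigma> x(1)] holo_onD(2)[OF \<sigma> x(2)]
      by (simp add: part_scaleC Dz_def Du_def algebra_simps)
  qed
qed

lemma gram_mult_coeffs: "(gram \<sigma> w *v c) $ i = cinner (\<Sum>j\<in>UNIV. (c $ j) *\<^sub>C \<sigma> j w) (\<sigma> i w)"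
  by (simp add: gram_def matrix_vector_mult_def cinner_sum_left mult.commute)

lemma coeffs_zero_of_gram:
  assumes inv: "invertible (gram \<sigma> w)" and c: "(\<Sum>j\<in>UNIV. (c $ j) *\<^sub>C \<sigma> j w) = 0"
  shows "c = 0"
proof -
  have "gram \<sigma> w *v c = 0"
    by (simp add: vec_eq_iff gram_mult_coeffs c)
  then have "matrix_inv (gram \<sigma> w) *v (gram \<sigma> w *v c) = 0"
    by simp
  then show ?thesis
    by (simp add: matrix_vector_mul_assoc matrix_inv_left[OF inv])
qed

lemma coeffs_unique_of_gram:
  assumes inv: "invertible (gram \<sigma> w)"
    and eq: "(\<Sum>j\<in>UNIV. (c $ j) *\<^sub>C \<sigma> j w) = (\<Sum>j\<in>UNIV. (d $ j) *\<^sub>C \<sigma> j w)"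
  shows "c = d"
proof -
  have "(\<Sum>j\<in>UNIV. ((c - d) $ j) *\<^sub>C \<sigma> j w) = 0"
    using eq by (simp add: scaleC_diff_left sum_subtractf)
  from coeffs_zero_of_gram[OF inv this] show ?thesis by simp
qed

text \<open>The quadratic form of the Gram matrix at \<open>c\<close> is the squared norm of the combination with coefficients \<open>c\<close>.\<close>

lemma invertible_gram:
  assumes \<sigma>: "inj (\<lambda>i. \<sigma> i w)" "cindependent (range (\<lambda>i. \<sigma> i w))"
  shows "invertible (gram \<sigma> w)"
proof -
  have "c = 0" if "gram \<sigma> w *v c = 0" for c
  proof -
    let ?s = "\<Sum>j\<in>UNIV. (c $ j) *\<^sub>C \<sigma> j w"
    have "cinner ?s ?s = (\<Sum>i\<in>UNIV. cnj (c $ i) * (gram \<sigma> w *v c) $ i)"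
      by (simp add: gram_mult_coeffs cinner_sum_right)
    then have s: "?s = 0"
      using that by simp
    define f where "f v = c $ (inv (\<lambda>i. \<sigma> i w) v)" for v
    have f: "f (\<sigma> j w) = c $ j" for j
      unfolding f_def using inv_f_f[OF \<sigma>(1), of j] by simp
    have "(\<Sum>v\<in>range (\<lambda>i. \<sigma> i w). f v *\<^sub>C v) = ?s"
      by (subst sum.reindex[OF \<sigma>(1)]) (simp add: f)
    then have "(\<Sum>v\<in>range (\<lambda>i. \<sigma> i w). f v *\<^sub>C v) = 0"
      using s by simp
    then have "f (\<sigma> j w) = 0" for j
      using \<sigma>(2) complex_vector.independentD[of "range (\<lambda>i. \<sigma> i w)" "range (\<lambda>i. \<sigma> i w)" f "\<sigma> j w"]
      by (auto simp: cindependent_def)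
    then show "c = 0"
      by (simp add: vec_eq_iff f)
  qed
  then have "\<exists>B. B ** gram \<sigma> w = mat 1"
    using matrix_left_invertible_ker[of "gram \<sigma> w"] by blast
  then show ?thesis
    using matrix_inv_eqI(2) by blast
qed

lemma polydisc_subset_open:
  fixes W :: "(complex^('m::finite + 'm)) set"
  assumes "open W" "0 \<in> W"
  obtains r where "r > 0" "polydisc r \<subseteq> W"
proof -
  obtain e where e: "e > 0" "ball 0 e \<subseteq> W"
    using assms open_contains_ball by blast
  define n where "n = real CARD('m + 'm)"
  have n: "n > 0" unfolding n_def by (simp only: of_nat_0_less_iff zero_less_card_finite)
  have "norm x < e" if x: "x \<in> polydisc (e / n)" for x :: "complex^('m + 'm)"
  proof -
    have "norm (x $ k) < e / n" for k
    proof (cases k)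
      case (Inl i)
      then show ?thesis
        using Finite_Cartesian_Product.norm_nth_le[of "zpart x" i] x by (simp add: polydisc_def zpart_def)
    next
      case (Inr i)
      then show ?thesis
        using Finite_Cartesian_Product.norm_nth_le[of "upart x" i] x by (simp add: polydisc_def upart_def)
    qed
    then have "(\<Sum>k\<in>UNIV. norm (x $ k)) < (\<Sum>k\<in>(UNIV :: ('m + 'm) set). e / n)"
      by (intro sum_strict_mono) auto
    moreover have "norm x \<le> (\<Sum>k\<in>UNIV. norm (x $ k))"
      unfolding norm_vec_def by (rule L2_set_le_sum) simp
    moreover have "(\<Sum>k\<in>(UNIV :: ('m + 'm) set). e / n) = e"
      using n by (simp add: n_def del: card_sum card_UNIV_sum)
    ultimately show ?thesis by linarith
  qed
  then have "polydisc (e / n) \<subseteq> W"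
    using e by auto
  then show ?thesis
    using that[of "e / n"] e n by simp
qed

lemma polydisc_mono: "s \<le> r \<Longrightarrow> polydisc s \<subseteq> polydisc r"
  by (auto simp: polydisc_def)

lemma holo_on_linear_compose:
  assumes f: "holo_on W f" and L: "bounded_linear L" "\<And>c v. L (c *\<^sub>C v) = c *\<^sub>C L v"
    and LW: "\<And>x. x \<in> W' \<Longrightarrow> L x \<in> W"
  shows "holo_on W' (\<lambda>x. f (L x))"
    and "x \<in> W' \<Longrightarrow> pd k (\<lambda>x. f (L x)) x = frechet_derivative f (at (L x)) (L (axis k 1))"
proof -
  have *: "((\<lambda>x. f (L x)) has_derivative (\<lambda>v. frechet_derivative f (at (L x)) (L v))) (at x)" if "x \<in> W'" for x
    using diff_chain_at[OF bounded_linear_imp_has_derivative[OF L(1)] holo_onD(1)[OF f LW[OF that]]]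
    by (simp add: o_def)
  show "holo_on W' (\<lambda>x. f (L x))"
    by (rule holo_onI[OF *]) (simp_all add: L(2) holo_onD(2)[OF f LW])
  show "x \<in> W' \<Longrightarrow> pd k (\<lambda>x. f (L x)) x = frechet_derivative f (at (L x)) (L (axis k 1))"
    by (rule pdI[OF *])
qed

text \<open>The normalising factor depends on \<open>u\<close> only, so it drops out of the connection, and the normalised
  matrix computes the curvature of the original metric.\<close>

lemma normalized_gram_curvature:
  fixes \<sigma> :: "'n::finite \<Rightarrow> complex^'m::finite \<Rightarrow> 'a::complex_inner"
  assumes r: "r > 0" and \<sigma>: "\<And>i. holo_on (ball 0 r) (\<sigma> i)"
    and inv: "\<And>x. x \<in> polydisc r \<Longrightarrow> invertible (polarized_gram \<sigma> x)"
  shows "normalized_metric r (normalized_gram \<sigma>)"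
    and "curvature_derivative_matrix (gram \<sigma>) I J i j 0
      = - pdl (map Inr J) (pdl (map Inl I) (pd (Inl i) (logder (normalized_gram \<sigma>) j))) 0"
proof -
  let ?W = "polydisc r :: (complex^('m + 'm)) set"
  let ?H = "polarized_gram \<sigma>" and ?B = "normalized_gram \<sigma>"
  let ?A = "\<lambda>x. ?H (join 0 (upart x))"
  note W = open_polydisc[of r, where ?'a = 'm]
  have H: "holo_on ?W ?H"
    by (rule holo_on_polarized_gram[OF \<sigma>])
  have slice_in: "join 0 (upart x) \<in> ?W" if "x \<in> ?W" for x
    using that r by (simp add: polydisc_def)
  have L: "bounded_linear (\<lambda>x. join 0 (upart x) :: complex^('m + 'm))"
    by (auto intro!: linear_conv_bounded_linear[THEN iffD1] linearI simp: vec_sum_eq_iff upart_def)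
  have L': "join 0 (upart (c *\<^sub>C v)) = c *\<^sub>C join 0 (upart v)" for c and v :: "complex^('m + 'm)"
    by (simp add: vec_sum_eq_iff upart_def)
  have A: "holo_on ?W ?A"
    by (rule holo_on_linear_compose(1)[OF H L L' slice_in])
  have pdA: "pd (Inl i) ?A x = 0" if "x \<in> ?W" for i x
  proof -
    have "join 0 (upart (axis (Inl i) 1)) = (0 :: complex^('m + 'm))"
      by (simp add: vec_sum_eq_iff upart_def axis_def)
    moreover have "linear (frechet_derivative ?H (at (join 0 (upart x))))"
      using holo_onD(1)[OF H slice_in[OF that]] has_derivative_bounded_linear bounded_linear.linear by blast
    ultimately show ?thesis
      using holo_on_linear_compose(2)[OF H L L' slice_in that, of "Inl i"] by (simp add: linear_0)
  qed
  have invA: "invertible (?A x)" if "x \<in> ?W" for x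
    by (rule inv[OF slice_in[OF that]])
  have Ai: "holo_on ?W (\<lambda>x. matrix_inv (?A x))"
    by (rule holo_on_matrix_inv[OF W A invA])
  have B: "holo_on ?W ?B"
    unfolding normalized_gram_def[abs_def] by (rule matmul.holo[OF Ai H])
  have left: "(matrix_inv (?H x) ** ?A x) ** ?B x = mat 1" if x: "x \<in> ?W" for x
  proof -
    have "(matrix_inv (?H x) ** ?A x) ** ?B x
        = matrix_inv (?H x) ** (?A x ** matrix_inv (?A x)) ** ?H x"
      by (simp add: normalized_gram_def matrix_mul_assoc)
    then show ?thesis
      by (simp add: matrix_inv_right[OF invA[OF x]] matrix_inv_left[OF inv[OF x]])
  qed
  note Binv = matrix_inv_eqI[OF left]
  show "normalized_metric r ?B"
  proof
    show "?B (join 0 u) = mat 1" if "norm u < r" for u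
    proof -
      have "join 0 u \<in> ?W" using that r by (simp add: join_in_polydisc)
      from matrix_inv_left[OF inv[OF this]] show ?thesis by (simp add: normalized_gram_def)
    qed
  qed (use r B Binv in auto)
  then interpret B: normalized_metric r ?B .
  interpret P: polarized_connection ?W "ball 0 r" ?B "gram \<sigma>"
  proof
    show "?B (join 0 u) = mat 1" if "join 0 u \<in> ?W" for u
      using that B.unit by (simp add: join_in_polydisc)
    fix w :: "complex^'m" and i assume w: "w \<in> ball 0 r"
    then have x: "diag w \<in> ?W" by (simp add: diag_in_polydisc)
    let ?x = "diag w"
    have "dz i (gram \<sigma>) w = dz i (\<lambda>w. ?H (diag w)) w"
      by (simp add: polarized_gram_diag)
    also have "\<dots> = pd (Inl i) ?H ?x"
      by (rule dz_diag[OF H x])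
    finally have 1: "connection (gram \<sigma>) i w = matrix_inv (?H ?x) ** pd (Inl i) ?H ?x"
      by (simp add: connection_def polarized_gram_diag)
    have "pd (Inl i) ?B ?x = matrix_inv (?A ?x) ** pd (Inl i) ?H ?x + pd (Inl i) (\<lambda>x. matrix_inv (?A x)) ?x ** ?H ?x"
      unfolding normalized_gram_def[abs_def] by (rule matmul.pd[OF Ai H x])
    also have "pd (Inl i) (\<lambda>x. matrix_inv (?A x)) ?x = 0"
      by (subst pd_matrix_inv[OF W A invA x]) (simp_all add: pdA[OF x] matrix_distribs)
    finally have "pd (Inl i) ?B ?x = matrix_inv (?A ?x) ** pd (Inl i) ?H ?x"
      by (simp add: matrix_distribs)
    then have "matrix_inv (?B ?x) ** pd (Inl i) ?B ?x
        = matrix_inv (?H ?x) ** (?A ?x ** matrix_inv (?A ?x)) ** pd (Inl i) ?H ?x"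
      by (simp add: Binv(1)[OF x] matrix_mul_assoc)
    then show "connection (gram \<sigma>) i w = matrix_inv (?B ?x) ** pd (Inl i) ?B ?x"
      by (simp add: matrix_inv_right[OF invA[OF x]] 1)
  qed (use r W B Binv in \<open>auto simp: diag_in_polydisc\<close>)
  have "P.\<Psi> j = logder ?B j"
    by (simp add: fun_eq_iff P.\<Psi>_def logder_def)
  then show "curvature_derivative_matrix (gram \<sigma>) I J i j 0
      = - pdl (map Inr J) (pdl (map Inl I) (pd (Inl i) (logder ?B j))) 0"
    using P.curvature_derivative_polarized by simp
qed

text \<open>The Gram matrix of a frame is invertible, and invertibility is an open condition.\<close>

lemma good_radius:
  fixes \<sigma> :: "'n::finite \<Rightarrow> complex^'m::finite \<Rightarrow> 'a::complex_inner"
  assumes \<sigma>: "holo_frame U E \<sigma>" and U: "0 \<in> U"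
  obtains r0 where "r0 > 0" "ball 0 r0 \<subseteq> U"
    "\<And>r x. r \<le> r0 \<Longrightarrow> x \<in> polydisc r \<Longrightarrow> invertible (polarized_gram \<sigma> x)"
    "\<And>i. holo_on (ball 0 r0) (\<sigma> i)"
proof -
  have "open U" using \<sigma> by (simp add: holo_frame_def)
  then obtain r1 where r1: "r1 > 0" "ball 0 r1 \<subseteq> U"
    using U open_contains_ball by blast
  have h: "holo_on (ball 0 r1) (\<sigma> i)" for i
    using \<sigma> r1 holo_on_subset unfolding holo_frame_def by blast
  have H: "holo_on (polydisc r1) (polarized_gram \<sigma>)"
    by (rule holo_on_polarized_gram[OF h])
  have "continuous_on (polydisc r1) (\<lambda>x. det (polarized_gram \<sigma> x))"
    by (intro holo_on_continuous holo_on_det) (use H in \<open>simp add: holo_on_matrix_iff\<close>)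
  then have "open ((\<lambda>x. det (polarized_gram \<sigma> x)) -` (- {0}) \<inter> polydisc r1)"
    by (simp add: continuous_on_open_vimage[OF open_polydisc] open_Compl)
  moreover have "invertible (gram \<sigma> 0)"
    using \<sigma> U by (intro invertible_gram) (auto simp: holo_frame_def)
  then have "0 \<in> (\<lambda>x. det (polarized_gram \<sigma> x)) -` (- {0}) \<inter> polydisc r1"
    using polarized_gram_diag[of \<sigma> 0] join_in_polydisc[of 0 0 r1] r1 by (simp add: invertible_det_nz)
  ultimately obtain r2 where r2: "r2 > 0"
    "polydisc r2 \<subseteq> (\<lambda>x. det (polarized_gram \<sigma> x)) -` (- {0}) \<inter> polydisc r1"
    using polydisc_subset_open by blast
  show ?thesis
  proof (rule that[of "min r1 r2"])
    show "invertible (polarized_gram \<sigma> x)" if "r \<le> min r1 r2" "x \<in> polydisc r" for r x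
      using polydisc_mono[of r r2] that r2 by (auto simp: invertible_det_nz)
    show "holo_on (ball 0 (min r1 r2)) (\<sigma> i)" for i
      by (rule holo_on_subset[OF h]) auto
  qed (use r1 r2 in auto)
qed

section \<open>Equal curvature at one point gives local equivalence\<close>

definition comb :: "('n::finite \<Rightarrow> 'p \<Rightarrow> 'a::complex_inner) \<Rightarrow> 'p \<Rightarrow> complex^'n \<Rightarrow> 'a" where
  "comb \<sigma> w c = (\<Sum>j\<in>UNIV. (c $ j) *\<^sub>C \<sigma> j w)"

definition adj :: "complex^'n^'n \<Rightarrow> complex^'n^'n" where
  "adj A = (\<chi> i j. cnj (A $ j $ i))"

lemma adj_mult: "adj (A ** B) = adj B ** adj A"
  by (simp add: adj_def matrix_matrix_mult_def vec_eq_iff mult.commute)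

lemma adj_adj [simp]: "adj (adj A) = A"
  by (simp add: adj_def vec_eq_iff)

lemma adj_mat_1 [simp]: "adj (mat 1) = mat 1"
  by (auto simp: adj_def vec_eq_iff mat_def)

lemma
  assumes "invertible A"
  shows adj_matrix_inv: "adj (matrix_inv A) = matrix_inv (adj A)" and invertible_adj: "invertible (adj A)"
proof -
  have "adj (matrix_inv A) ** adj A = mat 1"
    by (simp add: adj_mult[symmetric] matrix_inv_right[OF assms])
  from matrix_inv_eqI[OF this] show "adj (matrix_inv A) = matrix_inv (adj A)" "invertible (adj A)"
    by simp_all
qed

lemma mult_axis_nth: "((M :: complex^'n^'m) *v axis l 1) $ i = M $ i $ l"
  by (simp add: matrix_vector_mult_def axis_def if_distrib cong: if_cong)

lemma matrix_eq_axisI: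
  assumes "\<And>l. (M :: complex^'n^'m) *v axis l 1 = M' *v axis l 1" shows "M = M'"
  unfolding vec_eq_iff using assms by (metis mult_axis_nth)

lemma comb_axis [simp]: "comb \<sigma> w (axis j 1) = \<sigma> j w"
  by (simp add: comb_def axis_def if_distrib[of "\<lambda>c. c *\<^sub>C _"] cong: if_cong)

lemma comb_add: "comb \<sigma> w (c + d) = comb \<sigma> w c + comb \<sigma> w d"
  by (simp add: comb_def scaleC_add_left sum.distrib)

lemma comb_in_cspan: "comb \<sigma> w c \<in> cspan (range (\<lambda>i. \<sigma> i w))"
  unfolding comb_def
proof (rule complex_vector.subspace_sum[OF csubspace_cspan])
  show "(c $ j) *\<^sub>C \<sigma> j w \<in> cspan (range (\<lambda>i. \<sigma> i w))" for j
    by (rule csubspaceD(3)[OF csubspace_cspan subsetD[OF cspan_superset]]) simp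
qed

lemma cspan_range_eq_comb: "cspan (range (\<lambda>i. \<sigma> i w)) = range (comb \<sigma> w)"
proof
  show "cspan (range (\<lambda>i. \<sigma> i w)) \<subseteq> range (comb \<sigma> w)"
  proof (rule cspan_minimal)
    show "range (\<lambda>i. \<sigma> i w) \<subseteq> range (comb \<sigma> w)"
    proof
      fix x assume "x \<in> range (\<lambda>i. \<sigma> i w)"
      then obtain j where "x = comb \<sigma> w (axis j 1)" by auto
      then show "x \<in> range (comb \<sigma> w)" by blast
    qed
    show "csubspace (range (comb \<sigma> w))"
      unfolding complex_vector.subspace_def
    proof (intro conjI ballI allI)
      show "0 \<in> range (comb \<sigma> w)"
        by (rule range_eqI[of _ _ 0]) (simp add: comb_def)
    next
      fix x y assume "x \<in> range (comb \<sigma> w)" "y \<in> range (comb \<sigma> w)"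
      then obtain c d where "x = comb \<sigma> w c" "y = comb \<sigma> w d" by blast
      then show "x + y \<in> range (comb \<sigma> w)"
        by (intro range_eqI[of _ _ "c + d"]) (simp add: comb_add)
    next
      fix a x assume "x \<in> range (comb \<sigma> w)"
      then obtain c where "x = comb \<sigma> w c" by blast
      then show "a *\<^sub>C x \<in> range (comb \<sigma> w)"
        by (intro range_eqI[of _ _ "a *\<^sub>C c"]) (simp add: comb_def scaleC_sum_right scaleC_scaleC)
    qed
  qed
qed (use comb_in_cspan in auto)

lemma frame_endo_comb:
  assumes "invertible (gram \<sigma> w)"
  shows "frame_endo \<sigma> w M (comb \<sigma> w c) = comb \<sigma> w (M *v c)"
proof -
  have "(THE d :: complex^'a. comb \<sigma> w c = (\<Sum>j\<in>UNIV. (d $ j) *\<^sub>C \<sigma> j w)) = c"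
    by (rule the_equality) (auto simp: comb_def intro: coeffs_unique_of_gram[OF assms, symmetric])
  then show ?thesis
    by (simp add: frame_endo_def comb_def)
qed

lemma cinner_comb_comb:
  "cinner (comb \<tau> z (N *v axis j 1)) (comb \<tau> w (M *v axis i 1))
     = (adj M ** polarized_gram \<tau> (join z (cnj_vec w)) ** N) $ i $ j"
proof -
  have "cinner (comb \<tau> z (N *v axis j 1)) (comb \<tau> w (M *v axis i 1))
      = (\<Sum>l'\<in>UNIV. \<Sum>l\<in>UNIV. cnj (M $ l' $ i) * (N $ l $ j * cinner (\<tau> l z) (\<tau> l' w)))"
    by (simp add: comb_def mult_axis_nth cinner_sum_left cinner_sum_right sum_distrib_left)
  also have "\<dots> = (\<Sum>l\<in>UNIV. \<Sum>l'\<in>UNIV. cnj (M $ l' $ i) * (N $ l $ j * cinner (\<tau> l z) (\<tau> l' w)))"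
    by (rule sum.swap)
  also have "\<dots> = (adj M ** polarized_gram \<tau> (join z (cnj_vec w)) ** N) $ i $ j"
    by (simp add: matrix_matrix_mult_def adj_def polarized_gram_def sum_distrib_left mult_ac)
  finally show ?thesis .
qed

lemma polarized_gram_nth:
  "polarized_gram \<sigma> (join z (cnj_vec w)) $ i $ j = cinner (\<sigma> j z) (\<sigma> i w)"
  by (simp add: polarized_gram_def)

lemma adj_polarized_gram: "adj (polarized_gram \<sigma> (join w 0)) = polarized_gram \<sigma> (join 0 (cnj_vec w))"
  by (simp add: adj_def polarized_gram_def vec_eq_iff cinner_commute[symmetric])

lemma isometric_cinner:
  assumes V: "bounded_op_on S S' V" and S: "csubspace S" and iso: "\<And>x. x \<in> S \<Longrightarrow> norm (V x) = norm x"
    and x: "x \<in> S" and y: "y \<in> S"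
  shows "cinner (V x) (V y) = cinner x y"
proof -
  have re: "inner (V x) (V y) = inner x y" if "x \<in> S" "y \<in> S" for x y
  proof -
    have n: "(norm (u + v))\<^sup>2 = (norm u)\<^sup>2 + (norm v)\<^sup>2 + 2 * inner u v" for u v :: "'z::real_inner"
      by (simp add: power2_norm_eq_inner inner_add inner_commute)
    have "(norm (V (x + y)))\<^sup>2 = (norm (x + y))\<^sup>2"
      using iso[OF csubspaceD(2)[OF S that]] by simp
    then show ?thesis
      unfolding bounded_opD(2)[OF V that] n by (simp add: iso that)
  qed
  have "Re (cinner (V x) (V y)) = Re (cinner x y)"
    using re[OF x y] by (simp add: inner_Re_cinner)
  moreover have "Im (cinner (V x) (V y)) = Im (cinner x y)"
    using re[OF x csubspaceD(3)[OF S y, of \<i>]] bounded_opD(3)[OF V y, of \<i>]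
    by (simp add: inner_Re_cinner)
  ultimately show ?thesis by (simp add: complex_eq_iff)
qed

lemma bounded_op_comb:
  assumes V: "bounded_op_on S S' V" and S: "csubspace S" and \<sigma>: "\<And>j. \<sigma> j w \<in> S"
    and V\<sigma>: "\<And>j. V (\<sigma> j w) = comb \<tau> v (A *v axis j 1)"
  shows "V (comb \<sigma> w c) = comb \<tau> v (A *v c)"
proof -
  have "V (comb \<sigma> w c) = (\<Sum>j\<in>UNIV. (c $ j) *\<^sub>C V (\<sigma> j w))"
    unfolding comb_def by (rule bounded_op_sum[OF V S \<sigma>])
  also have "\<dots> = (\<Sum>j\<in>UNIV. \<Sum>l\<in>UNIV. (c $ j * A $ l $ j) *\<^sub>C \<tau> l v)"
    by (simp add: V\<sigma> comb_def mult_axis_nth scaleC_sum_right scaleC_scaleC)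
  also have "\<dots> = (\<Sum>l\<in>UNIV. \<Sum>j\<in>UNIV. (c $ j * A $ l $ j) *\<^sub>C \<tau> l v)"
    by (rule sum.swap)
  also have "\<dots> = comb \<tau> v (A *v c)"
    by (simp add: comb_def matrix_vector_mult_def scaleC_sum_left mult.commute)
  finally show ?thesis .
qed

text \<open>Indexing through \<open>\<beta>\<close> gives the frame of the tensor product the index type of the other frame.\<close>

definition tensor_frame ::
    "('n \<Rightarrow> 'a \<times> 'b) \<Rightarrow> ('k \<Rightarrow> 'e \<Rightarrow> 't) \<Rightarrow> ('a \<Rightarrow> 'p \<Rightarrow> 'k) \<Rightarrow> ('b \<Rightarrow> 'p \<Rightarrow> 'e) \<Rightarrow> 'n \<Rightarrow> 'p \<Rightarrow> 't" where
  "tensor_frame \<beta> tens \<kappa> \<epsilon> l w = tens (\<kappa> (fst (\<beta> l)) w) (\<epsilon> (snd (\<beta> l)) w)"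

lemma polarized_gram_tensor_frame:
  assumes "hilbert_tensor tens"
  shows "polarized_gram (tensor_frame \<beta> tens \<kappa> \<epsilon>) x = kron \<beta> (polarized_gram \<kappa> x) (polarized_gram \<epsilon> x)"
  by (simp add: vec_eq_iff polarized_gram_def tensor_frame_def kron_def hilbert_tensorD(5)[OF assms])

lemma tensor_sum_sum:
  assumes t: "hilbert_tensor tens"
  shows "tens (\<Sum>a\<in>P. c a *\<^sub>C f a) (\<Sum>b\<in>Q. d b *\<^sub>C g b)
    = (\<Sum>a\<in>P. \<Sum>b\<in>Q. (c a * d b) *\<^sub>C tens (f a) (g b))"
proof -
  have 1: "tens (\<Sum>a\<in>P. c a *\<^sub>C f a) y = (\<Sum>a\<in>P. c a *\<^sub>C tens (f a) y)" for y
    by (rule bounded_op_sum[OF bounded_op_tensor(1)[OF t] csubspace_UNIV UNIV_I])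
  have 2: "tens x (\<Sum>b\<in>Q. d b *\<^sub>C g b) = (\<Sum>b\<in>Q. d b *\<^sub>C tens x (g b))" for x
    by (rule bounded_op_sum[OF bounded_op_tensor(2)[OF t] csubspace_UNIV UNIV_I])
  show ?thesis
    by (simp only: 1) (simp add: 2 scaleC_sum_right scaleC_scaleC)
qed

lemma comb_tensor_frame:
  fixes \<beta> :: "'n::finite \<Rightarrow> 'a::finite \<times> 'b::finite"
  assumes t: "hilbert_tensor tens" and \<beta>: "bij \<beta>"
  shows "comb (tensor_frame \<beta> tens \<kappa> \<epsilon>) w (kron \<beta> X Y *v axis l 1)
    = tens (comb \<kappa> w (X *v axis (fst (\<beta> l)) 1)) (comb \<epsilon> w (Y *v axis (snd (\<beta> l)) 1))"
proof -
  have "comb (tensor_frame \<beta> tens \<kappa> \<epsilon>) w (kron \<beta> X Y *v axis l 1)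
      = (\<Sum>l'\<in>UNIV. (X $ fst (\<beta> l') $ fst (\<beta> l) * Y $ snd (\<beta> l') $ snd (\<beta> l)) *\<^sub>C
          tens (\<kappa> (fst (\<beta> l')) w) (\<epsilon> (snd (\<beta> l')) w))"
    by (simp add: comb_def mult_axis_nth kron_def tensor_frame_def)
  also have "\<dots> = (\<Sum>a\<in>UNIV. \<Sum>b\<in>UNIV. (X $ a $ fst (\<beta> l) * Y $ b $ snd (\<beta> l)) *\<^sub>C tens (\<kappa> a w) (\<epsilon> b w))"
    by (rule sum_bij_pairs[OF \<beta>, of "\<lambda>a b. (X $ a $ fst (\<beta> l) * Y $ b $ snd (\<beta> l)) *\<^sub>C tens (\<kappa> a w) (\<epsilon> b w)"])
  also have "\<dots> = tens (comb \<kappa> w (X *v axis (fst (\<beta> l)) 1)) (comb \<epsilon> w (Y *v axis (snd (\<beta> l)) 1))"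
    by (simp add: comb_def mult_axis_nth tensor_sum_sum[OF t])
  finally show ?thesis .
qed

lemma comb_tensor_in_cspan:
  fixes \<beta> :: "'n::finite \<Rightarrow> 'a::finite \<times> 'b::finite"
  assumes t: "hilbert_tensor tens" and \<beta>: "bij \<beta>"
  shows "tens (comb \<kappa> w c) (comb \<epsilon> w d) \<in> range (comb (tensor_frame \<beta> tens \<kappa> \<epsilon>) w)"
proof -
  have "tens (comb \<kappa> w c) (comb \<epsilon> w d)
      = (\<Sum>a\<in>UNIV. \<Sum>b\<in>UNIV. (c $ a * d $ b) *\<^sub>C tens (\<kappa> a w) (\<epsilon> b w))"
    by (simp add: comb_def tensor_sum_sum[OF t])
  also have "\<dots> = (\<Sum>l\<in>UNIV. (c $ fst (\<beta> l) * d $ snd (\<beta> l)) *\<^sub>C tens (\<kappa> (fst (\<beta> l)) w) (\<epsilon> (snd (\<beta> l)) w))"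
    by (rule sum_bij_pairs[OF \<beta>, of "\<lambda>a b. (c $ a * d $ b) *\<^sub>C tens (\<kappa> a w) (\<epsilon> b w)", symmetric])
  also have "\<dots> = comb (tensor_frame \<beta> tens \<kappa> \<epsilon>) w (\<chi> l. c $ fst (\<beta> l) * d $ snd (\<beta> l))"
    by (simp add: comb_def tensor_frame_def)
  finally show ?thesis by simp
qed

text \<open>The matrix \<open>A\<close> of the isometry at \<open>0\<close> conjugates the curvature data of one frame into those of
  the tensor frame. Rigidity of the normalised metrics then yields a change of frame \<open>N\<close>
  that matches the two polarized metrics; that \<open>A\<close> is isometric makes the factors depending on \<open>z\<close>
  and on \<open>u\<close> adjoint to each other.\<close>

lemma local_equivalence:
  fixes \<sigma> :: "'n::finite \<Rightarrow> complex^'m::finite \<Rightarrow> 'h::complex_inner"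
    and \<kappa> :: "'a::finite \<Rightarrow> complex^'m \<Rightarrow> 'k::complex_hilbert"
    and \<epsilon> :: "'b::finite \<Rightarrow> complex^'m \<Rightarrow> 'e::complex_hilbert"
    and tens :: "'k \<Rightarrow> 'e \<Rightarrow> 't::complex_hilbert"
    and \<beta> :: "'n \<Rightarrow> 'a \<times> 'b"
  assumes t: "hilbert_tensor tens" and \<beta>: "bij \<beta>"
    and \<sigma>: "holo_frame U1 E1 \<sigma>" "0 \<in> U1" and \<kappa>: "holo_frame U2 E2 \<kappa>" "0 \<in> U2"
    and \<epsilon>: "holo_frame U3 E3 \<epsilon>" "0 \<in> U3"
    and V: "bounded_op_on (E1 0) (tensor_bundle tens E2 E3 0) V"
    and iso: "\<And>x. x \<in> E1 0 \<Longrightarrow> norm (V x) = norm x"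
    and curv: "\<And>I J i j k e. k \<in> E2 0 \<Longrightarrow> e \<in> E3 0 \<Longrightarrow>
      V (frame_endo \<sigma> 0 (curvature_derivative_matrix (gram \<sigma>) I J i j 0) (adjoint_on (E1 0) V (tens k e)))
        - tens (frame_endo \<kappa> 0 (curvature_derivative_matrix (gram \<kappa>) I J i j 0) k) e
      = tens k (frame_endo \<epsilon> 0 (curvature_derivative_matrix (gram \<epsilon>) I J i j 0) e)"
  defines "\<tau> \<equiv> tensor_frame \<beta> tens \<kappa> \<epsilon>"
  shows "\<exists>r>0. \<exists>N. ball 0 r \<subseteq> U1 \<inter> U2 \<inter> U3 \<and> (\<forall>z\<in>ball 0 r. invertible (N z) \<and>
     (\<forall>w\<in>ball 0 r. \<forall>i j. cinner (\<sigma> j z) (\<sigma> i w)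
        = cinner (comb \<tau> z (N z *v axis j 1)) (comb \<tau> w (N w *v axis i 1))))"
proof -
  obtain r1 where r1: "r1 > 0" "ball 0 r1 \<subseteq> U1"
    "\<And>r x. r \<le> r1 \<Longrightarrow> x \<in> polydisc r \<Longrightarrow> invertible (polarized_gram \<sigma> x)"
    "\<And>i. holo_on (ball 0 r1) (\<sigma> i)"
    using good_radius[OF \<sigma>] by blast
  obtain r2 where r2: "r2 > 0" "ball 0 r2 \<subseteq> U2"
    "\<And>r x. r \<le> r2 \<Longrightarrow> x \<in> polydisc r \<Longrightarrow> invertible (polarized_gram \<kappa> x)"
    "\<And>i. holo_on (ball 0 r2) (\<kappa> i)"
    using good_radius[OF \<kappa>] by blast
  obtain r3 where r3: "r3 > 0" "ball 0 r3 \<subseteq> U3"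
    "\<And>r x. r \<le> r3 \<Longrightarrow> x \<in> polydisc r \<Longrightarrow> invertible (polarized_gram \<epsilon> x)"
    "\<And>i. holo_on (ball 0 r3) (\<epsilon> i)"
    using good_radius[OF \<epsilon>] by blast
  define r where "r = min r1 (min r2 r3)"
  have r: "r > 0" "r \<le> r1" "r \<le> r2" "r \<le> r3"
    using r1(1) r2(1) r3(1) by (auto simp: r_def)
  have inv1: "invertible (polarized_gram \<sigma> x)" if "x \<in> polydisc r" for x
    by (rule r1(3)[OF r(2) that])
  have inv2: "invertible (polarized_gram \<kappa> x)" if "x \<in> polydisc r" for x
    by (rule r2(3)[OF r(3) that])
  have inv3: "invertible (polarized_gram \<epsilon> x)" if "x \<in> polydisc r" for x
    by (rule r3(3)[OF r(4) that])
  have hol: "holo_on (ball 0 r) (\<sigma> i)" "holo_on (ball 0 r) (\<kappa> a)" "holo_on (ball 0 r) (\<epsilon> b)" for i a b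
    using holo_on_subset[OF r1(4)] holo_on_subset[OF r2(4)] holo_on_subset[OF r3(4)] r
    by (metis subset_ball)+
  note N1 = normalized_gram_curvature[OF r(1) hol(1) inv1]
  note N2 = normalized_gram_curvature[OF r(1) hol(2) inv2]
  note N3 = normalized_gram_curvature[OF r(1) hol(3) inv3]
  have zero_in: "(0 :: complex^('m + 'm)) \<in> polydisc r"
    using join_in_polydisc[of 0 0 r] r(1) by simp
  define H1 H2 where "H1 = polarized_gram \<sigma>" and "H2 = polarized_gram \<tau>"
  have H2: "H2 x = kron \<beta> (polarized_gram \<kappa> x) (polarized_gram \<epsilon> x)" for x
    by (simp add: H2_def \<tau>_def polarized_gram_tensor_frame[OF t])
  have invH1: "invertible (H1 x)" if "x \<in> polydisc r" for x
    using inv1[OF that] by (simp add: H1_def)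
  have invH2: "invertible (H2 x)" if "x \<in> polydisc r" for x
    unfolding H2 by (rule invertible_kron[OF \<beta> inv2[OF that] inv3[OF that]])
  have gram0: "gram \<sigma> 0 = H1 0" "gram \<tau> 0 = H2 0"
    using polarized_gram_diag[of \<sigma> 0] polarized_gram_diag[of \<tau> 0] by (simp_all add: H1_def H2_def)
  have inv0: "invertible (gram \<sigma> 0)" "invertible (gram \<tau> 0)"
      "invertible (gram \<kappa> 0)" "invertible (gram \<epsilon> 0)"
    using invH1[OF zero_in] invH2[OF zero_in] inv2[OF zero_in] inv3[OF zero_in]
      polarized_gram_diag[of \<kappa> 0] polarized_gram_diag[of \<epsilon> 0]
    by (simp_all add: gram0)
  have E1: "E1 0 = range (comb \<sigma> 0)" and E2: "E2 0 = range (comb \<kappa> 0)" and E3: "E3 0 = range (comb \<epsilon> 0)"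
    using \<sigma> \<kappa> \<epsilon> by (auto simp: holo_frame_def cspan_range_eq_comb[symmetric])
  have subE1: "csubspace (E1 0)"
    unfolding E1 cspan_range_eq_comb[symmetric] by simp
  have \<sigma>E1: "\<sigma> j 0 \<in> E1 0" for j
    unfolding E1 by (rule range_eqI[of _ _ "axis j 1"]) simp
  \<comment> \<open>the matrix of the isometry at \<open>0\<close>\<close>
  have "V (\<sigma> j 0) \<in> range (comb \<tau> 0)" for j
  proof -
    have "{tens k e |k e. k \<in> E2 0 \<and> e \<in> E3 0} \<subseteq> range (comb \<tau> 0)"
    proof
      fix x assume "x \<in> {tens k e |k e. k \<in> E2 0 \<and> e \<in> E3 0}"
      then obtain c d where "x = tens (comb \<kappa> 0 c) (comb \<epsilon> 0 d)"
        unfolding E2 E3 by blast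
      then show "x \<in> range (comb \<tau> 0)"
        unfolding \<tau>_def by (simp only: comb_tensor_in_cspan[OF t \<beta>])
    qed
    then have "tensor_bundle tens E2 E3 0 \<subseteq> range (comb \<tau> 0)"
      unfolding tensor_bundle_def cspan_range_eq_comb[symmetric]
      by (rule cspan_minimal) simp
    then show ?thesis
      using bounded_opD(1)[OF V \<sigma>E1] by blast
  qed
  then have "\<forall>j. \<exists>c. V (\<sigma> j 0) = comb \<tau> 0 c" by blast
  then obtain c where c: "\<And>j. V (\<sigma> j 0) = comb \<tau> 0 (c j)" by metis
  define A :: "complex^'n^'n" where "A = (\<chi> l j. c j $ l)"
  have "A *v axis j 1 = c j" for j
    by (simp add: vec_eq_iff mult_axis_nth A_def)
  then have VA: "V (\<sigma> j 0) = comb \<tau> 0 (A *v axis j 1)" for j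
    using c by simp
  have Vcomb: "V (comb \<sigma> 0 c) = comb \<tau> 0 (A *v c)" for c
    by (rule bounded_op_comb[where \<sigma> = \<sigma> and w = 0 and \<tau> = \<tau> and v = 0, OF V subE1 \<sigma>E1 VA])
  have gramA: "H1 0 = adj A ** H2 0 ** A"
  proof -
    have "H1 0 $ i $ j = (adj A ** H2 0 ** A) $ i $ j" for i j
    proof -
      have "H1 0 $ i $ j = cinner (\<sigma> j 0) (\<sigma> i 0)"
        using polarized_gram_nth[of \<sigma> 0 0 i j] by (simp add: H1_def)
      also have "\<dots> = cinner (V (\<sigma> j 0)) (V (\<sigma> i 0))"
        by (rule isometric_cinner[OF V subE1 iso \<sigma>E1 \<sigma>E1, symmetric])
      also have "\<dots> = (adj A ** H2 0 ** A) $ i $ j"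
        using cinner_comb_comb[of \<tau> 0 A j 0 A i] by (simp add: VA H2_def)
      finally show ?thesis .
    qed
    then show ?thesis by (simp add: vec_eq_iff)
  qed
  have A: "invertible A"
  proof (rule matrix_inv_eqI(2))
    show "(matrix_inv (H1 0) ** adj A ** H2 0) ** A = mat 1"
      using matrix_inv_left[OF invH1[OF zero_in]] gramA by (simp add: matrix_mul_assoc)
  qed
  define Ai where "Ai = matrix_inv A"
  have AAi: "A ** Ai = mat 1" "Ai ** A = mat 1"
    unfolding Ai_def by (rule matrix_inv_right[OF A], rule matrix_inv_left[OF A])
  \<comment> \<open>the curvature data are conjugate by \<open>A\<close>\<close>
  have cdata: "A ** curvature_derivative_matrix (gram \<sigma>) I J i j 0
      = (kron \<beta> (curvature_derivative_matrix (gram \<kappa>) I J i j 0) (mat 1)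
         + kron \<beta> (mat 1) (curvature_derivative_matrix (gram \<epsilon>) I J i j 0)) ** A"
    (is "A ** ?C1 = (kron \<beta> ?C2 _ + kron \<beta> _ ?C3) ** A") for I J i j
  proof -
    have "A ** ?C1 ** Ai = kron \<beta> ?C2 (mat 1) + kron \<beta> (mat 1) ?C3"
    proof (rule matrix_eq_axisI)
      fix l
      let ?k = "\<kappa> (fst (\<beta> l)) 0" and ?e = "\<epsilon> (snd (\<beta> l)) 0"
      have k: "?k \<in> E2 0" and e: "?e \<in> E3 0"
        unfolding E2 E3 using comb_axis by (metis rangeI)+
      have te: "tens ?k ?e = comb \<tau> 0 (axis l 1)"
        by (simp add: \<tau>_def tensor_frame_def)
      have adjoint: "adjoint_on (E1 0) V (tens ?k ?e) = comb \<sigma> 0 (Ai *v axis l 1)"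
      proof (rule adjoint_on_eqI[OF subE1])
        show u: "comb \<sigma> 0 (Ai *v axis l 1) \<in> E1 0" unfolding E1 by simp
        fix x assume x: "x \<in> E1 0"
        have "V (comb \<sigma> 0 (Ai *v axis l 1)) = tens ?k ?e"
          by (simp add: Vcomb te matrix_vector_mul_assoc AAi)
        then show "cinner (V x) (tens ?k ?e) = cinner x (comb \<sigma> 0 (Ai *v axis l 1))"
          using isometric_cinner[OF V subE1 iso x u] by simp
      qed
      have 1: "V (frame_endo \<sigma> 0 ?C1 (adjoint_on (E1 0) V (tens ?k ?e)))
          = comb \<tau> 0 ((A ** ?C1 ** Ai) *v axis l 1)"
        unfolding adjoint frame_endo_comb[OF inv0(1)] Vcomb
        by (simp add: matrix_vector_mul_assoc matrix_mul_assoc)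
      have 2: "tens (frame_endo \<kappa> 0 ?C2 ?k) ?e = comb \<tau> 0 (kron \<beta> ?C2 (mat 1) *v axis l 1)"
        using frame_endo_comb[OF inv0(3), of ?C2 "axis (fst (\<beta> l)) 1"]
        by (simp add: \<tau>_def comb_tensor_frame[OF t \<beta>])
      have 3: "tens ?k (frame_endo \<epsilon> 0 ?C3 ?e) = comb \<tau> 0 (kron \<beta> (mat 1) ?C3 *v axis l 1)"
        using frame_endo_comb[OF inv0(4), of ?C3 "axis (snd (\<beta> l)) 1"]
        by (simp add: \<tau>_def comb_tensor_frame[OF t \<beta>])
      have "comb \<tau> 0 ((A ** ?C1 ** Ai) *v axis l 1)
          = comb \<tau> 0 ((kron \<beta> ?C2 (mat 1) + kron \<beta> (mat 1) ?C3) *v axis l 1)"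
        using curv[OF k e, of I J i j] unfolding 1 2 3
        by (simp add: matrix_vector_mult_add_rdistrib comb_add algebra_simps)
      then show "(A ** ?C1 ** Ai) *v axis l 1 = (kron \<beta> ?C2 (mat 1) + kron \<beta> (mat 1) ?C3) *v axis l 1"
        unfolding comb_def by (rule coeffs_unique_of_gram[OF inv0(2)])
    qed
    then have "A ** ?C1 ** Ai ** A = (kron \<beta> ?C2 (mat 1) + kron \<beta> (mat 1) ?C3) ** A" by simp
    then show ?thesis
      by (simp add: matrix_mul_assoc[symmetric] AAi)
  qed
  define B1 B2 where "B1 = normalized_gram \<sigma>"
    and "B2 x = kron \<beta> (normalized_gram \<kappa> x) (normalized_gram \<epsilon> x)" for x
  have metric2: "normalized_metric r B2"
    unfolding B2_def by (rule normalized_metric_kron(1)[OF \<beta> N2(1) N3(1)])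
  have data: "A ** pdl (map Inr J) (pdl (map Inl I) (pd (Inl i) (logder B1 j))) 0
       = pdl (map Inr J) (pdl (map Inl I) (pd (Inl i) (logder B2 j))) 0 ** A" for I J i j
  proof -
    let ?L = "map Inr J @ map Inl I @ [Inl i]"
    have C: "curvature_derivative_matrix (gram \<sigma>) I J i j 0 = - pdl ?L (logder B1 j) 0"
      "curvature_derivative_matrix (gram \<kappa>) I J i j 0 = - pdl ?L (logder (normalized_gram \<kappa>) j) 0"
      "curvature_derivative_matrix (gram \<epsilon>) I J i j 0 = - pdl ?L (logder (normalized_gram \<epsilon>) j) 0"
      by (simp_all add: N1(2) N2(2) N3(2) pdl_append B1_def)
    have L2: "pdl ?L (logder B2 j) 0 = kron \<beta> (pdl ?L (logder (normalized_gram \<kappa>) j) 0) (mat 1)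
         + kron \<beta> (mat 1) (pdl ?L (logder (normalized_gram \<epsilon>) j) 0)"
      unfolding B2_def by (rule curvature_data_kron[OF \<beta> N2(1) N3(1) zero_in])
    have "- (A ** pdl ?L (logder B1 j) 0) = - (pdl ?L (logder B2 j) 0 ** A)"
      using cdata[of I J i j] unfolding C L2
      by (simp add: matrix_distribs bounded_bilinear.minus_left[OF kron.bb]
          bounded_bilinear.minus_right[OF kron.bb])
    then have "A ** pdl ?L (logder B1 j) 0 = pdl ?L (logder B2 j) 0 ** A"
      by (simp only: neg_equal_iff_equal)
    then show ?thesis by (simp add: pdl_append)
  qed
  define Nn where "Nn z = matrix_inv (B2 (join z 0)) ** A ** B1 (join z 0)" for z
  have rigid: "A ** B1 (join z u) = B2 (join z u) ** Nn z" if "norm z < r" "norm u < r" for z u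
    unfolding Nn_def by (rule normalized_metrics_rigid[OF N1(1)[folded B1_def] metric2 data that])
  have B1: "B1 (join z u) = matrix_inv (H1 (join 0 u)) ** H1 (join z u)" for z u
    by (simp add: B1_def H1_def normalized_gram_def)
  have B2: "B2 (join z u) = matrix_inv (H2 (join 0 u)) ** H2 (join z u)" if "norm u < r" for z u
  proof -
    have "join 0 u \<in> polydisc r" using that r by (simp add: join_in_polydisc)
    then show ?thesis
      by (simp add: B2_def H2 normalized_gram_def matrix_inv_kron[OF \<beta> inv2 inv3] kron_mult[OF \<beta>])
  qed
  have Nn: "Nn z = matrix_inv (H2 (join z 0)) ** matrix_inv (adj A) ** H1 (join z 0)"
    if z: "norm z < r" for z
  proof -
    have z_in: "join z 0 \<in> polydisc r" using z r by (simp add: join_in_polydisc)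
    have "adj A ** (H2 0 ** A ** matrix_inv (H1 0)) = mat 1"
      using matrix_inv_right[OF invH1[OF zero_in]] gramA by (simp add: matrix_mul_assoc)
    then have "(H2 0 ** A ** matrix_inv (H1 0)) ** adj A = mat 1"
      using matrix_left_right_inverse by blast
    then have adjA: "matrix_inv (adj A) = H2 0 ** A ** matrix_inv (H1 0)"
      by (rule matrix_inv_eqI(1))
    have "(matrix_inv (H2 (join z 0)) ** H2 0) ** B2 (join z 0)
        = matrix_inv (H2 (join z 0)) ** (H2 0 ** matrix_inv (H2 0)) ** H2 (join z 0)"
      using r by (simp add: B2 matrix_mul_assoc)
    also have "\<dots> = mat 1"
      by (simp add: matrix_inv_right[OF invH2[OF zero_in]] matrix_inv_left[OF invH2[OF z_in]])
    finally have "matrix_inv (B2 (join z 0)) = matrix_inv (H2 (join z 0)) ** H2 0"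
      by (rule matrix_inv_eqI(1))
    then show ?thesis
      by (simp add: Nn_def B1 adjA matrix_mul_assoc)
  qed
  have adjNn: "adj (Nn w) = H1 (join 0 (cnj_vec w)) ** Ai ** matrix_inv (H2 (join 0 (cnj_vec w)))"
    if w: "norm w < r" for w
  proof -
    have w_in: "join w 0 \<in> polydisc r" using w r by (simp add: join_in_polydisc)
    have "adj (matrix_inv (adj A)) = Ai"
      using adj_matrix_inv[OF invertible_adj[OF A]] by (simp add: Ai_def)
    then show ?thesis
      by (simp add: Nn[OF w] adj_mult adj_matrix_inv[OF invH2[OF w_in]] matrix_mul_assoc)
         (simp add: H1_def H2_def adj_polarized_gram)
  qed
  have final: "H1 (join z (cnj_vec w)) = adj (Nn w) ** H2 (join z (cnj_vec w)) ** Nn z"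
    if z: "norm z < r" and w: "norm w < r" for z w
  proof -
    let ?u = "cnj_vec w"
    have u: "norm ?u < r" using w by simp
    have u_in: "join 0 ?u \<in> polydisc r" using u r by (simp add: join_in_polydisc)
    have "H1 (join z ?u) = H1 (join 0 ?u) ** ((Ai ** A) ** B1 (join z ?u))"
      by (simp add: AAi B1 matrix_mul_assoc matrix_inv_right[OF invH1[OF u_in]])
    also have "\<dots> = H1 (join 0 ?u) ** (Ai ** (A ** B1 (join z ?u)))"
      by (simp add: matrix_mul_assoc)
    also have "\<dots> = adj (Nn w) ** H2 (join z ?u) ** Nn z"
      by (simp add: rigid[OF z u] B2[OF u] adjNn[OF w] matrix_mul_assoc)
    finally show ?thesis .
  qed
  have invNn: "invertible (Nn z)" if z: "norm z < r" for z
  proof (rule matrix_inv_eqI(2))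
    have d: "join z (cnj_vec z) \<in> polydisc r" using z by (simp add: join_in_polydisc)
    show "(matrix_inv (H1 (join z (cnj_vec z))) ** adj (Nn z) ** H2 (join z (cnj_vec z))) ** Nn z = mat 1"
      using matrix_inv_left[OF invH1[OF d]] final[OF z z] by (simp add: matrix_mul_assoc)
  qed
  show ?thesis
  proof (rule exI[of _ r], rule conjI[OF r(1)], rule exI[of _ Nn], intro conjI ballI allI)
    have "ball 0 r \<subseteq> ball 0 r1" "ball 0 r \<subseteq> ball 0 r2" "ball 0 r \<subseteq> ball 0 r3"
      using r by (auto intro: subset_ball)
    then show "ball 0 r \<subseteq> U1 \<inter> U2 \<inter> U3"
      using r1(2) r2(2) r3(2) by blast
  next
    show "invertible (Nn z)" if "z \<in> ball 0 r" for z
      using invNn that by simp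
  next
    fix z w :: "complex^'m" and i j assume "z \<in> ball 0 r" "w \<in> ball 0 r"
    then have "norm z < r" "norm w < r" by simp_all
    then show "cinner (\<sigma> j z) (\<sigma> i w)
        = cinner (comb \<tau> z (Nn z *v axis j 1)) (comb \<tau> w (Nn w *v axis i 1))"
      unfolding cinner_comb_comb polarized_gram_nth[symmetric] using final by (simp add: H1_def H2_def)
  qed
qed

section \<open>Holomorphic frames of eigenspaces\<close>

lemma comb_scaleC: "comb \<sigma> w (a *\<^sub>C c) = a *\<^sub>C comb \<sigma> w c"
  by (simp add: comb_def scaleC_sum_right scaleC_scaleC)

lemma independent_of_comb:
  assumes "\<And>c. comb \<sigma> w c = 0 \<Longrightarrow> c = 0"
  shows "inj (\<lambda>i. \<sigma> i w)" "cindependent (range (\<lambda>i. \<sigma> i w))"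
proof -
  show inj: "inj (\<lambda>i. \<sigma> i w)"
  proof (rule injI)
    fix i j assume "\<sigma> i w = \<sigma> j w"
    then have "comb \<sigma> w (axis i 1 + (- 1) *\<^sub>C axis j 1) = 0"
      unfolding comb_add comb_scaleC by simp
    then have "axis i 1 + (- 1) *\<^sub>C axis j 1 = (0 :: complex^'a)"
      by (rule assms)
    then have "(axis i 1 :: complex^'a) = axis j 1" by simp
    then show "i = j" by (simp add: axis_eq_axis)
  qed
  show "cindependent (range (\<lambda>i. \<sigma> i w))"
    unfolding cindependent_def complex_vector.dependent_finite[OF finite_imageI[OF finite]]
  proof clarify
    fix u j assume s: "(\<Sum>v\<in>range (\<lambda>i. \<sigma> i w). u v *\<^sub>C v) = 0" and u: "u (\<sigma> j w) \<noteq> 0"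
    have "comb \<sigma> w (\<chi> i. u (\<sigma> i w)) = (\<Sum>v\<in>range (\<lambda>i. \<sigma> i w). u v *\<^sub>C v)"
      by (subst sum.reindex[OF inj]) (simp add: comb_def)
    then have "(\<chi> i. u (\<sigma> i w)) = (0 :: complex^'a)"
      using s assms by simp
    then show False using u by (auto simp: vec_eq_iff)
  qed
qed

lemma comb_zero_of_independent:
  assumes \<sigma>: "inj (\<lambda>i. \<sigma> i w)" "cindependent (range (\<lambda>i. \<sigma> i w))" and "comb \<sigma> w c = 0"
  shows "c = 0"
  using coeffs_zero_of_gram[OF invertible_gram[OF \<sigma>]] assms(3) unfolding comb_def .

lemma finite_basis:
  fixes N :: "'a::complex_inner set"
  assumes N: "csubspace N" and dim: "cdim N = CARD('n::finite)"
  obtains b :: "'n::finite \<Rightarrow> 'p \<Rightarrow> 'a"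
  where "\<And>w. range (comb b w) = N" "\<And>w c. comb b w c = 0 \<Longrightarrow> c = 0"
proof -
  obtain B where B: "B \<subseteq> N" "\<not> complex_vector.dependent B" "N \<subseteq> cspan B" "card B = cdim N"
    using complex_vector.basis_exists[of N] by blast
  have "card B > 0" using B(4) dim by simp
  then have fin: "finite B" by (simp add: card_gt_0_iff)
  have "card (UNIV :: 'n set) = card B" using B(4) dim by simp
  then obtain g where g: "bij_betw g (UNIV :: 'n set) B"
    using finite_same_card_bij[OF finite fin] by blast
  define b :: "'n \<Rightarrow> 'p \<Rightarrow> 'a" where "b j w = g j" for j w
  have rg: "range (\<lambda>j. b j w) = B" for w
    using g by (simp add: b_def bij_betw_def)
  show ?thesis
  proof (rule that[of b])
    show "range (comb b w) = N" for w
      unfolding cspan_range_eq_comb[symmetric] rg using B(1,3) cspan_minimal[OF B(1) N] by blast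
    show "c = 0" if "comb b w c = 0" for w c
    proof (rule comb_zero_of_independent[OF _ _ that])
      show "inj (\<lambda>i. b i w)" using g by (simp add: b_def bij_betw_def)
      show "cindependent (range (\<lambda>i. b i w))"
        unfolding rg using B(2) by (simp add: cindependent_def)
    qed
  qed
qed

lemma holo_on_quadratic_remainder:
  fixes f :: "complex^'m \<Rightarrow> 'a::complex_inner"
  assumes U: "open U" and lin: "\<And>w. w \<in> U \<Longrightarrow> bounded_op (D w)"
    and rem: "\<And>w w'. w \<in> U \<Longrightarrow> w' \<in> U \<Longrightarrow> norm (f w' - f w - D w (w' - w)) \<le> C * (norm (w' - w))\<^sup>2"
  shows "holo_on U f"
proof (rule holo_onI)
  fix w assume w: "w \<in> U"
  obtain e where e: "e > 0" "ball w e \<subseteq> U" using U w open_contains_ball by blast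
  show "(f has_derivative D w) (at w)"
  proof (rule has_derivativeI_sandwich[OF e(1) bounded_op_imp_bounded_linear[OF lin[OF w]]])
    fix y assume y: "y \<noteq> w" "dist y w < e"
    then have "y \<in> U" using e(2) by (auto simp: dist_commute subset_iff)
    from rem[OF w this] show "norm (f y - f w - D w (y - w)) / norm (y - w) \<le> C * norm (y - w)"
      using y(1) by (simp add: field_simps power2_eq_square)
  next
    have "((\<lambda>y. C * norm (y - w)) \<longlongrightarrow> C * norm (w - w)) (at w)"
      by (intro tendsto_intros)
    then show "((\<lambda>y. C * norm (y - w)) \<longlongrightarrow> 0) (at w)" by simp
  qed
  show "D w (c *\<^sub>C v) = c *\<^sub>C D w v" for c v
    by (rule bounded_opD(3)[OF lin[OF w] UNIV_I])
qed

text \<open>The equation \<open>f = y + Q v f\<close> with a small bilinear \<open>Q\<close>: its solution operator is bounded by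
  \<open>2\<close>, linear in \<open>y\<close>, and depends holomorphically on \<open>v\<close>.\<close>

locale small_bilinear =
  fixes Q :: "complex^'m \<Rightarrow> 'h::complex_hilbert \<Rightarrow> 'h" and C \<delta> :: real
  assumes Q_add_left: "Q (v + v') x = Q v x + Q v' x" and Q_scale_left: "Q (c *\<^sub>C v) x = c *\<^sub>C Q v x"
    and Q_add_right: "Q v (x + x') = Q v x + Q v x'" and Q_scale_right: "Q v (c *\<^sub>C x) = c *\<^sub>C Q v x"
    and Q_bound: "norm (Q v x) \<le> C * norm v * norm x" and C: "C \<ge> 0" and \<delta>: "\<delta> > 0" "C * \<delta> \<le> 1/2"
begin

lemma Q_diff_left: "Q (v - v') x = Q v x - Q v' x"
  using Q_add_left[of v "(-1) *\<^sub>C v'" x] Q_scale_left[of "-1" v' x] by simp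

lemma Q_diff_right: "Q v (x - x') = Q v x - Q v x'"
  using Q_add_right[of v x "(-1) *\<^sub>C x'"] Q_scale_right[of v "-1" x'] by simp

lemma Q_half: "norm v < \<delta> \<Longrightarrow> norm (Q v x) \<le> (1/2) * norm x"
proof -
  assume v: "norm v < \<delta>"
  have "C * norm v \<le> C * \<delta>" using v C by (intro mult_left_mono) auto
  then have "C * norm v \<le> 1/2" using \<delta> by simp
  then have "C * norm v * norm x \<le> (1/2) * norm x" by (rule mult_right_mono) simp
  then show ?thesis using Q_bound[of v x] by simp
qed

lemma solution_unique:
  assumes v: "norm v < \<delta>" and f: "f = y + Q v f" and g: "g = y + Q v g"
  shows "f = g"
proof -
  have "f - g = Q v (f - g)" using f g by (metis Q_diff_right add_diff_cancel_left)
  then have "norm (f - g) \<le> (1/2) * norm (f - g)" using Q_half[OF v, of "f - g"] by simp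
  then show ?thesis by simp
qed

definition R :: "complex^'m \<Rightarrow> 'h \<Rightarrow> 'h" where
  "R v y = (THE f. f = y + Q v f)"

lemma R:
  assumes v: "norm v < \<delta>" shows "R v y = y + Q v (R v y)"
proof -
  have "\<exists>!f. y + Q v f = f"
  proof (rule banach_fix_type[of "1/2"])
    show "\<forall>x x'. dist (y + Q v x) (y + Q v x') \<le> 1 / 2 * dist x x'"
      using Q_half[OF v] by (simp add: dist_norm flip: Q_diff_right)
  qed auto
  then obtain f where f: "f = y + Q v f" by metis
  show ?thesis
    unfolding R_def by (rule theI[of _ f]) (use f solution_unique[OF v] in auto)
qed

lemma R_eqI: "norm v < \<delta> \<Longrightarrow> f = y + Q v f \<Longrightarrow> R v y = f"
  using solution_unique[OF _ R] by metis

lemma R_add: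
  assumes v: "norm v < \<delta>" shows "R v (x + y) = R v x + R v y"
proof (rule R_eqI[OF v])
  have "R v x + R v y = (x + Q v (R v x)) + (y + Q v (R v y))"
    by (rule arg_cong2[where f = "(+)", OF R[OF v] R[OF v]])
  also have "\<dots> = x + y + Q v (R v x + R v y)"
    by (simp add: Q_add_right)
  finally show "R v x + R v y = x + y + Q v (R v x + R v y)" .
qed

lemma R_scale:
  assumes v: "norm v < \<delta>" shows "R v (c *\<^sub>C x) = c *\<^sub>C R v x"
proof (rule R_eqI[OF v])
  have "c *\<^sub>C R v x = c *\<^sub>C (x + Q v (R v x))"
    by (rule arg_cong[OF R[OF v]])
  also have "\<dots> = c *\<^sub>C x + Q v (c *\<^sub>C R v x)"
    by (simp add: Q_scale_right scaleC_add_right)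
  finally show "c *\<^sub>C R v x = c *\<^sub>C x + Q v (c *\<^sub>C R v x)" .
qed

lemma R_bound: "norm v < \<delta> \<Longrightarrow> norm (R v y) \<le> 2 * norm y"
proof -
  assume v: "norm v < \<delta>"
  have "norm (R v y) \<le> norm y + norm (Q v (R v y))"
    by (subst R[OF v]) (rule norm_triangle_ineq)
  then show ?thesis using Q_half[OF v, of "R v y"] by simp
qed

lemma R_increment:
  assumes v: "norm v < \<delta>" and v': "norm v' < \<delta>"
  shows "R v' y - R v y = R v (Q (v' - v) (R v' y))"
proof (rule R_eqI[OF v, symmetric])
  have "R v' y - R v y = Q v' (R v' y) - Q v (R v y)"
    using R[OF v, of y] R[OF v', of y] by (metis add_diff_cancel_left)
  also have "\<dots> = Q (v' - v) (R v' y) + Q v (R v' y - R v y)"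
    by (simp add: Q_diff_left Q_diff_right)
  finally show "R v' y - R v y = Q (v' - v) (R v' y) + Q v (R v' y - R v y)" .
qed

lemma holo_on_solution: "holo_on (ball w0 \<delta>) (\<lambda>w. R (w - w0) y)"
proof (rule holo_on_quadratic_remainder[where D = "\<lambda>w u. R (w - w0) (Q u (R (w - w0) y))"
      and C = "8 * C * C * norm y"])
  fix w assume "w \<in> ball w0 \<delta>"
  then have v: "norm (w - w0) < \<delta>" by (simp add: dist_norm norm_minus_commute)
  have "norm (R (w - w0) (Q u (R (w - w0) y))) \<le> (4 * C * norm y) * norm u" for u
  proof -
    have "norm (R (w - w0) (Q u (R (w - w0) y))) \<le> 2 * (C * norm u * norm (R (w - w0) y))"
      using R_bound[OF v, of "Q u (R (w - w0) y)"] Q_bound[of u "R (w - w0) y"] by simp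
    also have "\<dots> \<le> 2 * (C * norm u * (2 * norm y))"
      using C by (intro mult_left_mono R_bound[OF v]) auto
    finally show ?thesis by (simp add: mult_ac)
  qed
  then show "bounded_op (\<lambda>u. R (w - w0) (Q u (R (w - w0) y)))"
    by (auto simp: bounded_op_on_def Q_add_left Q_scale_left R_add[OF v] R_scale[OF v])
  fix w' assume "w' \<in> ball w0 \<delta>"
  then have v': "norm (w' - w0) < \<delta>" by (simp add: dist_norm norm_minus_commute)
  let ?v = "w - w0" and ?v' = "w' - w0" and ?u = "w' - w"
  have u: "?v' - ?v = ?u" by simp
  have inc: "R ?v' y - R ?v y = R ?v (Q ?u (R ?v' y))"
    using R_increment[OF v v', of y] unfolding u .
  have "norm (R ?v' y - R ?v y) \<le> 2 * (C * norm ?u * norm (R ?v' y))"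
    unfolding inc using R_bound[OF v, of "Q ?u (R ?v' y)"] Q_bound[of ?u "R ?v' y"] by simp
  also have "\<dots> \<le> 2 * (C * norm ?u * (2 * norm y))"
    using C by (intro mult_left_mono R_bound[OF v']) auto
  finally have d: "norm (R ?v' y - R ?v y) \<le> 4 * C * norm ?u * norm y" by simp
  have "R ?v' y - R ?v y - R ?v (Q ?u (R ?v y)) = R ?v (Q ?u (R ?v' y - R ?v y))"
  proof -
    have "R ?v (Q ?u (R ?v' y)) = R ?v (Q ?u (R ?v' y - R ?v y)) + R ?v (Q ?u (R ?v y))"
      by (simp add: Q_diff_right flip: R_add[OF v])
    moreover have "R ?v' y - R ?v y - R ?v (Q ?u (R ?v y)) = R ?v (Q ?u (R ?v' y)) - R ?v (Q ?u (R ?v y))"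
      by (rule arg_cong[OF inc, of "\<lambda>t. t - R ?v (Q ?u (R ?v y))"])
    ultimately show ?thesis by simp
  qed
  also have "norm \<dots> \<le> 2 * (C * norm ?u * norm (R ?v' y - R ?v y))"
    using R_bound[OF v, of "Q ?u (R ?v' y - R ?v y)"] Q_bound[of ?u "R ?v' y - R ?v y"] by simp
  also have "\<dots> \<le> 2 * (C * norm ?u * (4 * C * norm ?u * norm y))"
    using C by (intro mult_left_mono d) auto
  finally show "norm (R ?v' y - R ?v y - R ?v (Q ?u (R ?v y))) \<le> 8 * C * C * norm y * (norm ?u)\<^sup>2"
    by (simp add: power2_eq_square mult_ac)
qed simp

end

lemma csubspace_joint_ker:
  assumes T: "\<And>i. bounded_op (T i)" shows "csubspace (joint_ker T w)"
  using bounded_opD(2,3)[OF T] bounded_opD(5)[OF T csubspace_UNIV]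
  by (auto simp: complex_vector.subspace_def joint_ker_def scaleC_add_right scaleC_scaleC mult.commute)

lemma bounded_op_vec:
  fixes A :: "'m::finite \<Rightarrow> 'a::complex_inner \<Rightarrow> 'b::complex_inner"
  assumes A: "\<And>i. bounded_op (A i)" shows "bounded_op (\<lambda>x. \<chi> i. A i x)"
proof -
  have "\<exists>B. \<forall>x. norm (A i x) \<le> B * norm x" for i
    using bounded_op_bound[OF A] by (metis UNIV_I)
  then obtain B where B: "\<And>i x. norm (A i x) \<le> B i * norm x" by metis
  have "norm (\<chi> i. A i x) \<le> (\<Sum>i\<in>UNIV. B i) * norm x" for x
  proof -
    have "norm (\<chi> i. A i x) \<le> (\<Sum>i\<in>UNIV. norm (A i x))"
      unfolding norm_vec_def by (rule order_trans[OF L2_set_le_sum]) auto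
    also have "\<dots> \<le> (\<Sum>i\<in>UNIV. B i * norm x)" by (intro sum_mono B)
    finally show ?thesis by (simp add: sum_distrib_right)
  qed
  then show ?thesis
    using bounded_opD(2,3)[OF A] by (auto simp: bounded_op_on_def vec_eq_iff)
qed

text \<open>Let \<open>L\<close> be a left inverse of \<open>x \<mapsto> (T i x - w0 i x)\<close> on the orthogonal complement of its kernel.
  A joint eigenvector \<open>x\<close> at \<open>w\<close> satisfies \<open>x = e + L ((w - w0) x)\<close> with \<open>e\<close> its projection to the kernel
  at \<open>w0\<close>. The equality of dimensions makes all \<open>e\<close> occur, so that solving this equation for a basis
  of the kernel at \<open>w0\<close> gives a frame.\<close>

lemma joint_ker_frame:
  fixes T :: "'m::finite \<Rightarrow> 'h::complex_hilbert \<Rightarrow> 'h"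
  assumes T: "cowen_douglas \<Omega> CARD('n::finite) T" and \<Omega>: "open \<Omega>" and w0: "w0 \<in> \<Omega>"
  shows "\<exists>U (\<sigma> :: 'n \<Rightarrow> complex^'m \<Rightarrow> 'h). w0 \<in> U \<and> U \<subseteq> \<Omega> \<and> holo_frame U (joint_ker T) \<sigma>"
proof -
  have bT: "\<And>i. bounded_op (T i)" and clos: "closed (range (\<lambda>x. \<chi> i. T i x - (w0 $ i) *\<^sub>C x))"
    and dim: "\<And>w. w \<in> \<Omega> \<Longrightarrow> cdim (joint_ker T w) = CARD('n)"
    using T w0 by (auto simp: cowen_douglas_def)
  define A where "A x = (\<chi> i. T i x - (w0 $ i) *\<^sub>C x)" for x
  define N where "N = joint_ker T w0"
  have NA: "{x. A x = 0} = N"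
    by (auto simp: N_def A_def joint_ker_def vec_eq_iff)
  have sub: "csubspace (joint_ker T w)" for w
    by (rule csubspace_joint_ker[OF bT])
  have "bounded_op (\<lambda>x. T i x - (w0 $ i) *\<^sub>C x)" for i
  proof -
    obtain B where B: "\<And>x. norm (T i x) \<le> B * norm x"
      using bounded_op_bound[OF bT] by (metis UNIV_I)
    have "norm (T i x - (w0 $ i) *\<^sub>C x) \<le> (B + norm (w0 $ i)) * norm x" for x
      using norm_triangle_ineq4[of "T i x" "(w0 $ i) *\<^sub>C x"] B[of x] by (simp add: algebra_simps)
    moreover have "T i (c *\<^sub>C x) - (w0 $ i) *\<^sub>C c *\<^sub>C x = c *\<^sub>C (T i x - (w0 $ i) *\<^sub>C x)" for c x
      using bounded_opD(3)[OF bT[of i] UNIV_I] by (simp add: scaleC_diff_right scaleC_scaleC mult.commute)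
    moreover have "T i (x + y) - (w0 $ i) *\<^sub>C (x + y) = (T i x - (w0 $ i) *\<^sub>C x) + (T i y - (w0 $ i) *\<^sub>C y)" for x y
      using bounded_opD(2)[OF bT[of i] UNIV_I UNIV_I] by (simp add: scaleC_add_right)
    ultimately show ?thesis
      unfolding bounded_op_on_def by blast
  qed
  then have A: "bounded_op A"
    unfolding A_def[abs_def] by (rule bounded_op_vec)
  have "closed (range A)" using clos by (simp add: A_def[abs_def])
  from closed_range_left_inverse[OF A this]
  obtain L where L: "bounded_op L" "\<And>x. L (A x) = x - proj N x"
    unfolding NA by blast
  have "closed {x. A x = 0}"
    by (intro closed_Collect_eq linear_continuous_on bounded_op_imp_bounded_linear[OF A] continuous_on_const)
  then have N: "csubspace N" "closed N"
    using sub unfolding NA by (simp_all add: N_def)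
  obtain C where C: "C > 0" "\<And>x. norm (L x) \<le> C * norm x"
    using bounded_op_bound[OF L(1)] by (metis UNIV_I)
  obtain e where e: "e > 0" "ball w0 e \<subseteq> \<Omega>" using \<Omega> w0 open_contains_ball by blast
  define \<delta> where "\<delta> = min e (1 / (2 * C))"
  have \<delta>_pos: "\<delta> > 0" "C * \<delta> \<le> 1/2" "\<delta> \<le> e"
    using e(1) C(1) mult_left_mono[of \<delta> "1 / (2 * C)" C] by (auto simp: \<delta>_def)
  define Q where "Q v x = L (outer v x)" for v :: "complex^'m" and x
  have outer: "outer (v + v') x = outer v x + outer v' x" "outer (c *\<^sub>C v) x = c *\<^sub>C outer v x"
    "outer v (x + x') = outer v x + outer v x'" "outer v (c *\<^sub>C x) = c *\<^sub>C outer v x"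
    for c and v v' :: "complex^'m" and x x' :: 'h
    by (simp_all add: outer_def vec_eq_iff scaleC_add_left scaleC_add_right scaleC_scaleC mult.commute)
  interpret small_bilinear Q C \<delta>
  proof
    show "norm (Q v x) \<le> C * norm v * norm x" for v x
      using C(2)[of "outer v x"] by (simp add: Q_def norm_outer mult.assoc)
  qed (use C(1) \<delta>_pos bounded_opD(2,3)[OF L(1)] in \<open>auto simp: Q_def outer\<close>)
  obtain b :: "'n \<Rightarrow> complex^'m \<Rightarrow> 'h" where b: "\<And>w. range (comb b w) = N" "\<And>w c. comb b w c = 0 \<Longrightarrow> c = 0"
    using finite_basis[OF N(1)] dim[OF w0] unfolding N_def by metis
  have eig: "x = R (w - w0) (proj N x)" if x: "x \<in> joint_ker T w" and w: "norm (w - w0) < \<delta>" for x w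
  proof (rule R_eqI[OF w, symmetric])
    have "A x = outer (w - w0) x"
      using x by (simp add: A_def outer_def joint_ker_def vec_eq_iff scaleC_diff_left)
    then show "x = proj N x + Q (w - w0) x"
      using L(2)[of x] by (simp add: Q_def)
  qed
  have surj: "\<exists>x\<in>joint_ker T w. proj N x = y" if y: "y \<in> N" and w: "norm (w - w0) < \<delta>" for y w
  proof -
    have w\<Omega>: "w \<in> \<Omega>" using w \<delta>_pos(3) e(2) by (auto simp: dist_norm norm_minus_commute subset_iff)
    obtain b' :: "'n \<Rightarrow> complex^'m \<Rightarrow> 'h"
      where b': "\<And>v. range (comb b' v) = joint_ker T w" "\<And>v c. comb b' v c = 0 \<Longrightarrow> c = 0"
      using finite_basis[OF sub dim[OF w\<Omega>]] by metis
    have "\<exists>c. proj N (b' j w0) = comb b w0 c" for j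
      using proj_in[OF N] b(1) by (metis imageE)
    then obtain c where c: "\<And>j. proj N (b' j w0) = comb b w0 (c j)" by metis
    define M :: "complex^'n^'n" where "M = (\<chi> l j. c j $ l)"
    have "M *v axis j 1 = c j" for j
      by (simp add: vec_eq_iff mult_axis_nth M_def)
    then have M: "proj N (b' j w0) = comb b w0 (M *v axis j 1)" for j using c by simp
    have "bounded_op (proj N)"
      using norm_proj_le[OF N]
      by (auto simp: bounded_op_on_def proj_add[OF N] proj_scaleC[OF N] intro: exI[of _ 1])
    then have PM: "proj N (comb b' w0 d) = comb b w0 (M *v d)" for d
      by (rule bounded_op_comb[where \<sigma> = b' and w = w0 and \<tau> = b and v = w0,
            OF _ csubspace_UNIV UNIV_I M])
    have "d = 0" if "M *v d = 0" for d
    proof -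
      have "comb b' w0 d = R (w - w0) (proj N (comb b' w0 d))"
        by (rule eig[OF _ w]) (use b'(1) in blast)
      also have "\<dots> = 0"
        using R_bound[OF w, of 0] unfolding PM that by (simp add: comb_def)
      finally show "d = 0" by (rule b'(2))
    qed
    then obtain M' where "M' ** M = mat 1"
      using matrix_left_invertible_ker[of M] by blast
    then have MM': "M ** M' = mat 1" using matrix_left_right_inverse by blast
    obtain d where d: "y = comb b w0 d" using y b(1) by (metis imageE)
    have "proj N (comb b' w0 (M' *v d)) = y"
      by (simp add: PM d matrix_vector_mul_assoc MM')
    then show ?thesis using b'(1) by blast
  qed
  have RN: "R (w - w0) y \<in> joint_ker T w" if "y \<in> N" "norm (w - w0) < \<delta>" for y w
    using surj[OF that] eig[OF _ that(2)] by metis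
  define \<sigma> where "\<sigma> j w = R (w - w0) (b j w0)" for j w
  have bN: "b j w0 \<in> N" for j
    using b(1)[of w0] comb_axis[of b w0 j] by (metis rangeI)
  have comb\<sigma>: "comb \<sigma> w c = R (w - w0) (comb b w0 c)" if w: "norm (w - w0) < \<delta>" for w c
  proof -
    have "bounded_op (R (w - w0))"
      using R_bound[OF w] by (auto simp: bounded_op_on_def R_add[OF w] R_scale[OF w])
    then show ?thesis
      unfolding comb_def \<sigma>_def
      by (rule bounded_op_sum[OF _ csubspace_UNIV UNIV_I, symmetric])
  qed
  have "holo_frame (ball w0 \<delta>) (joint_ker T) \<sigma>"
    unfolding holo_frame_def
  proof (intro conjI allI ballI)
    show "holo_on (ball w0 \<delta>) (\<sigma> i)" for i
      unfolding \<sigma>_def by (rule holo_on_solution)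
    fix w assume "w \<in> ball w0 \<delta>"
    then have w: "norm (w - w0) < \<delta>" by (simp add: dist_norm norm_minus_commute)
    have ind: "c = 0" if c: "comb \<sigma> w c = 0" for c
    proof (rule b(2)[of w0])
      have "R (w - w0) (comb b w0 c) = 0" using c comb\<sigma>[OF w] by simp
      then show "comb b w0 c = 0"
        using R[OF w, of "comb b w0 c"] Q_scale_right[of "w - w0" 0 0] by simp
    qed
    show "inj (\<lambda>i. \<sigma> i w)" "cindependent (range (\<lambda>i. \<sigma> i w))"
      by (rule independent_of_comb[of \<sigma> w], erule ind)+
    show "cspan (range (\<lambda>i. \<sigma> i w)) = joint_ker T w"
    proof
      show "cspan (range (\<lambda>i. \<sigma> i w)) \<subseteq> joint_ker T w"
        by (rule cspan_minimal[OF _ sub]) (auto simp: \<sigma>_def intro: RN bN w)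
      show "joint_ker T w \<subseteq> cspan (range (\<lambda>i. \<sigma> i w))"
      proof
        fix x assume x: "x \<in> joint_ker T w"
        obtain c where "proj N x = comb b w0 c" using proj_in[OF N] b(1) by (metis imageE)
        then have "x = comb \<sigma> w c" using eig[OF x w] comb\<sigma>[OF w] by simp
        then show "x \<in> cspan (range (\<lambda>i. \<sigma> i w))" by (simp only: comb_in_cspan)
      qed
    qed
  qed simp
  moreover have "w0 \<in> ball w0 \<delta>" "ball w0 \<delta> \<subseteq> \<Omega>" using \<delta>_pos e(2) by auto
  ultimately show ?thesis by blast
qed

lemma holo_on_cinner_const: "holo_on U f \<Longrightarrow> holo_on U (\<lambda>w. cinner (f w) y)"
proof (rule holo_onI)
  fix w assume f: "holo_on U f" and w: "w \<in> U"
  show "((\<lambda>w. cinner (f w) y) has_derivative (\<lambda>v. cinner (frechet_derivative f (at w) v) y)) (at w)"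
    by (rule bounded_linear.has_derivative[OF
          bounded_bilinear.bounded_linear_left[OF bounded_bilinear_cinner] holo_onD(1)[OF f w]])
  show "cinner (frechet_derivative f (at w) (c *\<^sub>C v)) y = c *\<^sub>C cinner (frechet_derivative f (at w) v) y" for c v
    by (simp add: holo_onD(2)[OF f w])
qed

text \<open>Restriction to the complex line through \<open>x\<close> and \<open>w\<close> meets the ball in a convex set.\<close>

lemma holo_on_identity:
  fixes g :: "complex^'m \<Rightarrow> complex"
  assumes g: "holo_on (ball a \<rho>) g" and x: "x \<in> ball a \<rho>" and w: "w \<in> ball a \<rho>" and e: "e > 0"
    and zero: "\<And>w. w \<in> ball x e \<Longrightarrow> w \<in> ball a \<rho> \<Longrightarrow> g w = 0"
  shows "g w = 0"
proof -
  define l where "l \<zeta> = x + \<zeta> *\<^sub>C (w - x)" for \<zeta> :: complex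
  have cont: "continuous_on UNIV l"
    unfolding l_def by (intro continuous_intros)
  define S where "S = l -` ball a \<rho>"
  have S: "open S"
    unfolding S_def by (intro open_vimage open_ball cont)
  have "convex S"
  proof (rule convexI)
    fix s t and u v :: real assume st: "s \<in> S" "t \<in> S" and uv: "0 \<le> u" "0 \<le> v" "u + v = 1"
    have "l (u *\<^sub>R s + v *\<^sub>R t) = (u + v) *\<^sub>R x + (u *\<^sub>R (s *\<^sub>C (w - x)) + v *\<^sub>R (t *\<^sub>C (w - x)))"
      by (simp add: l_def uv scaleC_add_left scaleR_scaleC scaleC_scaleC scaleC_complex_def)
    also have "\<dots> = u *\<^sub>R l s + v *\<^sub>R l t"
      by (simp add: l_def scaleR_add_left scaleR_add_right)
    finally show "u *\<^sub>R s + v *\<^sub>R t \<in> S"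
      using convexD[OF convex_ball, of "l s" a \<rho> "l t" u v] st uv by (simp add: S_def)
  qed
  then have conn: "connected S" by (rule convex_connected)
  define S0 where "S0 = S \<inter> l -` ball x e"
  have S0: "open S0" "S0 \<noteq> {}" "S0 \<subseteq> S"
  proof -
    show "open S0" unfolding S0_def by (intro open_Int S open_vimage open_ball cont)
    have "0 \<in> S0" using x e by (simp add: S0_def S_def l_def)
    then show "S0 \<noteq> {}" by blast
  qed (auto simp: S0_def)
  have "(\<lambda>\<zeta>. g (l \<zeta>)) holomorphic_on S"
    unfolding holomorphic_on_open[OF S]
  proof (intro ballI exI)
    fix \<zeta> assume "\<zeta> \<in> S"
    then have in_ball: "x + \<zeta> *\<^sub>C (w - x) \<in> ball a \<rho>" by (simp add: S_def l_def)
    show "((\<lambda>\<zeta>. g (l \<zeta>)) has_field_derivative frechet_derivative g (at (l \<zeta>)) (w - x)) (at \<zeta>)"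
      unfolding l_def by (rule holo_on_line_derivative[OF g in_ball])
  qed
  then have "g (l 1) = 0"
    by (rule analytic_continuation_open[OF S0(1) S S0(2) conn S0(3), where g = "\<lambda>_. 0"])
       (use zero w in \<open>auto simp: S0_def S_def l_def\<close>)
  then show ?thesis by (simp add: l_def)
qed

text \<open>A vector orthogonal to the eigenspaces near \<open>0\<close> is orthogonal to holomorphic frames on open sets,
  hence, by the identity theorem and connectedness, to all eigenspaces.\<close>

lemma dense_eigenspaces_small_ball:
  fixes T :: "'m::finite \<Rightarrow> 'h::complex_hilbert \<Rightarrow> 'h"
  assumes T: "cowen_douglas unit_ball CARD('n::finite) T" and r: "r > 0"
  shows "closure (cspan (\<Union>w\<in>ball 0 r \<inter> unit_ball. joint_ker T w)) = UNIV"
proof -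
  define M where "M = closure (cspan (\<Union>w\<in>ball 0 r \<inter> unit_ball. joint_ker T w))"
  have M: "csubspace M" "closed M" by (simp_all add: M_def csubspace_closure)
  have "x \<in> M" for x
  proof -
    define y where "y = x - proj M x"
    have yM: "cinner y s = 0" if "s \<in> M" for s
      unfolding y_def by (rule proj_orthogonal[OF M that])
    define P where "P w \<longleftrightarrow> (\<exists>e>0. \<forall>w'\<in>ball w e. w' \<in> unit_ball \<longrightarrow> (\<forall>s\<in>joint_ker T w'. cinner s y = 0))" for w
    have P0: "P 0"
      unfolding P_def
    proof (intro exI conjI ballI impI)
      fix w' s assume "w' \<in> ball 0 r" "w' \<in> unit_ball" "s \<in> joint_ker T w'"
      then have "s \<in> (\<Union>w\<in>ball 0 r \<inter> unit_ball. joint_ker T w)" by blast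
      then have "s \<in> M"
        unfolding M_def by (intro subsetD[OF closure_subset] subsetD[OF cspan_superset])
      then show "cinner s y = 0" using yM cinner_eq_0_commute by blast
    qed (rule r)
    have P: "P w" if w: "w \<in> unit_ball" for w
    proof (rule connected_induction_simple[where S = unit_ball and a = 0 and b = w and P = P])
      fix a :: "complex^'m" assume a: "a \<in> unit_ball"
      obtain U and \<sigma> :: "'n \<Rightarrow> complex^'m \<Rightarrow> 'h"
        where U: "a \<in> U" "U \<subseteq> unit_ball" "holo_frame U (joint_ker T) \<sigma>"
        using joint_ker_frame[OF T open_ball a] by blast
      have "open U" using U(3) by (simp add: holo_frame_def)
      then obtain \<rho> where \<rho>: "\<rho> > 0" "ball a \<rho> \<subseteq> U" using U(1) open_contains_ball by blast
      have step: "P z" if x: "x \<in> ball a \<rho>" and z: "z \<in> ball a \<rho>" and Px: "P x" for x z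
      proof -
        obtain e where e: "e > 0"
          "\<And>w s. w \<in> ball x e \<Longrightarrow> w \<in> unit_ball \<Longrightarrow> s \<in> joint_ker T w \<Longrightarrow> cinner s y = 0"
          using Px unfolding P_def by blast
        have vanish: "cinner s y = 0" if w: "w \<in> ball a \<rho>" and s: "s \<in> joint_ker T w" for w s
        proof -
          have span: "joint_ker T w = cspan (range (\<lambda>i. \<sigma> i w))" if "w \<in> ball a \<rho>" for w
            using U(3) \<rho>(2) that by (auto simp: holo_frame_def)
          have "cinner (\<sigma> j w) y = 0" for j
          proof (rule holo_on_identity[OF holo_on_cinner_const x w e(1)])
            show "holo_on (ball a \<rho>) (\<sigma> j)"
              using U(3) \<rho>(2) holo_on_subset unfolding holo_frame_def by blast
            fix w assume w: "w \<in> ball x e" "w \<in> ball a \<rho>"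
            have "\<sigma> j w \<in> joint_ker T w"
              unfolding span[OF w(2)] by (rule subsetD[OF cspan_superset]) simp
            then show "cinner (\<sigma> j w) y = 0"
              using e(2) w \<rho>(2) U(2) by blast
          qed
          then have "\<And>v. v \<in> range (\<lambda>i. \<sigma> i w) \<Longrightarrow> cinner v y = 0" by auto
          moreover have "s \<in> closure (cspan (range (\<lambda>i. \<sigma> i w)))"
            using s span[OF w] closure_subset by blast
          ultimately show ?thesis by (rule cinner_closure_cspan_eq_0)
        qed
        obtain e' where "e' > 0" "ball z e' \<subseteq> ball a \<rho>"
          using z open_ball[of a \<rho>] unfolding open_contains_ball by blast
        then show "P z"
          unfolding P_def using vanish by (intro exI[of _ e']) auto
      qed
      have "openin (top_of_set unit_ball) (ball a \<rho>)"
        using \<rho>(2) U(2) by (intro open_subset) auto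
      moreover have "a \<in> ball a \<rho>" using \<rho>(1) by simp
      ultimately show "\<exists>V. openin (top_of_set unit_ball) V \<and> a \<in> V \<and> (\<forall>x\<in>V. \<forall>z\<in>V. P x \<longrightarrow> P z)"
        using step by (intro exI[of _ "ball a \<rho>"] conjI ballI impI)
    qed (use P0 w in \<open>simp_all add: convex_connected\<close>)
    have "cinner y y = 0"
    proof (rule cinner_closure_cspan_eq_0)
      show "y \<in> closure (cspan (\<Union>w\<in>unit_ball. joint_ker T w))"
        using T by (simp add: cowen_douglas_def)
      fix s assume "s \<in> (\<Union>w\<in>unit_ball. joint_ker T w)"
      then obtain w where w: "w \<in> unit_ball" "s \<in> joint_ker T w" by blast
      from P[OF w(1)] obtain e where "e > 0"
        "\<forall>w'\<in>ball w e. w' \<in> unit_ball \<longrightarrow> (\<forall>s\<in>joint_ker T w'. cinner s y = 0)"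
        unfolding P_def by blast
      then show "cinner s y = 0" using w by (meson centre_in_ball)
    qed
    then have "x = proj M x" by (simp add: y_def)
    then show "x \<in> M" using proj_in[OF M, of x] by simp
  qed
  then show ?thesis unfolding M_def by blast
qed

section \<open>Condition (C) and the similarity\<close>

lemma represents_of_kernel_function:
  assumes ev: "rkhs ev K" and w: "w \<in> unit_ball" and k: "\<And>z. z \<in> unit_ball \<Longrightarrow> ev k z = K z w *v \<xi>"
  shows "represents ev k w \<xi>"
proof -
  have "\<exists>k'. (\<forall>z\<in>unit_ball. ev k' z = K z w *v \<xi>) \<and> (\<forall>f. cinner f k' = cinner (ev f w) \<xi>)"
    using ev w unfolding rkhs_def by (elim conjE) simp
  then obtain k' where k': "\<And>z. z \<in> unit_ball \<Longrightarrow> ev k' z = K z w *v \<xi>"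
    "\<And>f. cinner f k' = cinner (ev f w) \<xi>" by blast
  have add: "\<And>f g z. z \<in> unit_ball \<Longrightarrow> ev (f + g) z = ev f z + ev g z"
    and scale: "\<And>c f z. z \<in> unit_ball \<Longrightarrow> ev (c *\<^sub>C f) z = c *\<^sub>C ev f z"
    and inj: "\<And>f. (\<forall>z\<in>unit_ball. ev f z = 0) \<Longrightarrow> f = 0"
    using ev unfolding rkhs_def by auto
  have "k + (-1) *\<^sub>C k' = 0"
  proof (rule inj, rule ballI)
    fix z :: "complex^'b" assume z: "z \<in> unit_ball"
    show "ev (k + (-1) *\<^sub>C k') z = 0"
      unfolding add[OF z] scale[OF z] k[OF z] k'(1)[OF z] by simp
  qed
  then have "k = k'" by simp
  then show ?thesis using k'(2) by (simp add: represents_def)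
qed

lemma norm_lincomb_eq:
  assumes eq: "\<And>p q. p \<in> P \<Longrightarrow> q \<in> P \<Longrightarrow> cinner (a p) (a q) = cinner (b p) (b q)" and xs: "snd ` set xs \<subseteq> P"
  shows "norm (lincomb a xs) = norm (lincomb b xs)"
proof -
  have 1: "cinner (lincomb a ys) (a q) = cinner (lincomb b ys) (b q)" if "snd ` set ys \<subseteq> P" "q \<in> P" for ys q
    using that by (induction ys) (auto simp: cinner_add_left eq)
  have "cinner (lincomb a xs) (lincomb a ys) = cinner (lincomb b xs) (lincomb b ys)"
    if "snd ` set ys \<subseteq> P" for ys
    using that by (induction ys) (auto simp: cinner_add_right 1[OF xs])
  from this[OF xs] have "complex_of_real ((norm (lincomb a xs))\<^sup>2) = of_real ((norm (lincomb b xs))\<^sup>2)"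
    by (simp only: cinner_self)
  then have "(norm (lincomb a xs))\<^sup>2 = (norm (lincomb b xs))\<^sup>2"
    using of_real_eq_iff by blast
  then show ?thesis by (simp add: power2_eq_iff_nonneg)
qed

lemma orthonormal_spans:
  fixes s :: "'r::finite \<Rightarrow> complex^'r"
  assumes "orthonormal_on UNIV s"
  shows "x \<in> cspan (range s)"
proof -
  define \<sigma> where "\<sigma> i w = s i" for i and w :: unit
  have ss: "cinner (s j) (s i) = (if j = i then 1 else 0)" for i j
    using assms by (auto simp: orthonormal_on_def)
  have co: "cinner (comb \<sigma> () c) (s i) = c $ i" for c i
    by (simp add: comb_def \<sigma>_def cinner_sum_left ss if_distrib[of "\<lambda>x. _ * x"] cong: if_cong)
  define M :: "complex^'r^'r" where "M = (\<chi> l j. s j $ l)"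
  have M: "comb \<sigma> () c = M *v c" for c
    by (simp add: comb_def \<sigma>_def M_def matrix_vector_mult_def vec_eq_iff mult.commute)
  have "c = 0" if "M *v c = 0" for c
  proof -
    have "c $ i = 0" for i
      using co[of c i] unfolding M that by simp
    then show ?thesis by (simp add: vec_eq_iff)
  qed
  then obtain M' where "M' ** M = mat 1"
    using matrix_left_invertible_ker[of M] by blast
  then have "M ** M' = mat 1" using matrix_left_right_inverse by blast
  then have "x = comb \<sigma> () (M' *v x)"
    by (simp add: M matrix_vector_mul_assoc)
  then show ?thesis
    using comb_in_cspan[of \<sigma> "()" "M' *v x"] by (simp add: \<sigma>_def)
qed

lemma separable_frame_span:
  fixes f :: "'r::finite \<Rightarrow> complex^'m::finite \<Rightarrow> 'e::complex_hilbert"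
  assumes f: "\<And>i. holo_on unit_ball (f i)"
  obtains q :: "nat \<Rightarrow> 'e" where "closure (cspan (\<Union>w\<in>unit_ball. range (\<lambda>i. f i w))) = closure (cspan (range q))"
proof -
  obtain D :: "(complex^'m) set" where D: "countable D" "D \<subseteq> unit_ball" "unit_ball \<subseteq> closure D"
    using separable by blast
  define Q where "Q = (\<Union>w\<in>D. range (\<lambda>i. f i w))"
  have "D \<noteq> {}"
  proof
    assume "D = {}"
    then have "unit_ball = ({} :: (complex^'m) set)" using D(3) by simp
    then show False by (metis centre_in_ball empty_iff zero_less_one)
  qed
  then have Q: "countable Q" "Q \<noteq> {}" using D(1) by (auto simp: Q_def)
  have "f i w \<in> closure (cspan Q)" if w: "w \<in> unit_ball" for i w
  proof -
    obtain x where x: "\<And>n. x n \<in> D" "x \<longlonglongrightarrow> w"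
      using D(3) w closure_sequential[of w D] by auto
    have "isCont (f i) w"
      using holo_onD(1)[OF f w] has_derivative_continuous by blast
    then have "(\<lambda>n. f i (x n)) \<longlonglongrightarrow> f i w"
      using x(2) by (rule isCont_tendsto_compose)
    moreover have "f i (x n) \<in> closure (cspan Q)" for n
      by (rule subsetD[OF closure_subset], rule subsetD[OF cspan_superset]) (use x(1) in \<open>auto simp: Q_def\<close>)
    ultimately show ?thesis
      using closed_sequentially[OF closed_closure, of "\<lambda>n. f i (x n)"] by blast
  qed
  then have "closure (cspan (\<Union>w\<in>unit_ball. range (\<lambda>i. f i w))) \<subseteq> closure (cspan Q)"
    by (intro closure_cspan_minimal csubspace_closure csubspace_cspan closed_closure) auto
  moreover have "closure (cspan Q) \<subseteq> closure (cspan (\<Union>w\<in>unit_ball. range (\<lambda>i. f i w)))"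
    using D(2) unfolding Q_def by (intro closure_mono cspan_mono) blast
  moreover have "range (from_nat_into Q) = Q"
    by (rule range_from_nat_into[OF Q(2,1)])
  ultimately show ?thesis
    using that[of "from_nat_into Q"] by simp
qed

lemma total_sequence_UNIV:
  obtains q :: "nat \<Rightarrow> complex^'r" where "UNIV = closure (cspan (range q))"
proof -
  let ?Q = "range (\<lambda>i. axis i 1 :: complex^'r)"
  have "x \<in> cspan ?Q" for x
  proof -
    define \<sigma> where "\<sigma> i w = (axis i 1 :: complex^'r)" for i and w :: unit
    have x: "comb \<sigma> () x = x"
      by (simp add: \<sigma>_def comb_def vec_eq_iff axis_def if_distrib cong: if_cong)
    show ?thesis using comb_in_cspan[of \<sigma> "()" x] unfolding x by (simp add: \<sigma>_def)
  qed
  then have "closure (cspan ?Q) = UNIV" using closure_subset by blast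
  moreover have "range (from_nat_into ?Q) = ?Q"
    by (rule range_from_nat_into) auto
  ultimately show ?thesis using that[of "from_nat_into ?Q"] by simp
qed

text \<open>Condition (C) provides fibrewise isomorphisms \<open>G w\<close> onto the constant fibre such that
  \<open>k \<otimes> x \<mapsto> k \<otimes> G w x\<close> is bounded above and below on the span of the eigenvectors: the bound above
  comes from the multiplier of \<open>G\<close>, the bound below from that of \<open>F\<close>.\<close>

lemma condition_C_bounds:
  fixes ev :: "'k::complex_hilbert \<Rightarrow> complex^'m::finite \<Rightarrow> complex^'d"
    and E :: "complex^'m \<Rightarrow> 'e::complex_hilbert set"
    and tens :: "'k \<Rightarrow> 'e \<Rightarrow> 't::complex_hilbert"
  assumes ev: "rkhs ev K" and t: "hilbert_tensor tens" and C: "condition_C TYPE('r::finite) ev E"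
  defines "valid \<equiv> \<lambda>(w, k, x). w \<in> unit_ball \<and> (\<exists>\<xi>. represents ev k (cnj_vec w) \<xi>) \<and> x \<in> E w"
  obtains G :: "complex^'m \<Rightarrow> 'e \<Rightarrow> complex^'r" and C1 C2
  where "\<And>w. w \<in> unit_ball \<Longrightarrow> csubspace (E w)"
    "\<And>w. w \<in> unit_ball \<Longrightarrow> bounded_op_on (E w) UNIV (G w)"
    "\<And>w c. w \<in> unit_ball \<Longrightarrow> \<exists>x\<in>E w. G w x = c"
    "\<And>xs. \<forall>p\<in>set xs. valid p \<Longrightarrow>
       norm (\<Sum>(w, k, x)\<leftarrow>xs. vec_tensor k (G w x)) \<le> C1 * norm (\<Sum>(w, k, x)\<leftarrow>xs. tens k x)"
    "\<And>xs. \<forall>p\<in>set xs. valid p \<Longrightarrow>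
       norm (\<Sum>(w, k, x)\<leftarrow>xs. tens k x) \<le> C2 * norm (\<Sum>(w, k, x)\<leftarrow>xs. vec_tensor k (G w x))"
proof -
  obtain f :: "'r \<Rightarrow> complex^'m \<Rightarrow> 'e" and s :: "'r \<Rightarrow> complex^'r" and S F G where
    frame: "holo_frame unit_ball E f" and s: "orthonormal_on UNIV s"
    and S_def: "S = closure (cspan (\<Union>w\<in>unit_ball. range (\<lambda>i. f i w)))"
    and F: "Hinf unit_ball UNIV S F" and G: "Hinf unit_ball S UNIV G"
    and Fs: "\<forall>w\<in>unit_ball. \<forall>i. F w (s i) = f i w"
    and multF: "(\<lambda>z. adjoint_on UNIV (F (cnj_vec z))) \<in> Mult ev S UNIV"
    and multG: "(\<lambda>z. adjoint_on S (G (cnj_vec z))) \<in> Mult ev UNIV S"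
    and GF: "\<forall>w\<in>unit_ball. \<forall>x. G w (F w x) = x"
    using C unfolding condition_C_def Let_def by blast
  have bF: "bounded_op_on UNIV S (F w)" and bG: "bounded_op_on S UNIV (G w)" if "w \<in> unit_ball" for w
    using F G that by (auto simp: Hinf_def)
  have Ew: "E w = cspan (range (\<lambda>i. f i w))" if "w \<in> unit_ball" for w
    using frame that by (simp add: holo_frame_def)
  have subE: "csubspace (E w)" if "w \<in> unit_ball" for w
    unfolding Ew[OF that] by simp
  have S: "csubspace S" "closed S" by (simp_all add: S_def csubspace_closure)
  have ES: "E w \<subseteq> S" if w: "w \<in> unit_ball" for w
  proof -
    have "cspan (range (\<lambda>i. f i w)) \<subseteq> cspan (\<Union>w\<in>unit_ball. range (\<lambda>i. f i w))"
      by (rule cspan_mono) (use w in blast)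
    then show ?thesis
      unfolding Ew[OF w] S_def using closure_subset by blast
  qed
  have FE: "F w c \<in> E w" if w: "w \<in> unit_ball" for w c
  proof -
    have "cspan (range s) \<subseteq> {c. F w c \<in> E w}"
    proof (rule cspan_minimal)
      show "range s \<subseteq> {c. F w c \<in> E w}"
      proof clarify
        fix i
        show "F w (s i) \<in> E w"
          unfolding Ew[OF w] using Fs w subsetD[OF cspan_superset, of "f i w" "range (\<lambda>i. f i w)"] by simp
      qed
      show "csubspace {c. F w c \<in> E w}"
        using bounded_opD(2,3)[OF bF[OF w]] bounded_opD(5)[OF bF[OF w]] csubspaceD[OF subE[OF w]]
        by (auto simp: complex_vector.subspace_def)
    qed
    then show ?thesis using orthonormal_spans[OF s, of c] by blast
  qed
  have FG: "F w (G w x) = x" if w: "w \<in> unit_ball" and x: "x \<in> E w" for w x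
  proof -
    have "cspan (range (\<lambda>i. f i w)) \<subseteq> {x \<in> S. F w (G w x) = x}"
    proof (rule cspan_minimal)
      show "range (\<lambda>i. f i w) \<subseteq> {x \<in> S. F w (G w x) = x}"
      proof clarify
        fix i
        have "f i w \<in> E w" unfolding Ew[OF w] by (rule subsetD[OF cspan_superset]) simp
        then have "f i w \<in> S" using ES[OF w] by blast
        moreover have "F w (G w (f i w)) = f i w" using Fs GF w by metis
        ultimately show "f i w \<in> S \<and> F w (G w (f i w)) = f i w" by blast
      qed
      show "csubspace {x \<in> S. F w (G w x) = x}"
        using bounded_opD(2,3)[OF bF[OF w]] bounded_opD(5)[OF bF[OF w]]
          bounded_opD(2,3)[OF bG[OF w]] bounded_opD(5)[OF bG[OF w] S(1)] csubspaceD(1-3)[OF S(1)]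
        by (auto simp: complex_vector.subspace_def)
    qed
    then show ?thesis using x Ew[OF w] by blast
  qed
  have hf: "\<And>i. holo_on unit_ball (f i)" using frame by (simp add: holo_frame_def)
  obtain q :: "nat \<Rightarrow> 'e" where "closure (cspan (\<Union>w\<in>unit_ball. range (\<lambda>i. f i w))) = closure (cspan (range q))"
    by (rule separable_frame_span[of f, OF hf]) (rule that)
  then have q: "S = closure (cspan (range q))"
    by (simp only: S_def)
  obtain q' :: "nat \<Rightarrow> complex^'r" where q': "UNIV = closure (cspan (range q'))"
    by (rule total_sequence_UNIV) (rule that)
  obtain C1 where "C1 \<ge> 0" and C1: "\<forall>xs. (\<forall>p\<in>set xs. (\<lambda>(w, k, e). w \<in> unit_ball \<and>
      (\<exists>\<xi>. represents ev k (cnj_vec w) \<xi>) \<and> e \<in> S) p) \<longrightarrow>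
    norm (\<Sum>(w, k, e)\<leftarrow>xs. vec_tensor k (G w e)) \<le> C1 * norm (\<Sum>(w, k, e)\<leftarrow>xs. tens k e)"
    by (rule exE[OF multiplier_adjoint_bound[OF ev hilbert_tensor_vec_tensor t q' S bG multG]],
        assumption, elim conjE, rule that)
  obtain C2 where "C2 \<ge> 0" and C2: "\<forall>xs. (\<forall>p\<in>set xs. (\<lambda>(w, k, e). w \<in> unit_ball \<and>
      (\<exists>\<xi>. represents ev k (cnj_vec w) \<xi>) \<and> e \<in> UNIV) p) \<longrightarrow>
    norm (\<Sum>(w, k, e)\<leftarrow>xs. tens k (F w e)) \<le> C2 * norm (\<Sum>(w, k, e)\<leftarrow>xs. vec_tensor k e)"
    by (rule exE[OF multiplier_adjoint_bound[OF ev t hilbert_tensor_vec_tensor q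
            csubspace_UNIV closed_UNIV bF multF]], assumption, elim conjE, rule that)
  show ?thesis
  proof (rule that[of G C1 C2])
    show "csubspace (E w)" if "w \<in> unit_ball" for w by (rule subE[OF that])
    show "bounded_op_on (E w) UNIV (G w)" if "w \<in> unit_ball" for w
      using bG[OF that] ES[OF that] unfolding bounded_op_on_def by blast
    show "\<exists>x\<in>E w. G w x = c" if "w \<in> unit_ball" for w c
      using FE[OF that] GF that by blast
    fix xs assume v: "\<forall>p\<in>set xs. valid p"
    show "norm (\<Sum>(w, k, x)\<leftarrow>xs. vec_tensor k (G w x)) \<le> C1 * norm (\<Sum>(w, k, x)\<leftarrow>xs. tens k x)"
      by (rule C1[rule_format]) (use v ES in \<open>force simp: valid_def\<close>)
    define ys where "ys = map (\<lambda>(w, k, x). (w, k, G w x)) xs"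
    have "norm (\<Sum>(w, k, e)\<leftarrow>ys. tens k (F w e)) \<le> C2 * norm (\<Sum>(w, k, e)\<leftarrow>ys. vec_tensor k e)"
      by (rule C2[rule_format]) (use v in \<open>force simp: valid_def ys_def\<close>)
    moreover have "(\<Sum>(w, k, e)\<leftarrow>ys. tens k (F w e)) = (\<Sum>(w, k, x)\<leftarrow>xs. tens k x)"
      unfolding ys_def using v by (induction xs) (auto simp: valid_def FG)
    moreover have "(\<Sum>(w, k, e)\<leftarrow>ys. vec_tensor k e) = (\<Sum>(w, k, x)\<leftarrow>xs. vec_tensor k (G w x))"
      unfolding ys_def by (induction xs) auto
    ultimately show "norm (\<Sum>(w, k, x)\<leftarrow>xs. tens k x) \<le> C2 * norm (\<Sum>(w, k, x)\<leftarrow>xs. vec_tensor k (G w x))"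
      by simp
  qed
qed

lemma curvature_endo_some_frame:
  fixes E :: "complex^'m \<Rightarrow> 'a::complex_inner set"
  assumes "\<exists>(\<sigma> :: 'n::finite \<Rightarrow> complex^'m \<Rightarrow> 'a) U. w \<in> U \<and> holo_frame U E \<sigma>"
  obtains U and \<sigma> :: "'n::finite \<Rightarrow> complex^'m \<Rightarrow> 'a"
  where "holo_frame U E \<sigma>" "w \<in> U"
    "\<And>I J i j. curvature_endo TYPE('n) E I J i j w
       = frame_endo \<sigma> w (curvature_derivative_matrix (gram \<sigma>) I J i j w)"
proof -
  define \<sigma> where "\<sigma> = (SOME \<sigma> :: 'n \<Rightarrow> complex^'m \<Rightarrow> 'a. \<exists>U. w \<in> U \<and> holo_frame U E \<sigma>)"
  have "\<exists>U. w \<in> U \<and> holo_frame U E \<sigma>"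
    unfolding \<sigma>_def by (rule someI_ex[OF assms])
  then obtain U where "w \<in> U" "holo_frame U E \<sigma>" by blast
  moreover have "curvature_endo TYPE('n) E I J i j w
       = frame_endo \<sigma> w (curvature_derivative_matrix (gram \<sigma>) I J i j w)" for I J i j
    unfolding curvature_endo_def \<sigma>_def Let_def ..
  ultimately show ?thesis
    by (intro that[of U \<sigma>])
qed

lemma comb_mult: "comb \<tau> w (M *v c) = (\<Sum>j\<in>UNIV. (c $ j) *\<^sub>C comb \<tau> w (M *v axis j 1))"
  using bounded_op_comb[where \<sigma> = "\<lambda>j w. comb \<tau> w (M *v axis j 1)" and \<tau> = \<tau> and w = w and v = w
      and A = M and c = c, OF bounded_op_id csubspace_UNIV UNIV_I refl]
  by (simp add: comb_def)

lemma sum_list_expand: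
  assumes t: "hilbert_tensor tens" and ls: "distinct ls" "set ls = UNIV"
  shows "(\<Sum>(w, k, x)\<leftarrow>concat (map (\<lambda>(c, p). map (\<lambda>l. (W p, (c * n p l) *\<^sub>C k p l, e p l)) ls) xs). tens k (g w x))
    = lincomb (\<lambda>p. \<Sum>l\<in>UNIV. n p l *\<^sub>C tens (k p l) (g (W p) (e p l))) xs"
proof (induction xs)
  case (Cons cp xs)
  obtain c p where cp: "cp = (c, p)" by (cases cp)
  have "(\<Sum>(w, k, x)\<leftarrow>map (\<lambda>l. (W p, (c * n p l) *\<^sub>C k p l, e p l)) ls. tens k (g w x))
      = (\<Sum>l\<leftarrow>ls. c *\<^sub>C (n p l *\<^sub>C tens (k p l) (g (W p) (e p l))))"
    by (simp add: o_def hilbert_tensorD(3)[OF t] scaleC_scaleC)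
  also have "\<dots> = c *\<^sub>C (\<Sum>l\<in>UNIV. n p l *\<^sub>C tens (k p l) (g (W p) (e p l)))"
    unfolding scaleC_sum_right using sum.distinct_set_conv_list[OF ls(1)] ls(2) by metis
  finally show ?case
    using Cons.IH by (simp add: cp)
qed simp

lemma vec_tensor_total:
  fixes S :: "('k::complex_hilbert^'r) set"
  assumes S: "csubspace S" "closed S" and total: "closure (cspan A) = UNIV"
    and A: "\<And>k c. k \<in> A \<Longrightarrow> vec_tensor k c \<in> S"
  shows "y \<in> S"
proof -
  have "vec_tensor k c \<in> S" for k c
  proof -
    have b: "bounded_op (\<lambda>k::'k. vec_tensor k c)"
      by (rule bounded_op_tensor(1)[OF hilbert_tensor_vec_tensor])
    have "closure (cspan A) \<subseteq> {k. vec_tensor k c \<in> S}"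
    proof (rule closure_cspan_minimal)
      show "csubspace {k. vec_tensor k c \<in> S}"
        using bounded_opD(2,3)[OF b] bounded_opD(5)[OF b csubspace_UNIV] csubspaceD(1-3)[OF S(1)]
        by (auto simp: complex_vector.subspace_def)
      have "closed ((\<lambda>k. vec_tensor k c) -` S)"
        using bounded_op_imp_bounded_linear[OF b] S(2)
        by (intro closed_vimage linear_continuous_on)
      then show "closed {k. vec_tensor k c \<in> S}" by (simp add: vimage_def)
    qed (use A in auto)
    then show ?thesis using total by auto
  qed
  then have "(\<Sum>l\<in>UNIV. vec_tensor (y $ l) (axis l 1)) \<in> S"
    by (intro complex_vector.subspace_sum S) auto
  moreover have "(\<Sum>l\<in>UNIV. vec_tensor (y $ l) (axis l 1)) = y"
    by (simp add: vec_eq_iff vec_tensor_def axis_def if_distrib[of "\<lambda>c. c *\<^sub>C _"] cong: if_cong)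
  ultimately show ?thesis by simp
qed

theorem theorem1p4:
  fixes T :: "'m::finite \<Rightarrow> 'h::{complex_hilbert, second_countable_topology} \<Rightarrow> 'h"
    and ev :: "'k::{complex_hilbert, second_countable_topology} \<Rightarrow> complex^'m \<Rightarrow> complex^'n1::finite"
    and K :: "complex^'m \<Rightarrow> complex^'m \<Rightarrow> complex^'n1^'n1"
    and E :: "complex^'m \<Rightarrow> 'e::complex_hilbert set"
    and tens :: "'k \<Rightarrow> 'e \<Rightarrow> 't::complex_hilbert"
    and V :: "complex^'m \<Rightarrow> 'h \<Rightarrow> 't"
  defines "Mz \<equiv> mult_coord_adjoint ev"
  assumes ranks: "CARD('n::finite) = CARD('n1) * CARD('n2::finite)"
    and T: "cowen_douglas unit_ball CARD('n) T"
    and H_K: "rkhs ev K"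
    and mult: "\<forall>i f. \<exists>g. \<forall>z\<in>unit_ball. ev g z = (z $ i) *\<^sub>C ev f z"
    and mult_bounded: "\<forall>i. bounded_op (mult_coord ev i)"
    and Mz: "cowen_douglas unit_ball CARD('n1) Mz"
    and ker_Mz: "\<forall>w\<in>unit_ball.
          joint_ker Mz w = {k. \<exists>\<xi>. \<forall>z\<in>unit_ball. ev k z = K z (cnj_vec w) *v \<xi>}"
    and E: "hermitian_holo_bundle TYPE('n2) unit_ball E"
    and tens: "hilbert_tensor tens"
    and V: "isometric_bundle_map unit_ball (joint_ker T) (tensor_bundle tens (joint_ker Mz) E) V"
    and curvature:
      "\<forall>w\<in>unit_ball. \<forall>I J i j. \<forall>k\<in>joint_ker Mz w. \<forall>e\<in>E w.
         V w (curvature_endo TYPE('n) (joint_ker T) I J i j w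
                (adjoint_on (joint_ker T w) (V w) (tens k e)))
           - tens (curvature_endo TYPE('n1) (joint_ker Mz) I J i j w k) e
         = tens k (curvature_endo TYPE('n2) E I J i j w e)"
    and condition_C: "condition_C TYPE('n2) ev E"
  shows "similar T (direct_sum_copies Mz :: 'm \<Rightarrow> 'k^'n2 \<Rightarrow> 'k^'n2)"
proof -
  have zero: "(0 :: complex^'m) \<in> unit_ball" by simp
  have exT: "\<exists>(\<sigma> :: 'n \<Rightarrow> complex^'m \<Rightarrow> 'h) U. 0 \<in> U \<and> holo_frame U (joint_ker T) \<sigma>"
    using joint_ker_frame[OF T open_ball zero] by blast
  have exM: "\<exists>(\<kappa> :: 'n1 \<Rightarrow> complex^'m \<Rightarrow> 'k) U. 0 \<in> U \<and> holo_frame U (joint_ker Mz) \<kappa>"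
    using joint_ker_frame[OF Mz open_ball zero] by blast
  have exE: "\<exists>(\<epsilon> :: 'n2 \<Rightarrow> complex^'m \<Rightarrow> 'e) U. 0 \<in> U \<and> holo_frame U E \<epsilon>"
    using E zero unfolding hermitian_holo_bundle_def by meson
  obtain U1 and \<sigma> :: "'n \<Rightarrow> complex^'m \<Rightarrow> 'h" where \<sigma>: "holo_frame U1 (joint_ker T) \<sigma>" "0 \<in> U1"
    and K1: "\<And>I J i j. curvature_endo TYPE('n) (joint_ker T) I J i j 0
      = frame_endo \<sigma> 0 (curvature_derivative_matrix (gram \<sigma>) I J i j 0)"
    by (rule curvature_endo_some_frame[OF exT]) (rule that)
  obtain U2 and \<kappa> :: "'n1 \<Rightarrow> complex^'m \<Rightarrow> 'k" where \<kappa>: "holo_frame U2 (joint_ker Mz) \<kappa>" "0 \<in> U2"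
    and K2: "\<And>I J i j. curvature_endo TYPE('n1) (joint_ker Mz) I J i j 0
      = frame_endo \<kappa> 0 (curvature_derivative_matrix (gram \<kappa>) I J i j 0)"
    by (rule curvature_endo_some_frame[OF exM]) (rule that)
  obtain U3 and \<epsilon> :: "'n2 \<Rightarrow> complex^'m \<Rightarrow> 'e" where \<epsilon>: "holo_frame U3 E \<epsilon>" "0 \<in> U3"
    and K3: "\<And>I J i j. curvature_endo TYPE('n2) E I J i j 0
      = frame_endo \<epsilon> 0 (curvature_derivative_matrix (gram \<epsilon>) I J i j 0)"
    by (rule curvature_endo_some_frame[OF exE]) (rule that)
  have "card (UNIV :: 'n set) = card (UNIV :: ('n1 \<times> 'n2) set)"
    using ranks by simp
  then obtain \<beta> :: "'n \<Rightarrow> 'n1 \<times> 'n2" where \<beta>: "bij \<beta>"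
    using finite_same_card_bij[OF finite finite] by blast
  have V0: "bounded_op_on (joint_ker T 0) (tensor_bundle tens (joint_ker Mz) E 0) (V 0)"
    and iso: "\<And>x. x \<in> joint_ker T 0 \<Longrightarrow> norm (V 0 x) = norm x"
    using V zero unfolding isometric_bundle_map_def by blast+
  have curv: "V 0 (frame_endo \<sigma> 0 (curvature_derivative_matrix (gram \<sigma>) I J i j 0)
        (adjoint_on (joint_ker T 0) (V 0) (tens k e)))
      - tens (frame_endo \<kappa> 0 (curvature_derivative_matrix (gram \<kappa>) I J i j 0) k) e
      = tens k (frame_endo \<epsilon> 0 (curvature_derivative_matrix (gram \<epsilon>) I J i j 0) e)"
    if "k \<in> joint_ker Mz 0" "e \<in> E 0" for I J i j k e
    using curvature zero that unfolding K1[symmetric] K2[symmetric] K3[symmetric] by blast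
  define \<tau> where "\<tau> = tensor_frame \<beta> tens \<kappa> \<epsilon>"
  obtain r N where r: "r > 0" "ball 0 r \<subseteq> U1 \<inter> U2 \<inter> U3"
    and N: "\<And>z. z \<in> ball 0 r \<Longrightarrow> invertible (N z)"
    and gram_eq: "\<And>z w i j. z \<in> ball 0 r \<Longrightarrow> w \<in> ball 0 r \<Longrightarrow> cinner (\<sigma> j z) (\<sigma> i w)
        = cinner (comb \<tau> z (N z *v axis j 1)) (comb \<tau> w (N w *v axis i 1))"
    using local_equivalence[OF tens \<beta> \<sigma> \<kappa> \<epsilon> V0 iso curv] unfolding \<tau>_def by blast
  obtain G :: "complex^'m \<Rightarrow> 'e \<Rightarrow> complex^'n2" and C1 C2 where
    subE: "\<And>w. w \<in> unit_ball \<Longrightarrow> csubspace (E w)"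
    and bG: "\<And>w. w \<in> unit_ball \<Longrightarrow> bounded_op_on (E w) UNIV (G w)"
    and Gsurj: "\<And>w c. w \<in> unit_ball \<Longrightarrow> \<exists>x\<in>E w. G w x = c"
    and C1: "\<And>xs. \<forall>p\<in>set xs. (\<lambda>(w, k, x). w \<in> unit_ball \<and> (\<exists>\<xi>. represents ev k (cnj_vec w) \<xi>) \<and> x \<in> E w) p \<Longrightarrow>
       norm (\<Sum>(w, k, x)\<leftarrow>xs. vec_tensor k (G w x)) \<le> C1 * norm (\<Sum>(w, k, x)\<leftarrow>xs. tens k x)"
    and C2: "\<And>xs. \<forall>p\<in>set xs. (\<lambda>(w, k, x). w \<in> unit_ball \<and> (\<exists>\<xi>. represents ev k (cnj_vec w) \<xi>) \<and> x \<in> E w) p \<Longrightarrow>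
       norm (\<Sum>(w, k, x)\<leftarrow>xs. tens k x) \<le> C2 * norm (\<Sum>(w, k, x)\<leftarrow>xs. vec_tensor k (G w x))"
    using condition_C_bounds[OF H_K tens condition_C] by blast
  define s where "s = min r 1"
  have s: "s > 0" "ball 0 s \<subseteq> (unit_ball :: (complex^'m) set)" "ball 0 s \<subseteq> ball (0 :: complex^'m) r"
    using r(1) by (auto simp: s_def)
  have in_unit: "w \<in> unit_ball" and in_r: "w \<in> ball 0 r" if "w \<in> ball 0 s" for w :: "complex^'m"
    using that s by blast+
  have ker_T: "joint_ker T w = range (comb \<sigma> w)" and ker_M: "joint_ker Mz w = range (comb \<kappa> w)"
    and Ew: "E w = range (comb \<epsilon> w)" if "w \<in> ball 0 s" for w
    using \<sigma>(1) \<kappa>(1) \<epsilon>(1) r(2) in_r[OF that]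
    unfolding holo_frame_def cspan_range_eq_comb by blast+
  have \<sigma>_in: "\<sigma> j w \<in> joint_ker T w" and \<kappa>_in: "\<kappa> l w \<in> joint_ker Mz w" and \<epsilon>_in: "\<epsilon> m w \<in> E w"
    if "w \<in> ball 0 s" for j l m w
    unfolding ker_T[OF that] ker_M[OF that] Ew[OF that] using comb_axis by (metis rangeI)+
  have repr: "\<exists>\<xi>. represents ev k (cnj_vec w) \<xi>" if w: "w \<in> ball 0 s" and k: "k \<in> joint_ker Mz w" for k w
  proof -
    obtain \<xi> where "\<forall>z\<in>unit_ball. ev k z = K z (cnj_vec w) *v \<xi>"
      using ker_Mz in_unit[OF w] k by auto
    moreover have "cnj_vec w \<in> unit_ball" using in_unit[OF w] by simp
    ultimately show ?thesis
      using represents_of_kernel_function[OF H_K] by blast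
  qed
  have bT: "\<And>i. bounded_op (T i)" and bM: "\<And>i. bounded_op (Mz i)"
    using T Mz by (auto simp: cowen_douglas_def)
  \<comment> \<open>the three families of eigenvectors, indexed by a point and a frame index\<close>
  define P where "P = ball (0 :: complex^'m) s \<times> (UNIV :: 'n set)"
  define a where "a p = \<sigma> (snd p) (fst p)" for p
  define t where "t p = comb \<tau> (fst p) (N (fst p) *v axis (snd p) 1)" for p
  define \<tau>' where "\<tau>' = tensor_frame \<beta> vec_tensor \<kappa> (\<lambda>m w. G w (\<epsilon> m w))"
  define b where "b p = comb \<tau>' (fst p) (N (fst p) *v axis (snd p) 1)" for p
  have at: "norm (lincomb a xs) = norm (lincomb t xs)" if "snd ` set xs \<subseteq> P" for xs
  proof (rule norm_lincomb_eq[OF _ that])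
    fix p q assume "p \<in> P" "q \<in> P"
    then show "cinner (a p) (a q) = cinner (t p) (t q)"
      unfolding a_def t_def using in_r by (intro gram_eq) (auto simp: P_def)
  qed
  obtain ls :: "'n list" where ls: "set ls = UNIV" "distinct ls"
    using finite_distinct_list[OF finite] by blast
  define tri where "tri xs = concat (map (\<lambda>(c, p). map (\<lambda>l. (fst p, (c * N (fst p) $ l $ snd p) *\<^sub>C \<kappa> (fst (\<beta> l)) (fst p),
      \<epsilon> (snd (\<beta> l)) (fst p))) ls) xs)" for xs :: "(complex \<times> (complex^'m) \<times> 'n) list"
  have tri_t: "(\<Sum>(w, k, x)\<leftarrow>tri xs. tens k x) = lincomb t xs" for xs
    using sum_list_expand[OF tens ls(2,1), where W = fst and n = "\<lambda>p l. N (fst p) $ l $ snd p"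
        and k = "\<lambda>p l. \<kappa> (fst (\<beta> l)) (fst p)" and e = "\<lambda>p l. \<epsilon> (snd (\<beta> l)) (fst p)"
        and xs = xs and g = "\<lambda>w x. x"]
    by (simp add: tri_def t_def[abs_def] comb_def mult_axis_nth \<tau>_def tensor_frame_def)
  have tri_b: "(\<Sum>(w, k, x)\<leftarrow>tri xs. vec_tensor k (G w x)) = lincomb b xs" for xs
    using sum_list_expand[OF hilbert_tensor_vec_tensor ls(2,1), where W = fst and n = "\<lambda>p l. N (fst p) $ l $ snd p"
        and k = "\<lambda>p l. \<kappa> (fst (\<beta> l)) (fst p)" and e = "\<lambda>p l. \<epsilon> (snd (\<beta> l)) (fst p)"
        and xs = xs and g = G]
    by (simp add: tri_def b_def[abs_def] comb_def mult_axis_nth \<tau>'_def tensor_frame_def)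
  have tri_valid: "\<forall>p\<in>set (tri xs). (\<lambda>(w, k, x). w \<in> unit_ball \<and> (\<exists>\<xi>. represents ev k (cnj_vec w) \<xi>) \<and> x \<in> E w) p"
    if xs: "snd ` set xs \<subseteq> P" for xs
  proof
    fix q assume "q \<in> set (tri xs)"
    then obtain c p l where cp: "(c, p) \<in> set xs" and q: "q = (fst p,
        (c * N (fst p) $ l $ snd p) *\<^sub>C \<kappa> (fst (\<beta> l)) (fst p), \<epsilon> (snd (\<beta> l)) (fst p))"
      unfolding tri_def by auto
    have "snd (c, p) \<in> P" using cp xs by blast
    then have w: "fst p \<in> ball 0 s" by (auto simp: P_def)
    obtain \<xi> where "represents ev (\<kappa> (fst (\<beta> l)) (fst p)) (cnj_vec (fst p)) \<xi>"
      using repr[OF w \<kappa>_in[OF w]] by blast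
    from represents_scaleC[OF this]
    show "(\<lambda>(w, k, x). w \<in> unit_ball \<and> (\<exists>\<xi>. represents ev k (cnj_vec w) \<xi>) \<and> x \<in> E w) q"
      using in_unit[OF w] \<epsilon>_in[OF w] unfolding q by blast
  qed
  have ab: "norm (lincomb b xs) \<le> C1 * norm (lincomb a xs)"
    and ba: "norm (lincomb a xs) \<le> C2 * norm (lincomb b xs)" if "snd ` set xs \<subseteq> P" for xs
    using C1[OF tri_valid[OF that]] C2[OF tri_valid[OF that]] unfolding tri_t tri_b at[OF that] by blast+
  have "ball 0 s \<inter> unit_ball = (ball 0 s :: (complex^'m) set)" using s(2) by blast
  then have dense_T: "closure (cspan (\<Union>w\<in>ball 0 s. joint_ker T w)) = UNIV"
    and dense_M: "closure (cspan (\<Union>w\<in>ball 0 s. joint_ker Mz w)) = UNIV"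
    using dense_eigenspaces_small_ball[OF T s(1)] dense_eigenspaces_small_ball[OF Mz s(1)] by simp_all
  have total_a: "closure (cspan (a ` P)) = UNIV"
  proof -
    have "joint_ker T w \<subseteq> cspan (a ` P)" if w: "w \<in> ball 0 s" for w
    proof -
      have "range (\<lambda>j. \<sigma> j w) \<subseteq> a ` P"
        using w by (force simp: a_def P_def image_iff)
      then have "cspan (range (\<lambda>j. \<sigma> j w)) \<subseteq> cspan (a ` P)" by (rule cspan_mono)
      then show ?thesis unfolding ker_T[OF w] cspan_range_eq_comb .
    qed
    then have "(\<Union>w\<in>ball 0 s. joint_ker T w) \<subseteq> closure (cspan (a ` P))"
      using closure_subset by blast
    from closure_cspan_minimal[OF this csubspace_closure[OF csubspace_cspan] closed_closure]
    show ?thesis using dense_T by blast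
  qed
  have total_b: "closure (cspan (b ` P)) = UNIV"
  proof -
    define S where "S = closure (cspan (b ` P))"
    have S: "csubspace S" "closed S" by (simp_all add: S_def csubspace_closure)
    have \<tau>'S: "\<tau>' l w \<in> S" if w: "w \<in> ball 0 s" for l w
    proof -
      let ?c = "matrix_inv (N w) *v axis l 1"
      have bS: "b (w, j) \<in> S" for j
        unfolding S_def
        by (rule subsetD[OF closure_subset], rule subsetD[OF cspan_superset]) (use w in \<open>auto simp: P_def\<close>)
      have "\<tau>' l w = comb \<tau>' w (N w *v ?c)"
        by (simp add: matrix_vector_mul_assoc matrix_inv_right[OF N[OF in_r[OF w]]])
      also have "\<dots> = (\<Sum>j\<in>UNIV. (?c $ j) *\<^sub>C b (w, j))"
        by (subst comb_mult) (simp add: b_def)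
      also have "\<dots> \<in> S"
        by (rule complex_vector.subspace_sum[OF S(1)]) (rule csubspaceD(3)[OF S(1) bS])
      finally show ?thesis .
    qed
    have "vec_tensor k c \<in> S" if k: "k \<in> (\<Union>w\<in>ball 0 s. joint_ker Mz w)" for k c
    proof -
      obtain w where w: "w \<in> ball 0 s" "k \<in> joint_ker Mz w" using k by blast
      obtain d where d: "k = comb \<kappa> w d" using w(2) unfolding ker_M[OF w(1)] by blast
      obtain x where x: "x \<in> E w" "G w x = c" using Gsurj[OF in_unit[OF w(1)]] by blast
      obtain d' where d': "x = comb \<epsilon> w d'" using x(1) unfolding Ew[OF w(1)] by blast
      have "c = (\<Sum>m\<in>UNIV. (d' $ m) *\<^sub>C G w (\<epsilon> m w))"
        using bounded_op_sum[OF bG[OF in_unit[OF w(1)]] subE[OF in_unit[OF w(1)]], of UNIV "\<lambda>m. \<epsilon> m w" "\<lambda>m. d' $ m"]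
          \<epsilon>_in[OF w(1)] x(2)
        unfolding d' comb_def by simp
      then have "c = comb (\<lambda>m w. G w (\<epsilon> m w)) w d'" by (simp add: comb_def)
      then have "vec_tensor k c \<in> range (comb \<tau>' w)"
        unfolding d \<tau>'_def by (simp only: comb_tensor_in_cspan[OF hilbert_tensor_vec_tensor \<beta>])
      then have "vec_tensor k c \<in> cspan (range (\<lambda>l. \<tau>' l w))"
        unfolding cspan_range_eq_comb .
      moreover have "cspan (range (\<lambda>l. \<tau>' l w)) \<subseteq> S"
        by (rule cspan_minimal[OF _ S(1)]) (use \<tau>'S[OF w(1)] in auto)
      ultimately show ?thesis by blast
    qed
    then have "y \<in> S" for y
      by (rule vec_tensor_total[OF S dense_M])
    then show ?thesis unfolding S_def by blast
  qed
  show ?thesis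
  proof (rule similar_of_eigenvectors[OF bT _ total_a total_b, where \<mu> = "\<lambda>i p. fst p $ i"])
    show "bounded_op (direct_sum_copies Mz i :: 'k^'n2 \<Rightarrow> 'k^'n2)" for i
    proof -
      have nth: "bounded_op (\<lambda>x::'k^'n2. x $ l)" for l
        by (auto simp: bounded_op_on_def Finite_Cartesian_Product.norm_nth_le intro!: exI[of _ 1])
      show ?thesis
        unfolding direct_sum_copies_def[abs_def]
        by (rule bounded_op_vec, rule bounded_op_compose[OF bM nth])
    qed
    show "T i (a p) = (fst p $ i) *\<^sub>C a p" if "p \<in> P" for i p
    proof -
      have "a p \<in> joint_ker T (fst p)" unfolding a_def by (rule \<sigma>_in) (use that in \<open>auto simp: P_def\<close>)
      then show ?thesis by (simp add: joint_ker_def)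
    qed
    show "direct_sum_copies Mz i (b p) = (fst p $ i) *\<^sub>C b p" if p: "p \<in> P" for i p
    proof -
      have w: "fst p \<in> ball 0 s" using p by (auto simp: P_def)
      note sub = csubspace_joint_ker[of Mz "fst p", OF bM]
      have "b p $ l \<in> joint_ker Mz (fst p)" for l
        unfolding b_def comb_def \<tau>'_def tensor_frame_def vec_tensor_def sum_component scaleC_vec_nth vec_lambda_beta
        by (rule complex_vector.subspace_sum[OF sub], rule csubspaceD(3)[OF sub], rule csubspaceD(3)[OF sub \<kappa>_in[OF w]])
      then show ?thesis by (simp add: direct_sum_copies_def joint_ker_def vec_eq_iff)
    qed
  qed (use ab ba in auto)
qed

end
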